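(* Let $K_1, K_2, \dots, K_N$ be fields with $\mathbb{Q} \subseteq K_n \subseteq \overline{\mathbb{Q}}$ for each $n = 1, 2, \dots, N$, such that for each pair of integers $n_1 \neq n_2$ in $\{1,\dots,N\}$, either $K_{n_1}/(K_{n_1} \cap K_{n_2})$ is a (possibly infinite) Galois extension, or $K_{n_2}/(K_{n_1} \cap K_{n_2})$ is a (possibly infinite) Galois extension. Let $\alpha \in \overline{\mathbb{Q}}^{\times}$, and let $$\Gamma = \{\gamma \in \overline{\mathbb{Q}}^{\times} : \gamma^m \in K_1^{\times}K_2^{\times}\cdots K_N^{\times} \text{ for some integer } m \neq 0\}.$$ Then $h_{\Gamma}(\alpha) = 0$ if and only if $\alpha \in \Gamma$.
   Context: $\overline{\mathbb{Q}}$ is a fixed algebraic closure of $\mathbb{Q}$ and $h : \overline{\mathbb{Q}}^{\times} \to [0,\infty)$ is the absolute logarithmic Weil height. For a subgroup $\Gamma \subseteq \overline{\mathbb{Q}}^{\times}$ and $\alpha \in \overline{\mathbb{Q}}^{\times}$, $h_{\Gamma}(\alpha) = \inf_{\gamma \in \Gamma} h(\alpha/\gamma)$. The group $K_1^{\times}K_2^{\times}\cdots K_N^{\times}$ is the subgroup of $\overline{\mathbb{Q}}^{\times}$ consisting of all products $\beta_1\beta_2\cdots\beta_N$ with $\beta_n \in K_n^{\times}$. *)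

theory Defs
  imports "HOL-Analysis.Analysis" "HOL-Computational_Algebra.Computational_Algebra"
begin

text \<open>The fixed algebraic closure of the rationals is taken inside the complex numbers.\<close>

definition Qbar :: "complex set" where
  "Qbar = {z. algebraic z}"

definition is_subfield :: "complex set \<Rightarrow> bool" where
  "is_subfield K \<longleftrightarrow> 0 \<in> K \<and> 1 \<in> K \<and>
     (\<forall>x\<in>K. \<forall>y\<in>K. x + y \<in> K \<and> x * y \<in> K) \<and>
     (\<forall>x\<in>K. - x \<in> K \<and> inverse x \<in> K)"

definition rat_adjoin :: "complex \<Rightarrow> complex set" where
  "rat_adjoin \<alpha> = \<Inter>{F. is_subfield F \<and> \<alpha> \<in> F}"

definition field_degree :: "complex set \<Rightarrow> nat" where
  "field_degree K = vector_space.dim (\<lambda>(q::rat) (x::complex). of_rat q * x) K"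


subsection \<open>Galois extensions\<close>

definition field_automorphism :: "complex set \<Rightarrow> complex set \<Rightarrow> (complex \<Rightarrow> complex) \<Rightarrow> bool" where
  "field_automorphism K F \<sigma> \<longleftrightarrow> bij_betw \<sigma> K K \<and>
     (\<forall>x\<in>K. \<forall>y\<in>K. \<sigma> (x + y) = \<sigma> x + \<sigma> y \<and> \<sigma> (x * y) = \<sigma> x * \<sigma> y) \<and>
     (\<forall>x\<in>F. \<sigma> x = x)"

text \<open>A possibly infinite extension \<open>K/F\<close> is Galois if it is algebraic and \<open>F\<close> is the
  fixed field of the group of automorphisms of \<open>K\<close> over \<open>F\<close>.\<close>

definition galois_extension :: "complex set \<Rightarrow> complex set \<Rightarrow> bool" where
  "galois_extension K F \<longleftrightarrow> is_subfield K \<and> is_subfield F \<and> F \<subseteq> K \<and>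
     (\<forall>x\<in>K. \<exists>p. p \<noteq> 0 \<and> (\<forall>i. coeff p i \<in> F) \<and> poly p x = 0) \<and>
     {x \<in> K. \<forall>\<sigma>. field_automorphism K F \<sigma> \<longrightarrow> \<sigma> x = x} = F"


subsection \<open>Places of a number field\<close>

text \<open>Extensionality makes an absolute value on \<open>K\<close> a unique HOL function.\<close>

definition absolute_value :: "complex set \<Rightarrow> (complex \<Rightarrow> real) \<Rightarrow> bool" where
  "absolute_value K v \<longleftrightarrow> v \<in> extensional K \<and>
     (\<forall>x\<in>K. 0 \<le> v x \<and> (v x = 0 \<longleftrightarrow> x = 0)) \<and>
     (\<forall>x\<in>K. \<forall>y\<in>K. v (x * y) = v x * v y \<and> v (x + y) \<le> v x + v y)"

text \<open>Each place of \<open>K\<close> is represented by its unique member extending the usual absolute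
  value or a \<open>p\<close>-adic absolute value of the rationals, the latter normalised by
  \<open>\<bar>p\<bar> = 1/p\<close>. By multiplicativity it suffices to prescribe the values on integers.\<close>

definition archimedean_place :: "complex set \<Rightarrow> (complex \<Rightarrow> real) \<Rightarrow> bool" where
  "archimedean_place K v \<longleftrightarrow> absolute_value K v \<and>
     (\<forall>a::int. v (of_int a) = real_of_int \<bar>a\<bar>)"

definition padic_place :: "nat \<Rightarrow> complex set \<Rightarrow> (complex \<Rightarrow> real) \<Rightarrow> bool" where
  "padic_place p K v \<longleftrightarrow> absolute_value K v \<and>
     (\<forall>a::int. a \<noteq> 0 \<longrightarrow> v (of_int a) = 1 / real p ^ multiplicity (int p) a)"

definition places :: "complex set \<Rightarrow> (complex \<Rightarrow> real) set" where
  "places K = {v. archimedean_place K v \<or> (\<exists>p. prime p \<and> padic_place p K v)}"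

text \<open>The completion of \<open>K\<close> at \<open>v\<close> consists of the \<open>v\<close>-Cauchy sequences in \<open>K\<close>
  modulo the \<open>v\<close>-null sequences. The local degree \<open>[K\<^sub>v : \<rat>\<^sub>v]\<close> is the dimension of
  that completion over the completion of \<open>\<rat>\<close>, that is, the least number of elements
  \<open>b 0, \<dots>, b (n - 1)\<close> of \<open>K\<^sub>v\<close> that span it over \<open>\<rat>\<^sub>v\<close>. Elements of both
  completions are written as representing sequences.\<close>

definition cauchy_seqs :: "complex set \<Rightarrow> (complex \<Rightarrow> real) \<Rightarrow> (nat \<Rightarrow> complex) set" where
  "cauchy_seqs F v = {x. (\<forall>k. x k \<in> F) \<and>
     (\<forall>\<epsilon>>0. \<exists>M. \<forall>i\<ge>M. \<forall>j\<ge>M. v (x i - x j) < \<epsilon>)}"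

definition local_degree :: "complex set \<Rightarrow> (complex \<Rightarrow> real) \<Rightarrow> nat" where
  "local_degree K v = (LEAST n. \<exists>b :: nat \<Rightarrow> nat \<Rightarrow> complex.
     (\<forall>i<n. b i \<in> cauchy_seqs K v) \<and>
     (\<forall>x\<in>cauchy_seqs K v. \<exists>c :: nat \<Rightarrow> nat \<Rightarrow> complex.
        (\<forall>i<n. c i \<in> cauchy_seqs \<rat> v) \<and>
        (\<lambda>k. v (x k - (\<Sum>i<n. c i k * b i k))) \<longlonglongrightarrow> 0))"


subsection \<open>Heights\<close>

text \<open>The absolute logarithmic Weil height
  \<open>h(\<alpha>) = \<Sum>\<^sub>v [K\<^sub>v : \<rat>\<^sub>v] / [K : \<rat>] \<cdot> log max(1, \<bar>\<alpha>\<bar>\<^sub>v)\<close>, which does not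
  depend on the number field \<open>K\<close> containing \<open>\<alpha>\<close>; here \<open>K = \<rat>(\<alpha>)\<close>. Only finitely
  many terms of the sum are nonzero.\<close>

definition weil_height :: "complex \<Rightarrow> real" where
  "weil_height \<alpha> = (let K = rat_adjoin \<alpha> in
     \<Sum>\<^sub>\<infinity>v\<in>places K.
       real (local_degree K v) / real (field_degree K) * ln (max 1 (v \<alpha>)))"

definition relative_height :: "complex set \<Rightarrow> complex \<Rightarrow> real" where
  "relative_height \<Gamma> \<alpha> = (INF \<gamma>\<in>\<Gamma>. weil_height (\<alpha> / \<gamma>))"


subsection \<open>Products of multiplicative groups\<close>

definition mult_group_product :: "nat \<Rightarrow> (nat \<Rightarrow> complex set) \<Rightarrow> complex set" where
  "mult_group_product N K =
     {(\<Prod>n=1..N. \<beta> n) | \<beta>. \<forall>n\<in>{1..N}. \<beta> n \<in> K n - {0}}"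

end

theory Submission
  imports Defs
begin

text \<open>
  For \<open>y\<close> in \<open>Qbar\<close> and a finite set of places of \<open>\<rat>\<close>, extended to \<open>Qbar\<close>, let \<open>avg y\<close> be the
  average over the conjugates \<open>z\<close> of \<open>y\<close> of the sums of \<open>\<bar>log \<bar>z\<bar>\<bar>\<close>. It is a seminorm, and
  \<open>avg y \<le> 2 h(y)\<close> by the product formula, since the local degree at a place \<open>v\<close> is at least the number
  of embeddings that induce \<open>v\<close>; this inequality suffices, so completions need not be constructed.

  Let \<open>L\<close> be the normal closure of \<open>\<rat>(\<alpha>)\<close>. The map \<open>x \<mapsto> x ^ T / N x\<close> on \<open>L\<close>, with \<open>N\<close> the product
  over the \<open>T\<close> restrictions to \<open>L\<close> of the automorphisms over \<open>K i\<close>, is trivial on \<open>K i\<close> and, by the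
  Galois hypothesis, preserves every \<open>K j\<close>. The composite \<open>E\<close> of these maps is therefore trivial on all
  \<open>K i\<close>, while \<open>E \<alpha>\<close> differs from a power of \<open>\<alpha>\<close> by an element of the product of the \<open>K i\<close>. Taking
  norms to \<open>L\<close>, which preserve each \<open>K i\<close>, gives \<open>avg (E \<alpha>) \<le> C avg (\<alpha>/\<gamma>)\<close> for \<open>\<gamma>\<close> in \<open>\<Gamma>\<close> with \<open>C\<close>
  independent of \<open>\<gamma>\<close>. If \<open>h\<^sub>\<Gamma>(\<alpha>) = 0\<close>, then \<open>E \<alpha>\<close> has absolute value \<open>1\<close> at all places, so it is a
  root of unity by Kronecker's theorem, and a power of \<open>\<alpha>\<close> lies in the product of the \<open>K i\<close>.
\<close>

section \<open>Subfields and linear systems\<close>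

text \<open>The elements of \<open>\<Gamma>\<close> lie in no common number field, so a bound
  obtained inside a field containing \<open>\<gamma>\<close> could a priori worsen with the degree
  of that field. Homogeneity removes the danger. The norm from a large level down to the level of
  \<open>\<alpha>\<close> raises \<open>\<alpha>\<close> itself to the degree \<open>u\<close> of
  that norm, and it multiplies \<open>avg\<close> of the quotient \<open>\<alpha> / \<gamma>\<close>
  by at most \<open>u\<close>; since \<open>avg\<close> turns powers into multiples exactly, both
  sides carry the same factor \<open>u\<close>, which cancels. The exponent \<open>m\<close> with
  \<open>\<gamma> ^ m\<close> in the product of the fields cancels in the same way.

  The composite of the maps is trivial on every field for the following reason: the maps applied
  before the one for \<open>K j\<close> keep an element of \<open>K j\<close> inside
  \<open>K j\<close>, that one sends it to 1, and the later ones fix 1.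

  Absolute values on \<open>Qbar\<close> above a prime \<open>p\<close> are obtained without any
  tower of extensions, by Chevalley's method: a subring of \<open>Qbar\<close> maximal among those
  that omit \<open>1/p\<close> is a valuation ring, and algebraicity over the rationals makes its
  valuation real-valued.\<close>

locale cfield =
  fixes F :: "complex set"
  assumes subfield: "is_subfield F"
begin

lemma zero: "0 \<in> F" and one: "1 \<in> F"
  and add: "x \<in> F \<Longrightarrow> y \<in> F \<Longrightarrow> x + y \<in> F"
  and mult: "x \<in> F \<Longrightarrow> y \<in> F \<Longrightarrow> x * y \<in> F"
  and uminus: "x \<in> F \<Longrightarrow> - x \<in> F"
  and inv: "x \<in> F \<Longrightarrow> inverse x \<in> F"
  using subfield unfolding is_subfield_def by auto

lemma diff: "x \<in> F \<Longrightarrow> y \<in> F \<Longrightarrow> x - y \<in> F"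
  using add[of x "- y"] uminus[of y] by simp

lemma div: "x \<in> F \<Longrightarrow> y \<in> F \<Longrightarrow> x / y \<in> F"
  using mult[of x "inverse y"] inv[of y] by (simp add: field_simps)

lemma pow: "x \<in> F \<Longrightarrow> x ^ n \<in> F"
  by (induction n) (auto intro: one mult)

lemma sum: "(\<And>i. i \<in> I \<Longrightarrow> f i \<in> F) \<Longrightarrow> sum f I \<in> F"
  by (induction I rule: infinite_finite_induct) (auto intro: zero add)

lemma prod: "(\<And>i. i \<in> I \<Longrightarrow> f i \<in> F) \<Longrightarrow> prod f I \<in> F"
  by (induction I rule: infinite_finite_induct) (auto intro: one mult)

lemma nat: "of_nat n \<in> F"
  by (induction n) (auto intro: zero one add)

lemma int: "of_int n \<in> F"
  by (cases n) (auto intro: nat uminus simp del: of_nat_Suc)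

lemma rat: "x \<in> \<rat> \<Longrightarrow> x \<in> F"
  by (elim Rats_cases') (auto intro: div int)

lemma rats_subset: "\<rat> \<subseteq> F"
  using rat by auto

lemma poly: "(\<And>i. coeff p i \<in> F) \<Longrightarrow> x \<in> F \<Longrightarrow> poly p x \<in> F"
  unfolding poly_altdef by (intro sum mult pow)

text \<open>Gaussian elimination by induction on the equations, with a solution that stays in
  \<open>F\<close>. Over the rationals it yields relations with rational coefficients, over
  \<open>Qbar\<close> it yields the weights used to bound the number of embeddings.\<close>

lemma homogeneous_system:
  assumes "finite I" "finite J" "card I < card J"
    and "\<And>i j. i \<in> I \<Longrightarrow> j \<in> J \<Longrightarrow> a i j \<in> F"
  shows "\<exists>x. (\<forall>j\<in>J. x j \<in> F) \<and> (\<exists>j\<in>J. x j \<noteq> 0) \<and> (\<forall>i\<in>I. (\<Sum>j\<in>J. a i j * x j) = 0)"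
  using assms
proof (induction I arbitrary: J a rule: finite_induct)
  case empty
  then have "J \<noteq> {}" by auto
  then show ?case using one by (intro exI[of _ "\<lambda>_. 1"]) auto
next
  case (insert i I)
  show ?case
  proof (cases "\<forall>j\<in>J. a i j = 0")
    case True
    have "card I < card J" using insert.prems insert.hyps by simp
    from insert.IH[OF insert.prems(1) this, of a] insert.prems(3) obtain x where
      x: "\<forall>j\<in>J. x j \<in> F" "\<exists>j\<in>J. x j \<noteq> 0" "\<forall>i\<in>I. (\<Sum>j\<in>J. a i j * x j) = 0"
      by blast
    moreover have "(\<Sum>j\<in>J. a i j * x j) = 0" using True by (intro sum.neutral) auto
    ultimately show ?thesis by (intro exI[of _ x]) auto
  next
    case False
    then obtain j0 where j0: "j0 \<in> J" "a i j0 \<noteq> 0" by auto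
    define J' where "J' = J - {j0}"
    \<comment> \<open>Equation \<open>i\<close> is used to eliminate the unknown \<open>j0\<close>
      from all other equations; the value of \<open>y\<close> at \<open>j0\<close> is then read off
      from equation \<open>i\<close>.\<close>
    define a' where "a' k j = a k j - a k j0 * (a i j / a i j0)" for k j
    have fJ': "finite J'" "j0 \<notin> J'" "J = insert j0 J'" using insert.prems j0 by (auto simp: J'_def)
    have "card I < card J'" using insert.prems insert.hyps fJ' by simp
    moreover have "a' k j \<in> F" if "k \<in> I" "j \<in> J'" for k j
      unfolding a'_def using that insert.prems(3) fJ' j0 by (intro diff mult div) auto
    ultimately obtain x where
      x: "\<forall>j\<in>J'. x j \<in> F" "\<exists>j\<in>J'. x j \<noteq> 0" "\<forall>i\<in>I. (\<Sum>j\<in>J'. a' i j * x j) = 0"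
      using insert.IH[OF fJ'(1), of a'] by blast
    define s where "s = (\<Sum>j\<in>J'. a i j * x j)"
    define y where "y = x(j0 := - s / a i j0)"
    have sF: "s \<in> F" unfolding s_def using x insert.prems(3) fJ' by (intro sum mult) auto
    have yx: "(\<Sum>j\<in>J'. a k j * y j) = (\<Sum>j\<in>J'. a k j * x j)" for k
      using fJ'(2) by (intro sum.cong) (auto simp: y_def)
    have "(\<Sum>j\<in>J. a k j * y j) = 0" if "k \<in> insert i I" for k
    proof -
      have eq: "(\<Sum>j\<in>J. a k j * y j) = (\<Sum>j\<in>J'. a k j * x j) - a k j0 * s / a i j0"
        using fJ' yx[of k] by (simp add: y_def)
      show ?thesis
      proof (cases "k = i")
        case True
        then show ?thesis using eq j0 by (simp add: s_def)
      next
        case False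
        then have "0 = (\<Sum>j\<in>J'. a' k j * x j)" using x that by auto
        also have "\<dots> = (\<Sum>j\<in>J'. a k j * x j) - a k j0 * s / a i j0"
          by (simp add: a'_def s_def algebra_simps sum_subtractf sum_distrib_left sum_divide_distrib)
        finally show ?thesis using eq by simp
      qed
    qed
    moreover have "\<forall>j\<in>J. y j \<in> F"
      using x sF j0 insert.prems(3) fJ' by (auto simp: y_def intro!: div uminus)
    moreover have "\<exists>j\<in>J. y j \<noteq> 0" using x(2) fJ' by (auto simp: y_def)
    ultimately show ?thesis by blast
  qed
qed

end

lemma cfieldI: "is_subfield K \<Longrightarrow> cfield K"
  by (simp add: cfield_def)

section \<open>Rational spans and the field of algebraic numbers\<close>

lemma is_subfield_Rats: "is_subfield \<rat>"
  unfolding is_subfield_def by auto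

interpretation Q: cfield \<rat>
  by (rule cfieldI[OF is_subfield_Rats])

text \<open>Spans of indexed families rather than of sets: repetitions are harmless, so a family of
  powers or monomials can be used before anything is known about its independence or
  injectivity.\<close>

definition qspan :: "'i set \<Rightarrow> ('i \<Rightarrow> complex) \<Rightarrow> complex set" where
  "qspan I e = {(\<Sum>i\<in>I. c i * e i) | c. \<forall>i\<in>I. c i \<in> \<rat>}"

lemma qspanI: "(\<And>i. i \<in> I \<Longrightarrow> c i \<in> \<rat>) \<Longrightarrow> (\<Sum>i\<in>I. c i * e i) \<in> qspan I e"
  unfolding qspan_def by blast

lemma qspan_0: "0 \<in> qspan I e"
  using qspanI[of I "\<lambda>_. 0" e] by simp

lemma qspan_add: "x \<in> qspan I e \<Longrightarrow> y \<in> qspan I e \<Longrightarrow> x + y \<in> qspan I e"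
proof -
  assume "x \<in> qspan I e" "y \<in> qspan I e"
  then obtain c d where "x = (\<Sum>i\<in>I. c i * e i)" "y = (\<Sum>i\<in>I. d i * e i)"
    and "\<forall>i\<in>I. c i \<in> \<rat>" "\<forall>i\<in>I. d i \<in> \<rat>" unfolding qspan_def by blast
  then show ?thesis using qspanI[of I "\<lambda>i. c i + d i" e] by (simp add: sum.distrib algebra_simps)
qed

lemma qspan_scale: "q \<in> \<rat> \<Longrightarrow> x \<in> qspan I e \<Longrightarrow> q * x \<in> qspan I e"
proof -
  assume q: "q \<in> \<rat>" and "x \<in> qspan I e"
  then obtain c where "x = (\<Sum>i\<in>I. c i * e i)" "\<forall>i\<in>I. c i \<in> \<rat>" unfolding qspan_def by blast
  then show ?thesis using q qspanI[of I "\<lambda>i. q * c i" e] by (simp add: sum_distrib_left algebra_simps)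
qed

lemma qspan_sum: "(\<And>j. j \<in> J \<Longrightarrow> f j \<in> qspan I e) \<Longrightarrow> sum f J \<in> qspan I e"
  by (induction J rule: infinite_finite_induct) (auto intro: qspan_0 qspan_add)

lemma qspan_base:
  assumes "finite I" "i \<in> I" shows "e i \<in> qspan I e"
proof -
  have "(\<Sum>j\<in>I. (if j = i then 1 else 0) * e j) \<in> qspan I e" by (rule qspanI) auto
  moreover have "(\<Sum>j\<in>I. (if j = i then 1 else 0) * e j) = (\<Sum>j\<in>I. if j = i then e j else 0)"
    by (intro sum.cong) auto
  ultimately show ?thesis using assms by simp
qed

lemma qspan_mult:
  assumes "\<And>i. i \<in> I \<Longrightarrow> z * e i \<in> qspan I e" and "x \<in> qspan I e"
  shows "z * x \<in> qspan I e"
proof -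
  obtain c where c: "x = (\<Sum>i\<in>I. c i * e i)" "\<forall>i\<in>I. c i \<in> \<rat>"
    using assms(2) unfolding qspan_def by blast
  have "z * x = (\<Sum>i\<in>I. c i * (z * e i))" by (simp add: c sum_distrib_left algebra_simps)
  also have "\<dots> \<in> qspan I e" by (rule qspan_sum, rule qspan_scale) (use assms(1) c(2) in auto)
  finally show ?thesis .
qed

text \<open>The \<open>card I + 1\<close> vectors \<open>z ^ k * s\<close> lie in a span of
  \<open>card I\<close> generators, so they satisfy a rational relation; it is a polynomial in
  \<open>z\<close> that annihilates the nonzero number \<open>s\<close>.\<close>

lemma algebraic_if_qspan_stable:
  assumes "finite I" and stable: "\<And>x. x \<in> qspan I e \<Longrightarrow> z * x \<in> qspan I e"
    and s: "s \<in> qspan I e" "s \<noteq> 0"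
  shows "algebraic z"
proof -
  have "z ^ k * s \<in> qspan I e" for k
    by (induction k) (use s stable in \<open>auto simp: mult.assoc\<close>)
  then have "\<forall>k. \<exists>c. (\<forall>i\<in>I. c i \<in> \<rat>) \<and> z ^ k * s = (\<Sum>i\<in>I. c i * e i)"
    unfolding qspan_def by blast
  then obtain c where c: "\<And>k i. i \<in> I \<Longrightarrow> c k i \<in> \<rat>"
    and zc: "\<And>k. z ^ k * s = (\<Sum>i\<in>I. c k i * e i)" by metis
  obtain l where l: "\<forall>k\<in>{..card I}. l k \<in> \<rat>" "\<exists>k\<in>{..card I}. l k \<noteq> 0"
    "\<forall>i\<in>I. (\<Sum>k\<in>{..card I}. c k i * l k) = 0"
    using Q.homogeneous_system[OF assms(1), of "{..card I}" "\<lambda>i k. c k i"] c by auto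
  define p where "p = (\<Sum>k\<in>{..card I}. monom (l k) k)"
  have coeff: "coeff p k = (if k \<le> card I then l k else 0)" for k
    by (simp add: p_def coeff_sum sum.delta')
  have "poly p z * s = (\<Sum>k\<in>{..card I}. l k * (z ^ k * s))"
    unfolding p_def poly_sum poly_monom sum_distrib_right by (simp add: mult.assoc)
  also have "\<dots> = (\<Sum>k\<in>{..card I}. \<Sum>i\<in>I. c k i * l k * e i)"
    by (simp only: zc sum_distrib_left) (simp add: mult_ac)
  also have "\<dots> = (\<Sum>i\<in>I. (\<Sum>k\<in>{..card I}. c k i * l k) * e i)"
    by (subst sum.swap) (simp add: sum_distrib_right)
  also have "\<dots> = 0" using l(3) by (intro sum.neutral) auto
  finally have "poly p z = 0" using s by simp
  moreover have "p \<noteq> 0" using l(2) coeff by (metis atMost_iff coeff_0)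
  moreover have "\<forall>i. coeff p i \<in> \<rat>" using l(1) coeff by auto
  ultimately show ?thesis unfolding algebraic_altdef by blast
qed

lemma algebraic_power_reduction:
  assumes "algebraic (x::complex)"
  obtains m c where "m > 0" "\<And>i. c i \<in> \<rat>" "x ^ m = (\<Sum>i<m. c i * x ^ i)"
proof -
  obtain p where p: "\<forall>i. coeff p i \<in> \<rat>" "p \<noteq> 0" "poly p x = 0"
    using assms unfolding algebraic_altdef by blast
  define c where "c i = - coeff p i / lead_coeff p" for i
  have deg: "degree p > 0"
  proof (rule ccontr)
    assume "\<not> degree p > 0"
    then obtain a where "p = [:a:]" by (metis degree_eq_zeroE neq0_conv)
    then show False using p by simp
  qed
  have "0 = (\<Sum>i\<le>degree p. coeff p i * x ^ i)" using p by (simp add: poly_altdef)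
  also have "{..degree p} = insert (degree p) {..<degree p}" by auto
  finally have "lead_coeff p * x ^ degree p = - (\<Sum>i<degree p. coeff p i * x ^ i)"
    by (simp add: add_eq_0_iff2)
  moreover have "(\<Sum>i<degree p. c i * x ^ i) = - (\<Sum>i<degree p. coeff p i * x ^ i) / lead_coeff p"
    by (simp add: c_def sum_divide_distrib sum_negf)
  ultimately have "x ^ degree p = (\<Sum>i<degree p. c i * x ^ i)"
    using p(2) by (metis leading_coeff_0_iff nonzero_mult_div_cancel_left)
  moreover have "c i \<in> \<rat>" for i using p(1) by (auto simp: c_def)
  ultimately show ?thesis using that deg by blast
qed

text \<open>The monomials \<open>x ^ i * y ^ j\<close> with \<open>i < m\<close> and
  \<open>j < n\<close> span a space stable under multiplication by \<open>x\<close> and by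
  \<open>y\<close>, hence by their sum and product.\<close>

lemma algebraic_add_mult:
  assumes "algebraic (x::complex)" "algebraic y"
  shows "algebraic (x + y)" and "algebraic (x * y)"
proof -
  obtain m c where m: "m > 0" "\<And>i. c i \<in> \<rat>" "x ^ m = (\<Sum>i<m. c i * x ^ i)"
    using algebraic_power_reduction[OF assms(1)] by blast
  obtain n d where n: "n > 0" "\<And>i. d i \<in> \<rat>" "y ^ n = (\<Sum>i<n. d i * y ^ i)"
    using algebraic_power_reduction[OF assms(2)] by blast
  define I where "I = {..<m} \<times> {..<n}"
  define e where "e = (\<lambda>(i, j). x ^ i * y ^ j)"
  have fin: "finite I" by (simp add: I_def)
  have x: "x * e ij \<in> qspan I e" if "ij \<in> I" for ij
  proof -
    obtain i j where ij: "ij = (i, j)" "i < m" "j < n" using \<open>ij \<in> I\<close> unfolding I_def by auto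
    show ?thesis
    proof (cases "Suc i < m")
      case True
      then have "e (Suc i, j) \<in> qspan I e" using ij by (intro qspan_base fin) (auto simp: I_def)
      then show ?thesis by (simp add: ij e_def mult.assoc)
    next
      case False
      then have "Suc i = m" using ij by simp
      then have "x * e ij = x ^ m * y ^ j" by (auto simp: ij e_def mult.assoc)
      also have "\<dots> = (\<Sum>i<m. c i * e (i, j))" by (simp add: m(3) e_def sum_distrib_right mult.assoc)
      also have "\<dots> \<in> qspan I e" using m(2) ij
        by (intro qspan_sum qspan_scale qspan_base fin) (auto simp: I_def)
      finally show ?thesis .
    qed
  qed
  have y: "y * e ij \<in> qspan I e" if "ij \<in> I" for ij
  proof -
    obtain i j where ij: "ij = (i, j)" "i < m" "j < n" using \<open>ij \<in> I\<close> unfolding I_def by auto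
    show ?thesis
    proof (cases "Suc j < n")
      case True
      then have "e (i, Suc j) \<in> qspan I e" using ij by (intro qspan_base fin) (auto simp: I_def)
      then show ?thesis by (simp add: ij e_def algebra_simps)
    next
      case False
      then have "Suc j = n" using ij by simp
      then have "y * e ij = x ^ i * y ^ n" by (auto simp: ij e_def algebra_simps)
      also have "\<dots> = (\<Sum>j<n. d j * e (i, j))"
        by (simp add: n(3) e_def sum_distrib_left algebra_simps)
      also have "\<dots> \<in> qspan I e" using n(2) ij
        by (intro qspan_sum qspan_scale qspan_base fin) (auto simp: I_def)
      finally show ?thesis .
    qed
  qed
  have sx: "x * s \<in> qspan I e" and sy: "y * s \<in> qspan I e" if "s \<in> qspan I e" for s
    using qspan_mult[of I x e, OF x that] qspan_mult[of I y e, OF y that] by auto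
  have "e (0, 0) \<in> qspan I e" using m n by (intro qspan_base fin) (auto simp: I_def)
  then have one: "1 \<in> qspan I e" by (simp add: e_def)
  show "algebraic (x + y)"
    by (rule algebraic_if_qspan_stable[OF fin _ one]) (auto simp: distrib_right intro: qspan_add sx sy)
  show "algebraic (x * y)"
    by (rule algebraic_if_qspan_stable[OF fin _ one]) (auto simp: mult.assoc intro: sx sy)
qed

lemma is_subfield_Qbar: "is_subfield Qbar"
  unfolding is_subfield_def Qbar_def by (auto intro: algebraic_add_mult algebraic_inverse)

interpretation Qb: cfield Qbar
  by (rule cfieldI[OF is_subfield_Qbar])

section \<open>Automorphisms of the algebraic numbers\<close>

text \<open>Nothing is demanded of the map outside \<open>F\<close>, and surjectivity is not built
  in. The same locale thus serves automorphisms of \<open>Qbar\<close>, automorphisms of a given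
  field in the sense of \<open>field_automorphism\<close>, and restrictions of automorphisms to a
  level.\<close>

locale chom = cfield F for F +
  fixes \<tau> :: "complex \<Rightarrow> complex"
  assumes hom_in: "x \<in> F \<Longrightarrow> \<tau> x \<in> F"
    and hom_add: "x \<in> F \<Longrightarrow> y \<in> F \<Longrightarrow> \<tau> (x + y) = \<tau> x + \<tau> y"
    and hom_mult: "x \<in> F \<Longrightarrow> y \<in> F \<Longrightarrow> \<tau> (x * y) = \<tau> x * \<tau> y"
    and hom_one: "\<tau> 1 = 1"
begin

lemma hom_zero: "\<tau> 0 = 0"
  using hom_add[OF zero zero] by simp

lemma hom_uminus: "x \<in> F \<Longrightarrow> \<tau> (- x) = - \<tau> x"
  by (metis add.right_inverse add_eq_0_iff hom_add hom_zero uminus)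

lemma hom_diff: "x \<in> F \<Longrightarrow> y \<in> F \<Longrightarrow> \<tau> (x - y) = \<tau> x - \<tau> y"
  by (metis add_uminus_conv_diff hom_add hom_uminus uminus)

lemma hom_inverse: "x \<in> F \<Longrightarrow> \<tau> (inverse x) = inverse (\<tau> x)"
proof (cases "x = 0")
  case False
  assume x: "x \<in> F"
  then have "\<tau> x * \<tau> (inverse x) = 1" using hom_mult[OF x inv[OF x]] False hom_one by simp
  then show ?thesis by (metis inverse_unique)
qed (use hom_zero in auto)

lemma hom_divide: "x \<in> F \<Longrightarrow> y \<in> F \<Longrightarrow> \<tau> (x / y) = \<tau> x / \<tau> y"
  by (simp add: divide_inverse hom_mult inv hom_inverse)

lemma hom_eq_0_iff: "x \<in> F \<Longrightarrow> \<tau> x = 0 \<longleftrightarrow> x = 0"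
  by (metis hom_inverse hom_mult hom_one hom_zero inv inverse_zero mult_zero_left right_inverse zero_neq_one)

lemma hom_inj: "inj_on \<tau> F"
  using hom_eq_0_iff[OF diff] by (auto intro!: inj_onI simp: hom_diff)

lemma hom_power: "x \<in> F \<Longrightarrow> \<tau> (x ^ n) = \<tau> x ^ n"
  by (induction n) (simp_all add: hom_one hom_mult pow)

lemma hom_sum: "(\<And>i. i \<in> I \<Longrightarrow> f i \<in> F) \<Longrightarrow> \<tau> (sum f I) = (\<Sum>i\<in>I. \<tau> (f i))"
  by (induction I rule: infinite_finite_induct) (simp_all add: hom_zero hom_add sum)

lemma hom_prod: "(\<And>i. i \<in> I \<Longrightarrow> f i \<in> F) \<Longrightarrow> \<tau> (prod f I) = (\<Prod>i\<in>I. \<tau> (f i))"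
  by (induction I rule: infinite_finite_induct) (simp_all add: hom_one hom_mult prod)

lemma hom_nat: "\<tau> (of_nat n) = of_nat n"
  by (induction n) (simp_all add: hom_zero hom_one hom_add nat one)

lemma hom_int: "\<tau> (of_int n) = of_int n"
  by (cases n) (simp_all add: hom_nat hom_uminus nat del: of_nat_Suc)

lemma hom_rat: "x \<in> \<rat> \<Longrightarrow> \<tau> x = x"
  by (elim Rats_cases') (simp add: hom_divide hom_int int)

lemma hom_poly:
  assumes "\<And>i. coeff p i \<in> F" "\<And>i. \<tau> (coeff p i) = coeff p i" "x \<in> F"
  shows "\<tau> (poly p x) = poly p (\<tau> x)"
  unfolding poly_altdef using assms by (simp add: hom_sum hom_mult hom_power pow mult)

text \<open>Used when the map permutes the roots: the polynomial on the right is then the original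
  one, so its coefficients are fixed and descend to the fixed field.\<close>

lemma coeff_linear_prod:
  assumes "\<And>i. i \<in> I \<Longrightarrow> f i \<in> F"
  shows "coeff (\<Prod>i\<in>I. [:- f i, 1:]) n \<in> F \<and>
    \<tau> (coeff (\<Prod>i\<in>I. [:- f i, 1:]) n) = coeff (\<Prod>i\<in>I. [:- \<tau> (f i), 1:]) n"
  using assms
proof (induction I arbitrary: n rule: infinite_finite_induct)
  case (insert x A)
  have "coeff ([:- a, 1:] * q) n = - a * coeff q n + (if n = 0 then 0 else coeff q (n - 1))"
    for a :: complex and q
    by (simp add: coeff_pCons split: nat.split)
  then show ?case using insert
    by (auto simp: hom_add hom_mult hom_uminus add mult uminus hom_diff diff simp del: mult_pCons_left)
qed (auto simp: coeff_pCons hom_one hom_zero one zero split: nat.split)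

end

lemma field_automorphism_imp_chom:
  assumes "is_subfield K" "field_automorphism K F \<tau>"
  shows "chom K \<tau>"
proof -
  interpret cfield K by (rule cfieldI[OF assms(1)])
  have bij: "bij_betw \<tau> K K" and ad: "\<forall>x\<in>K. \<forall>y\<in>K. \<tau> (x + y) = \<tau> x + \<tau> y \<and> \<tau> (x * y) = \<tau> x * \<tau> y"
    using assms(2) by (auto simp: field_automorphism_def)
  have 0: "\<tau> 0 = 0" using ad zero by (metis add_cancel_right_right add_0)
  have "\<tau> 1 * \<tau> 1 = \<tau> 1" using ad one by (metis mult_1)
  moreover have "\<tau> 1 \<noteq> \<tau> 0" using bij one zero by (metis bij_betw_def inj_on_def zero_neq_one)
  ultimately have "\<tau> 1 = 1" using 0 by simp
  then show ?thesis using bij ad by unfold_locales (auto simp: bij_betw_def)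
qed

text \<open>The identity outside \<open>Qbar\<close> makes each automorphism of \<open>Qbar\<close>
  a single function that is bijective on all complex numbers, so that \<open>inv\<close> and
  composition are the group operations.\<close>

definition qaut :: "(complex \<Rightarrow> complex) set" where
  "qaut = {\<sigma>. bij \<sigma> \<and> (\<forall>x. x \<notin> Qbar \<longrightarrow> \<sigma> x = x) \<and> (\<forall>x\<in>Qbar. \<sigma> x \<in> Qbar) \<and>
     (\<forall>x\<in>Qbar. \<forall>y\<in>Qbar. \<sigma> (x + y) = \<sigma> x + \<sigma> y \<and> \<sigma> (x * y) = \<sigma> x * \<sigma> y)}"

lemma qaut_chom: "\<sigma> \<in> qaut \<Longrightarrow> chom Qbar \<sigma>"
proof -
  assume s: "\<sigma> \<in> qaut"
  then have ad: "\<sigma> (x + y) = \<sigma> x + \<sigma> y \<and> \<sigma> (x * y) = \<sigma> x * \<sigma> y" if "x \<in> Qbar" "y \<in> Qbar" for x y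
    using that by (simp add: qaut_def)
  have 0: "\<sigma> 0 = 0" using ad[OF Qb.zero Qb.zero] by simp
  have "\<sigma> 1 * \<sigma> 1 = \<sigma> 1" using ad[OF Qb.one Qb.one] by simp
  moreover have "\<sigma> 1 \<noteq> \<sigma> 0" using s by (simp add: qaut_def bij_is_inj inj_eq)
  ultimately have "\<sigma> 1 = 1" using 0 by simp
  then show ?thesis using s by unfold_locales (auto simp: qaut_def)
qed

lemma qaut_id: "id \<in> qaut"
  by (auto simp: qaut_def)

lemma qaut_comp: "\<sigma> \<in> qaut \<Longrightarrow> \<tau> \<in> qaut \<Longrightarrow> \<sigma> \<circ> \<tau> \<in> qaut"
  by (auto simp: qaut_def bij_comp)

lemma qaut_bij: "\<sigma> \<in> qaut \<Longrightarrow> bij \<sigma>"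
  by (simp add: qaut_def)

lemma qaut_Qbar: "\<sigma> \<in> qaut \<Longrightarrow> x \<in> Qbar \<Longrightarrow> \<sigma> x \<in> Qbar"
  by (simp add: qaut_def)

lemma qaut_inv:
  assumes s: "\<sigma> \<in> qaut" shows "inv \<sigma> \<in> qaut"
proof -
  interpret chom Qbar \<sigma> by (rule qaut_chom[OF s])
  have b: "bij \<sigma>" by (rule qaut_bij[OF s])
  have i: "\<sigma> (inv \<sigma> x) = x" "inv \<sigma> (\<sigma> x) = x" for x
    using b by (auto simp: bij_is_surj surj_f_inv_f bij_is_inj)
  have out: "inv \<sigma> x = x" if "x \<notin> Qbar" for x
    using s that i(2)[of x] by (simp add: qaut_def)
  have in': "inv \<sigma> x \<in> Qbar" if "x \<in> Qbar" for x
    using s that i(1)[of x] by (cases "inv \<sigma> x \<in> Qbar") (auto simp: qaut_def)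
  have "inv \<sigma> (x + y) = inv \<sigma> x + inv \<sigma> y \<and> inv \<sigma> (x * y) = inv \<sigma> x * inv \<sigma> y"
    if "x \<in> Qbar" "y \<in> Qbar" for x y
    using hom_add[OF in'[OF that(1)] in'[OF that(2)]] hom_mult[OF in'[OF that(1)] in'[OF that(2)]] i
    by metis
  then show ?thesis using out in' b by (auto simp: qaut_def bij_imp_bij_inv)
qed

lemma qaut_inv_cancel: "\<sigma> \<in> qaut \<Longrightarrow> \<sigma> (inv \<sigma> x) = x" "\<sigma> \<in> qaut \<Longrightarrow> inv \<sigma> (\<sigma> x) = x"
  using qaut_bij by (auto simp: bij_is_surj surj_f_inv_f bij_is_inj)

section \<open>Extension of homomorphisms to all algebraic numbers\<close>

text \<open>Homomorphisms into \<open>\<complex>\<close> from subrings of \<open>Qbar\<close>, encoded by their graphs so that Zorn's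
  lemma applies to inclusion.\<close>

definition is_hom_graph :: "(complex \<times> complex) set \<Rightarrow> bool" where
  "is_hom_graph R \<longleftrightarrow> (\<forall>q\<in>\<rat>. (q, q) \<in> R) \<and> Domain R \<subseteq> Qbar \<and>
     (\<forall>a b c d. (a, b) \<in> R \<longrightarrow> (c, d) \<in> R \<longrightarrow> (a + c, b + d) \<in> R \<and> (a * c, b * d) \<in> R) \<and>
     (\<forall>b. (0, b) \<in> R \<longrightarrow> b = 0)"

definition graph_poly :: "(complex \<times> complex) set \<Rightarrow> complex poly \<Rightarrow> complex poly \<Rightarrow> bool" where
  "graph_poly R p q \<longleftrightarrow> (\<forall>i. (coeff p i, coeff q i) \<in> R)"

text \<open>The candidate extension that sends \<open>y\<close> to \<open>z\<close>, evaluated on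
  polynomials whose coefficients are carried along by \<open>R\<close>. In general this relation is
  not single-valued; \<open>adjoin_zero\<close> secures that when \<open>z\<close> is a root of the
  image of the minimal polynomial.\<close>

definition graph_adjoin :: "(complex \<times> complex) set \<Rightarrow> complex \<Rightarrow> complex \<Rightarrow> (complex \<times> complex) set" where
  "graph_adjoin R y z = {(poly p y, poly q z) | p q. graph_poly R p q}"

locale hom_graph =
  fixes R assumes graph: "is_hom_graph R"
begin

lemma g_rat: "q \<in> \<rat> \<Longrightarrow> (q, q) \<in> R"
  and g_add: "(a, b) \<in> R \<Longrightarrow> (c, d) \<in> R \<Longrightarrow> (a + c, b + d) \<in> R"
  and g_mult: "(a, b) \<in> R \<Longrightarrow> (c, d) \<in> R \<Longrightarrow> (a * c, b * d) \<in> R"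
  and g_zero: "(0, b) \<in> R \<Longrightarrow> b = 0"
  and g_dom: "(a, b) \<in> R \<Longrightarrow> a \<in> Qbar"
  using graph unfolding is_hom_graph_def by auto

lemma g_uminus: "(a, b) \<in> R \<Longrightarrow> (- a, - b) \<in> R"
  using g_mult[OF g_rat[of "-1"], of a b] by simp

lemma g_diff: "(a, b) \<in> R \<Longrightarrow> (c, d) \<in> R \<Longrightarrow> (a - c, b - d) \<in> R"
  using g_add[of a b "- c" "- d"] g_uminus[of c d] by simp

lemma g_fun: "(a, b) \<in> R \<Longrightarrow> (a, c) \<in> R \<Longrightarrow> b = c"
  using g_diff[of a b a c] g_zero[of "b - c"] by simp

lemma g_sum: "(\<And>i. i \<in> I \<Longrightarrow> (f i, g i) \<in> R) \<Longrightarrow> (sum f I, sum g I) \<in> R"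
  by (induction I rule: infinite_finite_induct) (auto intro: g_add g_rat)

lemma g_pow: "(a, b) \<in> R \<Longrightarrow> (a ^ n, b ^ n) \<in> R"
  by (induction n) (auto intro: g_mult g_rat)

lemma gp_rat: "(\<And>i. coeff p i \<in> \<rat>) \<Longrightarrow> graph_poly R p p"
  by (simp add: graph_poly_def g_rat)

lemma gp_add: "graph_poly R p q \<Longrightarrow> graph_poly R p' q' \<Longrightarrow> graph_poly R (p + p') (q + q')"
  by (simp add: graph_poly_def g_add)

lemma gp_diff: "graph_poly R p q \<Longrightarrow> graph_poly R p' q' \<Longrightarrow> graph_poly R (p - p') (q - q')"
  by (simp add: graph_poly_def g_diff)

lemma gp_mult: "graph_poly R p q \<Longrightarrow> graph_poly R p' q' \<Longrightarrow> graph_poly R (p * p') (q * q')"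
  by (auto simp: graph_poly_def coeff_mult intro!: g_sum g_mult)

lemma gp_monom: "(a, b) \<in> R \<Longrightarrow> graph_poly R (monom a k) (monom b k)"
  by (simp add: graph_poly_def g_rat)

lemma gp_degree: "graph_poly R p q \<Longrightarrow> degree q \<le> degree p"
  by (rule degree_le) (metis coeff_eq_0 g_zero graph_poly_def)

lemma gp_poly:
  assumes "graph_poly R p q" "(a, b) \<in> R" shows "(poly p a, poly q b) \<in> R"
proof -
  have "poly q b = (\<Sum>i\<le>degree p. coeff q i * b ^ i)"
    unfolding poly_altdef using gp_degree[OF assms(1)]
    by (intro sum.mono_neutral_left) (auto simp: coeff_eq_0)
  moreover have "(\<Sum>i\<le>degree p. coeff p i * a ^ i, \<Sum>i\<le>degree p. coeff q i * b ^ i) \<in> R"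
    using assms by (intro g_sum g_mult g_pow) (auto simp: graph_poly_def)
  ultimately show ?thesis by (simp add: poly_altdef)
qed

text \<open>The domain is only known to be a ring, but an algebraic \<open>a\<close> has its inverse
  among the rational polynomials in \<open>a\<close>: split off the nonzero constant term of an
  annihilating polynomial. The same polynomial annihilates \<open>b\<close>.\<close>

lemma g_inverse:
  assumes "(a, b) \<in> R" "a \<noteq> 0" shows "b \<noteq> 0" "(inverse a, inverse b) \<in> R"
proof -
  have "algebraic a" using g_dom[OF assms(1)] by (simp add: Qbar_def)
  then obtain p where p: "\<And>i. coeff p i \<in> \<int>" "coeff p 0 \<noteq> 0" "poly p a = 0"
  proof (rule algebraicE'_nonzero[OF _ assms(2)])
    fix p assume "coeff p 0 \<noteq> 0" "poly (map_poly of_int p) a = 0"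
    then show thesis using that[of "map_poly of_int p"] by (simp add: coeff_map_poly)
  qed
  obtain c r where cr: "p = pCons c r" by (cases p) auto
  have c: "c \<noteq> 0" "c \<in> \<rat>" using p(1)[of 0] p(2) Ints_subset_Rats by (auto simp: cr)
  have cf: "coeff p i \<in> \<rat>" for i using p(1) Ints_subset_Rats by blast
  have r: "coeff r i \<in> \<rat>" for i using cf[of "Suc i"] by (simp add: cr)
  have "(0, poly p b) \<in> R" using gp_poly[OF gp_rat[OF cf] assms(1)] p(3) by simp
  then have "poly p b = 0" by (rule g_zero)
  then have b: "c + b * poly r b = 0" and a: "c + a * poly r a = 0" using p(3) by (auto simp: cr)
  show "b \<noteq> 0" using b c by auto
  have eq: "inverse x = - poly r x / c" if "c + x * poly r x = 0" for x
  proof -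
    have "x \<noteq> 0" using that c by auto
    then show ?thesis using that c by (simp add: field_simps add_eq_0_iff)
  qed
  have "(poly r a * (- inverse c), poly r b * (- inverse c)) \<in> R"
    using c by (intro g_mult g_rat gp_poly gp_rat r assms(1)) auto
  then show "(inverse a, inverse b) \<in> R" unfolding eq[OF a] eq[OF b] by (simp add: divide_inverse)
qed

text \<open>A nonzero annihilating polynomial of least degree, made monic by
  \<open>g_inverse\<close>. Its image \<open>g\<close> has a nonzero coefficient in the same degree,
  so \<open>g\<close> is not constant and possesses a complex root to which \<open>y\<close> can be
  sent.\<close>

lemma minimal_poly:
  assumes "y \<in> Qbar"
  obtains f g where "graph_poly R f g" "lead_coeff f = 1" "poly f y = 0" "degree f > 0" "degree g > 0"
    "\<And>p q. graph_poly R p q \<Longrightarrow> poly p y = 0 \<Longrightarrow> p \<noteq> 0 \<Longrightarrow> degree f \<le> degree p"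
proof -
  define P where "P n \<longleftrightarrow> (\<exists>p q. graph_poly R p q \<and> poly p y = 0 \<and> p \<noteq> 0 \<and> degree p = n)" for n
  obtain p0 where "\<forall>i. coeff p0 i \<in> \<rat>" "p0 \<noteq> 0" "poly p0 y = 0"
    using assms unfolding Qbar_def algebraic_altdef by blast
  then have "P (degree p0)" unfolding P_def using gp_rat by blast
  then have least: "P (LEAST n. P n)" by (rule LeastI)
  then obtain p q where pq: "graph_poly R p q" "poly p y = 0" "p \<noteq> 0" "degree p = (LEAST n. P n)"
    unfolding P_def by blast
  define a b where "a = lead_coeff p" and "b = coeff q (degree p)"
  have ab: "(a, b) \<in> R" "a \<noteq> 0" using pq(1,3) by (auto simp: a_def b_def graph_poly_def)
  note inv = g_inverse[OF this]
  define f g where "f = monom (inverse a) 0 * p" and "g = monom (inverse b) 0 * q"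
  have fg: "f = smult (inverse a) p" "g = smult (inverse b) q" by (simp_all add: f_def g_def smult_monom_mult monom_0)
  have gp: "graph_poly R f g" unfolding f_def g_def by (intro gp_mult gp_monom inv pq)
  have lead: "lead_coeff f = 1" and deg: "degree f = degree p" and root: "poly f y = 0"
    using ab pq by (auto simp: fg a_def)
  have pos: "degree f > 0"
  proof (rule ccontr)
    assume "\<not> degree f > 0"
    then have "f = 1" using lead by (metis degree_eq_zeroE neq0_conv coeff_pCons_0 degree_pCons_0 one_pCons)
    then show False using root by simp
  qed
  have "coeff g (degree f) = 1" using ab inv by (simp add: fg deg b_def)
  then have "degree f \<le> degree g" by (intro le_degree) simp
  moreover have "degree f \<le> degree p'" if "graph_poly R p' q'" "poly p' y = 0" "p' \<noteq> 0" for p' q'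
    using that unfolding deg pq(4) by (intro Least_le) (auto simp: P_def)
  ultimately show thesis using that gp lead root pos by fastforce
qed

text \<open>Division by the monic \<open>f\<close>, carried out in parallel on \<open>p\<close> with
  \<open>f\<close> and on \<open>q\<close> with \<open>g\<close>: cancelling leading terms preserves
  the graph relation, and below the degree of \<open>f\<close> minimality leaves only the zero
  polynomial.\<close>

lemma adjoin_zero:
  assumes f: "graph_poly R f g" "lead_coeff f = 1" "poly f y = 0" "poly g z = 0"
    and min: "\<And>p q. graph_poly R p q \<Longrightarrow> poly p y = 0 \<Longrightarrow> p \<noteq> 0 \<Longrightarrow> degree f \<le> degree p"
  shows "graph_poly R p q \<Longrightarrow> poly p y = 0 \<Longrightarrow> poly q z = 0"
proof (induction "degree p" arbitrary: p q rule: less_induct)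
  case less
  show ?case
  proof (cases "p = 0")
    case True
    then have "coeff q i = 0" for i using less.prems(1) g_zero[of "coeff q i"] by (auto simp: graph_poly_def)
    then show ?thesis by (simp add: poly_altdef)
  next
    case False
    then have le: "degree f \<le> degree p" using min less.prems by blast
    define c d k where "c = lead_coeff p" and "d = coeff q (degree p)" and "k = degree p - degree f"
    define p1 q1 where "p1 = p - monom c k * f" and "q1 = q - monom d k * g"
    have cd: "(c, d) \<in> R" using less.prems(1) by (simp add: c_def d_def graph_poly_def)
    have gp: "graph_poly R p1 q1" unfolding p1_def q1_def by (intro gp_diff gp_mult gp_monom cd f less.prems)
    have root: "poly p1 y = 0" using f less.prems by (simp add: p1_def)
    have "poly q1 z = 0"
    \<comment> \<open>In degree 0 cancelling the leading term would not lower \<open>degree\<close>;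
      but a nonzero constant does not vanish at \<open>y\<close>.\<close>
    proof (cases "degree p = 0")
      case True
      then have "p = [:c:]" by (metis c_def degree_eq_zeroE coeff_pCons_0)
      then show ?thesis using less.prems(2) False by simp
    next
      case nz: False
      have degm: "degree (monom c k * f) = degree p"
      proof -
        have "c \<noteq> 0" "f \<noteq> 0" using False f(2) by (auto simp: c_def)
        then show ?thesis using le by (simp add: degree_mult_eq degree_monom_eq k_def)
      qed
      moreover have "lead_coeff (monom c k * f) = c"
        using f(2) unfolding lead_coeff_mult lead_coeff_monom by simp
      ultimately have "coeff p1 (degree p) = 0" by (simp add: p1_def c_def)
      moreover have "degree p1 \<le> degree p" unfolding p1_def using degm by (intro degree_diff_le) auto
      ultimately have "degree p1 < degree p"
        using nz by (metis degree_0 leading_coeff_0_iff le_neq_implies_less neq0_conv)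
      then show ?thesis by (rule less.hyps[OF _ gp root])
    qed
    then show ?thesis using f by (simp add: q1_def)
  qed
qed

lemma graph_adjoin:
  assumes "y \<in> Qbar" "graph_poly R f g" "lead_coeff f = 1" "poly f y = 0" "poly g z = 0"
    and "\<And>p q. graph_poly R p q \<Longrightarrow> poly p y = 0 \<Longrightarrow> p \<noteq> 0 \<Longrightarrow> degree f \<le> degree p"
  shows "is_hom_graph (graph_adjoin R y z)" "R \<subseteq> graph_adjoin R y z" "(y, z) \<in> graph_adjoin R y z"
proof -
  have const: "(a, b) \<in> graph_adjoin R y z" if "(a, b) \<in> R" for a b
  proof -
    have "graph_poly R [:a:] [:b:]" using that by (simp add: graph_poly_def coeff_pCons g_rat split: nat.split)
    then show ?thesis unfolding graph_adjoin_def by force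
  qed
  then show "R \<subseteq> graph_adjoin R y z" by auto
  have "graph_poly R [:0, 1:] [:0, 1:]" by (rule gp_rat) (simp add: coeff_pCons split: nat.split)
  then show "(y, z) \<in> graph_adjoin R y z" unfolding graph_adjoin_def by force
  show "is_hom_graph (graph_adjoin R y z)"
    unfolding is_hom_graph_def
  proof (intro conjI ballI allI impI)
    show "(q, q) \<in> graph_adjoin R y z" if "q \<in> \<rat>" for q using const g_rat[OF that] .
    show "Domain (graph_adjoin R y z) \<subseteq> Qbar"
      using g_dom assms(1) unfolding graph_adjoin_def graph_poly_def by (auto intro!: Qb.poly)
    fix a b
    show "b = 0" if "(0, b) \<in> graph_adjoin R y z"
      using that adjoin_zero[OF assms(2-6)] unfolding graph_adjoin_def by force
    fix c d
    assume "(a, b) \<in> graph_adjoin R y z" "(c, d) \<in> graph_adjoin R y z"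
    then obtain p q p' q' where *: "graph_poly R p q" "graph_poly R p' q'"
      and "a = poly p y" "b = poly q z" "c = poly p' y" "d = poly q' z" unfolding graph_adjoin_def by blast
    then have "(a + c, b + d) = (poly (p + p') y, poly (q + q') z)"
      "(a * c, b * d) = (poly (p * p') y, poly (q * q') z)" by auto
    then show "(a + c, b + d) \<in> graph_adjoin R y z" "(a * c, b * d) \<in> graph_adjoin R y z"
      unfolding graph_adjoin_def using gp_add[OF *] gp_mult[OF *] by blast+
  qed
qed

end

lemma ex_poly_root: "degree (p :: complex poly) > 0 \<Longrightarrow> \<exists>z. poly p z = 0"
  using fundamental_theorem_of_algebra[of p] constant_degree[of p] by auto

lemma hom_graph_Union:
  assumes "C \<noteq> {}" "subset.chain {R. is_hom_graph R} C" shows "is_hom_graph (\<Union>C)"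
proof -
  have hg: "hom_graph R" if "R \<in> C" for R
    using assms that by unfold_locales (auto simp: subset.chain_def)
  have two: "\<exists>R\<in>C. x \<in> R \<and> y \<in> R" if xy: "x \<in> \<Union>C" "y \<in> \<Union>C" for x y
  proof -
    obtain A B where "A \<in> C" "x \<in> A" "B \<in> C" "y \<in> B" using xy by blast
    moreover from this have "A \<subseteq> B \<or> B \<subseteq> A" using assms(2) by (auto simp: subset.chain_def)
    ultimately show ?thesis by blast
  qed
  show ?thesis unfolding is_hom_graph_def
  proof (intro conjI ballI allI impI)
    show "(q, q) \<in> \<Union>C" if "q \<in> \<rat>" for q using assms(1) hom_graph.g_rat[OF hg _] that by auto
    show "Domain (\<Union>C) \<subseteq> Qbar" using hom_graph.g_dom[OF hg] by auto
    show "b = 0" if "(0, b) \<in> \<Union>C" for b using that hom_graph.g_zero[OF hg] by auto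
    fix a b c d assume "(a, b) \<in> \<Union>C" "(c, d) \<in> \<Union>C"
    from two[OF this] obtain R where "R \<in> C" "(a, b) \<in> R" "(c, d) \<in> R" by blast
    then show "(a + c, b + d) \<in> \<Union>C" "(a * c, b * d) \<in> \<Union>C"
      using hom_graph.g_add[OF hg] hom_graph.g_mult[OF hg] by blast+
  qed
qed

text \<open>A maximal graph has domain \<open>Qbar\<close>, because any missing algebraic number
  could be adjoined. The resulting map is onto \<open>Qbar\<close> since it injects the finite root
  set of each rational polynomial into itself.\<close>

lemma hom_graph_extend:
  assumes "is_hom_graph R"
  shows "\<exists>\<sigma>\<in>qaut. \<forall>(x, y)\<in>R. \<sigma> x = y"
proof -
  have "\<exists>M\<in>{M. is_hom_graph M \<and> R \<subseteq> M}. \<forall>X\<in>{M. is_hom_graph M \<and> R \<subseteq> M}. M \<subseteq> X \<longrightarrow> X = M"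
  proof (rule subset_Zorn_nonempty)
    show "{M. is_hom_graph M \<and> R \<subseteq> M} \<noteq> {}" using assms by blast
    fix C assume C: "C \<noteq> {}" "subset.chain {M. is_hom_graph M \<and> R \<subseteq> M} C"
    then have "subset.chain {M. is_hom_graph M} C" by (auto simp: subset.chain_def)
    then have "is_hom_graph (\<Union>C)" by (rule hom_graph_Union[OF C(1)])
    moreover have "R \<subseteq> \<Union>C"
    proof -
      obtain X where "X \<in> C" using C(1) by blast
      moreover have "R \<subseteq> X" using C(2) \<open>X \<in> C\<close> by (auto simp: subset.chain_def)
      ultimately show ?thesis by blast
    qed
    ultimately show "\<Union>C \<in> {M. is_hom_graph M \<and> R \<subseteq> M}" by blast
  qed
  then obtain M where M': "M \<in> {M. is_hom_graph M \<and> R \<subseteq> M}"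
    and max0: "\<forall>X\<in>{M. is_hom_graph M \<and> R \<subseteq> M}. M \<subseteq> X \<longrightarrow> X = M" by (rule bexE)
  then have M: "is_hom_graph M" "R \<subseteq> M" by simp_all
  have max: "X = M" if "is_hom_graph X" "M \<subseteq> X" for X
    using max0 that M(2) by (metis (mono_tags, lifting) mem_Collect_eq order_trans)
  interpret hom_graph M by unfold_locales (rule M)
  have dom: "\<exists>z. (y, z) \<in> M" if y: "y \<in> Qbar" for y
  proof -
    obtain f g where fg: "graph_poly M f g" "lead_coeff f = 1" "poly f y = 0" "degree g > 0"
      "\<And>p q. graph_poly M p q \<Longrightarrow> poly p y = 0 \<Longrightarrow> p \<noteq> 0 \<Longrightarrow> degree f \<le> degree p"
      using minimal_poly[OF y] by metis
    obtain z where z: "poly g z = 0" using ex_poly_root[OF fg(4)] by blast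
    have "is_hom_graph (graph_adjoin M y z)" "M \<subseteq> graph_adjoin M y z" "(y, z) \<in> graph_adjoin M y z"
      using graph_adjoin[OF y fg(1-3) z] fg(5) by blast+
    then show ?thesis using max by blast
  qed
  define \<sigma> where "\<sigma> x = (if x \<in> Qbar then THE y. (x, y) \<in> M else x)" for x
  have eq: "\<sigma> x = y" if "(x, y) \<in> M" for x y
    using that g_fun g_dom[OF that] by (auto simp: \<sigma>_def intro: the_equality)
  have sM: "(x, \<sigma> x) \<in> M" if "x \<in> Qbar" for x using dom[OF that] eq by blast
  have poly0: "poly p (\<sigma> x) = 0" if "\<And>i. coeff p i \<in> \<rat>" "poly p x = 0" "x \<in> Qbar" for p x
    using gp_poly[OF gp_rat[OF that(1)] sM[OF that(3)]] that(2) g_zero by simp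
  have Qb: "\<sigma> x \<in> Qbar" if x: "x \<in> Qbar" for x
  proof -
    obtain p where "\<forall>i. coeff p i \<in> \<rat>" "p \<noteq> 0" "poly p x = 0"
      using x unfolding Qbar_def algebraic_altdef by blast
    then show ?thesis unfolding Qbar_def algebraic_altdef using poly0[OF _ _ x] by blast
  qed
  have inj: "inj_on \<sigma> Qbar"
  proof (rule inj_onI)
    fix x y assume xy: "x \<in> Qbar" "y \<in> Qbar" "\<sigma> x = \<sigma> y"
    then have "(x - y, 0) \<in> M" using g_diff[OF sM[OF xy(1)] sM[OF xy(2)]] by simp
    then show "x = y" using g_inverse(1)[of "x - y" 0] by auto
  qed
  have surj: "\<sigma> ` Qbar = Qbar"
  proof
    show "Qbar \<subseteq> \<sigma> ` Qbar"
    proof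
      fix x assume x: "x \<in> Qbar"
      obtain p where p: "\<forall>i. coeff p i \<in> \<rat>" "p \<noteq> 0" "poly p x = 0"
        using x unfolding Qbar_def algebraic_altdef by blast
      define Z where "Z = {z. poly p z = 0}"
      have fin: "finite Z" unfolding Z_def using p(2) by (rule poly_roots_finite)
      have ZQ: "Z \<subseteq> Qbar" unfolding Z_def Qbar_def algebraic_altdef using p by blast
      have "\<sigma> ` Z \<subseteq> Z" using poly0[of p] p(1) ZQ unfolding Z_def by auto
      then have "\<sigma> ` Z = Z" using fin inj ZQ by (metis endo_inj_surj inj_on_subset)
      then show "x \<in> \<sigma> ` Qbar" using p(3) ZQ unfolding Z_def by (metis (mono_tags, lifting) image_mono mem_Collect_eq subsetD)
    qed
  qed (use Qb in auto)
  have "\<sigma> ` UNIV = UNIV"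
  proof -
    have "\<sigma> ` (- Qbar) = - Qbar" by (auto simp: \<sigma>_def image_def)
    then have "\<sigma> ` (Qbar \<union> - Qbar) = UNIV" unfolding image_Un surj by simp
    then show ?thesis by simp
  qed
  moreover have "inj \<sigma>"
    using inj Qb by (auto simp: inj_def inj_on_def) (metis \<sigma>_def)
  ultimately have "bij \<sigma>" by (simp add: bij_def)
  moreover have "\<sigma> (x + y) = \<sigma> x + \<sigma> y \<and> \<sigma> (x * y) = \<sigma> x * \<sigma> y" if "x \<in> Qbar" "y \<in> Qbar" for x y
    using eq[OF g_add[OF sM[OF that(1)] sM[OF that(2)]]] eq[OF g_mult[OF sM[OF that(1)] sM[OF that(2)]]] by simp
  ultimately have "\<sigma> \<in> qaut" using Qb by (auto simp: qaut_def) (simp add: \<sigma>_def)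
  then show ?thesis using eq M(2) by auto
qed

text \<open>The fixed field of the automorphisms over \<open>K\<close> is \<open>K\<close>. The second root that \<open>x\<close> is moved to
  exists because the derivative of the minimal polynomial does not vanish at \<open>x\<close>.\<close>

lemma qaut_moves:
  assumes K: "is_subfield K" "K \<subseteq> Qbar" and x: "x \<in> Qbar" "x \<notin> K"
  shows "\<exists>\<sigma>\<in>qaut. (\<forall>a\<in>K. \<sigma> a = a) \<and> \<sigma> x \<noteq> x"
proof -
  interpret K: cfield K by (rule cfieldI[OF K(1)])
  have "is_hom_graph (Id_on K)"
    unfolding is_hom_graph_def using K(2) by (auto simp: K.rat K.add K.mult)
  then interpret hom_graph "Id_on K" by unfold_locales
  have gp: "graph_poly (Id_on K) p q \<longleftrightarrow> q = p \<and> (\<forall>i. coeff p i \<in> K)" for p q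
    by (auto simp: graph_poly_def poly_eq_iff)
  obtain f g where fg: "graph_poly (Id_on K) f g" "lead_coeff f = 1" "poly f x = 0" "degree f > 0"
    "\<And>p q. graph_poly (Id_on K) p q \<Longrightarrow> poly p x = 0 \<Longrightarrow> p \<noteq> 0 \<Longrightarrow> degree f \<le> degree p"
    using minimal_poly[OF x(1)] by metis
  have gf: "g = f" and cf: "coeff f i \<in> K" for i using fg(1) by (auto simp: gp)
  obtain r where r: "f = [:- x, 1:] * r" using fg(3) by (metis dvdE poly_eq_0_iff_dvd)
  have r0: "r \<noteq> 0" using r fg(2) by auto
  have degr: "degree f = Suc (degree r)" unfolding r using r0 by (subst degree_mult_eq) auto
  have "degree r > 0"
  proof (rule ccontr)
    assume "\<not> degree r > 0"
    then obtain c where c: "r = [:c:]" by (metis degree_eq_zeroE neq0_conv)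
    then have "c = 1" using fg(2) r r0 by auto
    then have "coeff f 0 = - x" using r c by simp
    then show False using cf[of 0] K.uminus[of "- x"] x(2) by simp
  qed
  then obtain z where z: "poly r z = 0" using ex_poly_root by blast
  have "poly (pderiv f) x \<noteq> 0"
  proof
    assume 0: "poly (pderiv f) x = 0"
    have "graph_poly (Id_on K) (pderiv f) (pderiv f)" using cf by (auto simp: gp coeff_pderiv intro!: K.mult K.add K.one K.nat simp del: of_nat_Suc)
    moreover have "pderiv f \<noteq> 0" using fg(4) by (simp add: pderiv_eq_0_iff)
    ultimately have "degree f \<le> degree (pderiv f)" using fg(5) 0 by blast
    then show False using fg(4) by (simp add: degree_pderiv)
  qed
  then have "poly r x \<noteq> 0" unfolding r pderiv_mult by (simp add: pderiv_pCons)
  then have "z \<noteq> x" using z by auto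
  have "poly g z = 0" using z by (simp add: gf r)
  then have ga: "is_hom_graph (graph_adjoin (Id_on K) x z)" "Id_on K \<subseteq> graph_adjoin (Id_on K) x z"
    "(x, z) \<in> graph_adjoin (Id_on K) x z"
    using graph_adjoin[OF x(1) fg(1,2,3)] fg(5) by blast+
  obtain \<sigma> where s: "\<sigma> \<in> qaut" "\<forall>(x, y)\<in>graph_adjoin (Id_on K) x z. \<sigma> x = y"
    using hom_graph_extend[OF ga(1)] by blast
  then have "\<sigma> x = z" "\<forall>a\<in>K. \<sigma> a = a" using ga(2,3) by auto
  then show ?thesis using s(1) \<open>z \<noteq> x\<close> by blast
qed

text \<open>The orbit of \<open>x\<close> under the automorphisms of \<open>K\<close> over
  \<open>F\<close> is finite, as \<open>x\<close> is algebraic over \<open>F\<close>. The product of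
  the linear factors over this orbit has coefficients in the fixed field \<open>F\<close>, so
  \<open>\<sigma>\<close> maps \<open>x\<close> to a root of it, that is, into the orbit and hence
  into \<open>K\<close>.\<close>

lemma galois_extension_normal:
  assumes gal: "galois_extension K F" and KQ: "K \<subseteq> Qbar"
    and s: "\<sigma> \<in> qaut" "\<And>a. a \<in> F \<Longrightarrow> \<sigma> a = a" and x: "x \<in> K"
  shows "\<sigma> x \<in> K"
proof -
  have sub: "is_subfield K" "is_subfield F" "F \<subseteq> K" using gal by (auto simp: galois_extension_def)
  have fixed: "y \<in> F" if "y \<in> K" "\<And>\<tau>. field_automorphism K F \<tau> \<Longrightarrow> \<tau> y = y" for y
    using gal that unfolding galois_extension_def by blast
  interpret K: cfield K by (rule cfieldI[OF sub(1)])
  interpret s: chom Qbar \<sigma> by (rule qaut_chom[OF s(1)])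
  have hom: "chom K \<tau>" if "field_automorphism K F \<tau>" for \<tau>
    using field_automorphism_imp_chom[OF sub(1) that] .
  define Orb where "Orb = {\<tau> x | \<tau>. field_automorphism K F \<tau>}"
  obtain p where p: "p \<noteq> 0" "\<forall>i. coeff p i \<in> F" "poly p x = 0"
    using gal x unfolding galois_extension_def by blast
  have "poly p y = 0" if "y \<in> Orb" for y
  proof -
    obtain \<tau> where t: "field_automorphism K F \<tau>" "y = \<tau> x" using \<open>y \<in> Orb\<close> Orb_def by blast
    interpret chom K \<tau> by (rule hom[OF t(1)])
    have "\<tau> (coeff p i) = coeff p i" "coeff p i \<in> K" for i
      using t(1) p(2) sub(3) unfolding field_automorphism_def by blast+
    then have "\<tau> (poly p x) = poly p (\<tau> x)" using x by (intro hom_poly) auto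
    then show ?thesis using p(3) t(2) hom_zero by simp
  qed
  then have fin: "finite Orb" using finite_subset[OF _ poly_roots_finite[OF p(1)], of Orb] by auto
  have OK: "Orb \<subseteq> K" using x chom.hom_in[OF hom] unfolding Orb_def by auto
  have perm: "bij_betw \<tau> Orb Orb" if t: "field_automorphism K F \<tau>" for \<tau>
  proof -
    interpret chom K \<tau> by (rule hom[OF t])
    have "\<tau> ` Orb \<subseteq> Orb"
    proof
      fix y assume "y \<in> \<tau> ` Orb"
      then obtain \<rho> where r: "field_automorphism K F \<rho>" "y = (\<tau> \<circ> \<rho>) x" unfolding Orb_def by auto
      interpret r: chom K \<rho> by (rule hom[OF r(1)])
      have "field_automorphism K F (\<tau> \<circ> \<rho>)"
        using t r(1) r.hom_in sub(3) unfolding field_automorphism_def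
        by (auto intro: bij_betw_trans)
      then show "y \<in> Orb" using r(2) unfolding Orb_def by blast
    qed
    moreover have "inj_on \<tau> Orb" using hom_inj OK by (rule inj_on_subset)
    ultimately show ?thesis using fin by (simp add: bij_betw_def endo_inj_surj)
  qed
  define g where "g = (\<Prod>y\<in>Orb. [:- y, 1:])"
  have cF: "coeff g i \<in> F" for i
  proof (rule fixed)
    have fa_id: "field_automorphism K F id" by (simp add: field_automorphism_def)
    interpret i: chom K id by (rule hom[OF fa_id])
    show "coeff g i \<in> K" using i.coeff_linear_prod[of Orb "\<lambda>y. y" i] OK unfolding g_def by auto
    fix \<tau> assume t: "field_automorphism K F \<tau>"
    interpret chom K \<tau> by (rule hom[OF t])
    have "\<tau> (coeff g i) = coeff (\<Prod>y\<in>Orb. [:- \<tau> y, 1:]) i"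
      using coeff_linear_prod[of Orb "\<lambda>y. y" i] OK unfolding g_def by auto
    also have "(\<Prod>y\<in>Orb. [:- \<tau> y, 1:]) = g"
      unfolding g_def using prod.reindex_bij_betw[OF perm[OF t], of "\<lambda>y. [:- y, 1:]"] .
    finally show "\<tau> (coeff g i) = coeff g i" .
  qed
  have "x \<in> Orb" unfolding Orb_def by (auto intro!: exI[of _ id] simp: field_automorphism_def)
  then have "poly g x = 0" using fin by (auto simp: g_def poly_prod)
  moreover have "\<sigma> (poly g x) = poly g (\<sigma> x)"
    using cF s(2) sub(3) KQ x by (intro s.hom_poly) auto
  ultimately have "poly g (\<sigma> x) = 0" using s.hom_zero by simp
  then have "\<sigma> x \<in> Orb" using fin by (auto simp: g_def poly_prod)
  then show ?thesis using OK by blast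
qed

section \<open>Extending the p-adic absolute value to the algebraic numbers\<close>

locale csubring =
  fixes R :: "complex set"
  assumes r_one: "1 \<in> R" and r_diff: "x \<in> R \<Longrightarrow> y \<in> R \<Longrightarrow> x - y \<in> R"
    and r_mult: "x \<in> R \<Longrightarrow> y \<in> R \<Longrightarrow> x * y \<in> R"
begin

lemma r_zero: "0 \<in> R"
  using r_diff[OF r_one r_one] by simp

lemma r_uminus: "x \<in> R \<Longrightarrow> - x \<in> R"
  using r_diff[OF r_zero, of x] by simp

lemma r_add: "x \<in> R \<Longrightarrow> y \<in> R \<Longrightarrow> x + y \<in> R"
  using r_diff[OF _ r_uminus, of x y] by simp

lemma r_pow: "x \<in> R \<Longrightarrow> x ^ n \<in> R"
  by (induction n) (auto intro: r_one r_mult)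

lemma r_sum: "(\<And>i. i \<in> I \<Longrightarrow> f i \<in> R) \<Longrightarrow> sum f I \<in> R"
  by (induction I rule: infinite_finite_induct) (auto intro: r_zero r_add)

lemma r_int: "of_int n \<in> R"
proof -
  have "of_nat n \<in> R" for n by (induction n) (auto intro: r_zero r_one r_add)
  then show ?thesis by (cases n) (auto intro: r_uminus simp del: of_nat_Suc)
qed

definition adjoin :: "complex \<Rightarrow> complex set" where
  "adjoin x = {poly f x | f. \<forall>i. coeff f i \<in> R}"

lemma adjoin_self: "x \<in> adjoin x"
  unfolding adjoin_def
  by (auto intro!: exI[of _ "[:0, 1:]"] simp: coeff_pCons r_zero r_one split: nat.split)

lemma adjoin_base: "y \<in> R \<Longrightarrow> y \<in> adjoin x"
  unfolding adjoin_def
  by (auto intro!: exI[of _ "[:y:]"] simp: coeff_pCons r_zero split: nat.split)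

lemma adjoin_subring: "csubring (adjoin x)"
proof
  show "1 \<in> adjoin x" by (rule adjoin_base[OF r_one])
  fix y z assume "y \<in> adjoin x" "z \<in> adjoin x"
  then obtain f g where fg: "y = poly f x" "z = poly g x" "\<forall>i. coeff f i \<in> R" "\<forall>i. coeff g i \<in> R"
    unfolding adjoin_def by blast
  have "\<forall>i. coeff (f - g) i \<in> R" "\<forall>i. coeff (f * g) i \<in> R"
    using fg(3,4) by (auto simp: coeff_mult intro!: r_diff r_sum r_mult)
  moreover have "y - z = poly (f - g) x" "y * z = poly (f * g) x" using fg by auto
  ultimately show "y - z \<in> adjoin x" "y * z \<in> adjoin x" unfolding adjoin_def by blast+
qed

end

text \<open>Chevalley's construction of a valuation. Maximality is exploited by adjoining one
  element \<open>x\<close>: if \<open>x\<close> is missing from \<open>R\<close>, the larger ring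
  must contain \<open>1/p\<close>, which gives an explicit polynomial expression to compute
  with.\<close>

locale max_subring = csubring R for R +
  fixes p :: nat
  assumes p: "prime p" and R_Qbar: "R \<subseteq> Qbar" and p_notin: "inverse (of_nat p) \<notin> R"
    and R_max: "\<And>S. csubring S \<Longrightarrow> S \<subseteq> Qbar \<Longrightarrow> R \<subseteq> S \<Longrightarrow> inverse (of_nat p) \<notin> S \<Longrightarrow> S = R"
begin

abbreviation \<pi> :: complex where "\<pi> \<equiv> of_nat p"

lemma pi_nz: "\<pi> \<noteq> 0"
  using p by (auto dest: prime_gt_0_nat)

lemma pi_R: "\<pi> \<in> R"
  using r_int[of "int p"] by simp

lemma notin_R:
  assumes "x \<in> Qbar" "x \<notin> R"
  shows "\<exists>f. (\<forall>i. coeff f i \<in> R) \<and> poly f x = inverse \<pi>"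
proof -
  have "adjoin x \<subseteq> Qbar" using R_Qbar assms(1) unfolding adjoin_def by (auto intro!: Qb.poly)
  then have "inverse \<pi> \<in> adjoin x"
    using R_max[OF adjoin_subring[of x]] adjoin_self[of x] adjoin_base assms(2) by blast
  then show ?thesis unfolding adjoin_def by force
qed

text \<open>Write \<open>u = 1 - \<pi> * b\<close>. If \<open>1/u\<close> were missing,
  \<open>1/p\<close> would be a polynomial in \<open>1/u\<close>; clearing denominators puts
  \<open>u ^ n / p\<close> into \<open>R\<close>. But \<open>u ^ n\<close> is 1 modulo
  \<open>\<pi>\<close>, so \<open>1/p\<close> itself would lie in \<open>R\<close>.\<close>

lemma unit_1_minus:
  assumes b: "b \<in> R" shows "inverse (1 - \<pi> * b) \<in> R" "1 - \<pi> * b \<noteq> 0"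
proof -
  define u where "u = 1 - \<pi> * b"
  show u0: "1 - \<pi> * b \<noteq> 0"
  proof
    assume "1 - \<pi> * b = 0"
    then have "inverse \<pi> = b" by (intro inverse_unique) simp
    then show False using b p_notin by simp
  qed
  have uR: "u \<in> R" unfolding u_def by (intro r_diff r_one r_mult pi_R b)
  have pow: "\<exists>s\<in>R. u ^ n = 1 - \<pi> * s" for n
  proof (induction n)
    case (Suc n)
    then obtain s where s: "s \<in> R" "u ^ n = 1 - \<pi> * s" by blast
    have "u ^ Suc n = 1 - \<pi> * (b + s - \<pi> * b * s)" by (simp only: power_Suc s(2)) (simp add: u_def algebra_simps)
    moreover have "b + s - \<pi> * b * s \<in> R" by (intro r_diff r_add r_mult pi_R b s)
    ultimately show ?case by blast
  qed (auto intro!: bexI[of _ 0] r_zero)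
  show "inverse (1 - \<pi> * b) \<in> R"
  proof (rule ccontr)
    assume "inverse (1 - \<pi> * b) \<notin> R"
    then obtain f where f: "\<forall>i. coeff f i \<in> R" "poly f (inverse u) = inverse \<pi>"
      using notin_R[of "inverse u"] uR R_Qbar Qb.inv unfolding u_def by blast
    define n where "n = degree f"
    define r where "r = (\<Sum>i\<le>n. coeff f i * u ^ (n - i))"
    have rR: "r \<in> R" unfolding r_def using f(1) by (intro r_sum r_mult r_pow uR) auto
    have "u ^ n * inverse \<pi> = u ^ n * poly f (inverse u)" using f(2) by simp
    also have "\<dots> = (\<Sum>i\<le>n. coeff f i * (u ^ n * inverse u ^ i))"
      by (simp add: poly_altdef n_def sum_distrib_left mult_ac)
    also have "\<dots> = r" unfolding r_def
      using u0 by (intro sum.cong) (auto simp: power_diff u_def divide_inverse power_inverse)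
    finally have "u ^ n * inverse \<pi> = r" .
    moreover obtain s where s: "s \<in> R" "u ^ n = 1 - \<pi> * s" using pow by blast
    ultimately have "inverse \<pi> = r + s" using pi_nz by (simp add: field_simps)
    then show False using r_add[OF rR s(1)] p_notin by simp
  qed
qed

text \<open>By Bezout some multiple of \<open>u\<close> has the form \<open>1 - p * t\<close>, a
  unit by \<open>unit_1_minus\<close>.\<close>

lemma unit_int:
  assumes "\<not> int p dvd u" shows "inverse (of_int u) \<in> R"
proof -
  have "coprime u (int p)"
    using assms p by (metis coprime_commute prime_imp_coprime prime_nat_int_transfer)
  then obtain s t where st: "s * u + t * int p = 1"
    using bezout_int[of u "int p"] by (auto simp: coprime_iff_gcd_eq_1)
  have "complex_of_int s * of_int u = of_int (s * u)" by simp
  also have "s * u = 1 - int p * t" using st by (simp add: algebra_simps)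
  finally have eq: "complex_of_int s * of_int u = 1 - \<pi> * of_int t" by simp
  note un = unit_1_minus[OF r_int[of t], folded eq]
  have "inverse (complex_of_int u) = of_int s * inverse (of_int s * of_int u)"
    using un(2) by (simp add: field_simps)
  then show ?thesis using r_mult[OF r_int[of s] un(1)] by metis
qed

text \<open>Of two expressions of \<open>1/p\<close>, one in \<open>R[x]\<close> of degree \<open>n\<close> and one in \<open>R[1/x]\<close> of degree
  at most \<open>n\<close>, the second lets one eliminate the leading term of the first.\<close>

lemma reduce_degree:
  assumes x: "x \<noteq> 0" and f: "\<forall>i. coeff f i \<in> R" "poly f x = inverse \<pi>"
    and g: "\<forall>i. coeff g i \<in> R" "poly g (inverse x) = inverse \<pi>" and le: "degree g \<le> degree f"
  shows "\<exists>f'. (\<forall>i. coeff f' i \<in> R) \<and> poly f' x = inverse \<pi> \<and> degree f' < degree f"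
proof -
  define n m u where "n = degree f" and "m = degree g" and "u = 1 - \<pi> * coeff g 0"
  have m: "m > 0"
  proof (rule ccontr)
    assume "\<not> m > 0"
    then obtain c where "g = [:c:]" unfolding m_def by (metis degree_eq_zeroE neq0_conv)
    then have "inverse \<pi> = coeff g 0" using g(2) by simp
    then show False using g(1) p_notin by metis
  qed
  have u: "inverse u \<in> R" "u \<noteq> 0" using unit_1_minus g(1) by (auto simp: u_def)
  \<comment> \<open>Moving the constant term of the second expression to the left and dividing by
    the unit \<open>u\<close> writes 1 as a combination of negative powers of \<open>x\<close> with
    coefficients \<open>c j\<close>. Multiplied by \<open>x ^ n\<close>, this replaces
    \<open>x ^ n\<close> by lower powers.\<close>
  define c where "c j = \<pi> * coeff g j * inverse u" for j
  have c: "c j \<in> R" for j unfolding c_def using g(1) u pi_R by (intro r_mult) auto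
  have split: "{..m} = insert 0 {1..m}" by auto
  have "inverse \<pi> = coeff g 0 + (\<Sum>j\<in>{1..m}. coeff g j * inverse x ^ j)"
    using g(2) unfolding poly_altdef m_def[symmetric] split by simp
  then have "1 = \<pi> * (coeff g 0 + (\<Sum>j\<in>{1..m}. coeff g j * inverse x ^ j))"
    using pi_nz by (metis right_inverse)
  then have "u = (\<Sum>j\<in>{1..m}. \<pi> * coeff g j * inverse x ^ j)"
    unfolding u_def by (simp add: algebra_simps sum_distrib_left)
  then have "1 = (\<Sum>j\<in>{1..m}. \<pi> * coeff g j * inverse x ^ j) * inverse u"
    using u(2) by (metis right_inverse)
  also have "\<dots> = (\<Sum>j\<in>{1..m}. c j * inverse x ^ j)" unfolding sum_distrib_right by (simp add: c_def mult_ac)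
  finally have one: "1 = (\<Sum>j\<in>{1..m}. c j * inverse x ^ j)" .
  define h where "h = (\<Sum>j\<in>{1..m}. monom (c j) (n - j))"
  have "x ^ n = x ^ n * (\<Sum>j\<in>{1..m}. c j * inverse x ^ j)" using one by (metis mult.right_neutral)
  also have "\<dots> = (\<Sum>j\<in>{1..m}. c j * (x ^ n * inverse x ^ j))"
    by (simp add: sum_distrib_left mult_ac)
  also have "\<dots> = poly h x" unfolding h_def poly_sum poly_monom
    using x le by (intro sum.cong) (auto simp: power_diff n_def m_def divide_inverse power_inverse)
  finally have hx: "poly h x = x ^ n" ..
  have hR: "coeff h i \<in> R" for i unfolding h_def coeff_sum using c by (intro r_sum) (auto simp: r_zero)
  have hdeg: "coeff h i = 0" if "i \<ge> n" for i
    unfolding h_def coeff_sum using that m le by (intro sum.neutral) (auto simp: n_def m_def)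
  define f' where "f' = f - monom (coeff f n) n + smult (coeff f n) h"
  have "poly f' x = inverse \<pi>" using f(2) hx by (simp add: f'_def poly_monom)
  moreover have "coeff f' i \<in> R" for i
    unfolding f'_def using f(1) hR by (auto intro!: r_add r_diff r_mult simp: r_zero)
  moreover have "degree f' < degree f"
  proof -
    have "coeff f' i = 0" if "i \<ge> n" for i
      using that hdeg[OF that] by (cases "i = n") (auto simp: f'_def n_def coeff_eq_0)
    moreover have "n > 0" using m le by (simp add: n_def m_def)
    ultimately show ?thesis unfolding n_def
      by (metis leading_coeff_0_iff degree_0 linorder_not_less)
  qed
  ultimately show ?thesis by blast
qed

text \<open>If both \<open>x\<close> and its inverse were missing, each would give an expression of
  \<open>1/p\<close>. Taking both of least degree, the one of larger degree could still be shortened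
  by \<open>reduce_degree\<close>.\<close>

lemma valuation_ring:
  assumes "x \<in> Qbar" "x \<notin> R" shows "inverse x \<in> R"
proof (rule ccontr)
  assume inv: "inverse x \<notin> R"
  have x0: "x \<noteq> 0" using assms r_zero by auto
  define P where "P y n \<longleftrightarrow> (\<exists>f. (\<forall>i. coeff f i \<in> R) \<and> poly f y = inverse \<pi> \<and> degree f = n)" for y n
  have ex: "\<exists>n. P x n" "\<exists>n. P (inverse x) n"
    using notin_R[OF assms] notin_R[OF Qb.inv[OF assms(1)] inv] unfolding P_def by blast+
  define n m where "n = (LEAST n. P x n)" and "m = (LEAST n. P (inverse x) n)"
  have P: "P x n" "P (inverse x) m" unfolding n_def m_def using ex by (auto intro: LeastI_ex)
  have least: "\<not> P x k" if "k < n" for k using that not_less_Least unfolding n_def by blast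
  have least': "\<not> P (inverse x) k" if "k < m" for k using that not_less_Least unfolding m_def by blast
  obtain f g where f: "\<forall>i. coeff f i \<in> R" "poly f x = inverse \<pi>" "degree f = n"
    and g: "\<forall>i. coeff g i \<in> R" "poly g (inverse x) = inverse \<pi>" "degree g = m"
    using P unfolding P_def by blast
  show False
  proof (cases "m \<le> n")
    case True
    then show False using reduce_degree[OF x0 f(1,2) g(1,2)] f(3) g(3) least unfolding P_def by blast
  next
    case False
    then show False
      using reduce_degree[of "inverse x" g f] f g x0 least' unfolding P_def by (metis inverse_inverse_eq inverse_nonzero_iff_nonzero nle_le)
  qed
qed

lemma root_in_R:
  assumes "z \<in> Qbar" "z ^ k \<in> R" "k > 0" shows "z \<in> R"
proof (rule ccontr)
  assume z: "z \<notin> R"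
  then have inv: "inverse z \<in> R" using valuation_ring assms(1) by blast
  have "z \<noteq> 0" using z r_zero by auto
  then have "z = z ^ k * inverse z ^ (k - 1)"
    using assms(3) by (cases k) (auto simp: field_simps)
  then show False using z r_mult[OF assms(2) r_pow[OF inv, of "k - 1"]] by simp
qed

text \<open>This makes the valuation real-valued: no algebraic number is infinitely large compared
  with powers of \<open>1/p\<close>. If \<open>c\<close> is the leading coefficient of an integer
  polynomial for \<open>x\<close>, then \<open>c * x\<close> is an integral polynomial in
  \<open>1/x\<close> and lies in \<open>R\<close>; the part of \<open>c\<close> prime to
  \<open>p\<close> is a unit of \<open>R\<close>.\<close>

lemma clear_denominator:
  assumes "x \<in> Qbar" shows "\<exists>k. \<pi> ^ k * x \<in> R"
proof (cases "x \<in> R")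
  case True
  then show ?thesis by (intro exI[of _ 0]) simp
next
  case False
  then have y: "inverse x \<in> R" using valuation_ring assms by blast
  have x0: "x \<noteq> 0" using False r_zero by auto
  obtain f where f: "\<forall>i. coeff f i \<in> \<int>" "f \<noteq> 0" "poly f x = 0"
    using assms unfolding Qbar_def algebraic_def by blast
  define n where "n = degree f"
  have n: "n > 0"
  proof (rule ccontr)
    assume "\<not> n > 0"
    then obtain c where "f = [:c:]" unfolding n_def by (metis degree_eq_zeroE neq0_conv)
    then show False using f by auto
  qed
  obtain c where c: "coeff f n = of_int c" using f(1) by (auto elim: Ints_cases)
  have "c \<noteq> 0" using c f(2) n_def by auto
  moreover have "\<not> is_unit (int p)" using p by (auto dest: prime_gt_1_nat)
  ultimately obtain u where u: "c = int p ^ multiplicity (int p) c * u" "\<not> int p dvd u"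
    by (metis multiplicity_decompose')
  \<comment> \<open>Multiplying the equation of \<open>x\<close> by the power \<open>n - 1\<close>
    of \<open>1/x\<close> leaves \<open>x\<close> in the top term only; all other terms become
    powers of \<open>1/x\<close>.\<close>
  have xy: "x ^ i * inverse x ^ (n - 1) = (if i = n then x else inverse x ^ (n - 1 - i))" if "i \<le> n" for i
  proof (cases "i = n")
    case True
    then show ?thesis using n x0 by (cases n) (auto simp: field_simps)
  next
    case False
    then have "n - 1 = i + (n - 1 - i)" using that by simp
    then have "inverse x ^ (n - 1) = inverse x ^ i * inverse x ^ (n - 1 - i)" by (metis power_add)
    then show ?thesis using False x0 by (simp add: field_simps)
  qed
  have "0 = poly f x * inverse x ^ (n - 1)" using f(3) by simp
  also have "\<dots> = (\<Sum>i\<le>n. coeff f i * (x ^ i * inverse x ^ (n - 1)))"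
    unfolding poly_altdef n_def sum_distrib_right by (simp add: mult_ac)
  also have "\<dots> = (\<Sum>i\<le>n. coeff f i * (if i = n then x else inverse x ^ (n - 1 - i)))"
    using xy by (intro sum.cong) auto
  also have "{..n} = insert n {..<n}" by auto
  also have "(\<Sum>i\<in>insert n {..<n}. coeff f i * (if i = n then x else inverse x ^ (n - 1 - i))) =
      of_int c * x + (\<Sum>i<n. coeff f i * inverse x ^ (n - 1 - i))"
    by (simp add: c)
  finally have "of_int c * x = - (\<Sum>i<n. coeff f i * inverse x ^ (n - 1 - i))" by (simp add: add_eq_0_iff2)
  moreover have "coeff f i \<in> R" for i using f(1) r_int by (metis Ints_cases)
  ultimately have cR: "of_int c * x \<in> R" using y by (auto intro!: r_uminus r_sum r_mult r_pow)
  have "complex_of_int c = \<pi> ^ multiplicity (int p) c * complex_of_int u"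
    using arg_cong[OF u(1), of complex_of_int] by simp
  moreover have "u \<noteq> 0" using u(2) by auto
  ultimately have "\<pi> ^ multiplicity (int p) c * x = of_int c * x * inverse (of_int u)"
    by simp
  then show ?thesis using r_mult[OF cR unit_int[OF u(2)]] by metis
qed

section \<open>The real-valued valuation of the maximal ring\<close>

text \<open>\<open>D x a b\<close> says that \<open>a / b\<close> is at most the valuation of \<open>x\<close>.\<close>

definition D :: "complex \<Rightarrow> int \<Rightarrow> nat \<Rightarrow> bool" where
  "D x a b \<longleftrightarrow> x ^ b * \<pi> powi (- a) \<in> R"

lemma powi_Qbar: "\<pi> powi a \<in> Qbar"
  by (cases a rule: int_cases2) (auto simp: power_int_minus intro!: Qb.inv Qb.pow Qb.nat)

text \<open>The fraction need not be reduced: scaling it by \<open>k\<close> raises the tested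
  element to its \<open>k\<close>-th power, and \<open>R\<close> contains the \<open>k\<close>-th
  roots of its elements.\<close>

lemma D_scale:
  assumes "x \<in> Qbar" "k > 0" shows "D x (a * int k) (b * k) \<longleftrightarrow> D x a b"
proof -
  have "x ^ (b * k) * \<pi> powi (- (a * int k)) = (x ^ b * \<pi> powi (- a)) ^ k"
    using power_int_mult[of \<pi> "- a" "int k"] by (simp add: power_mult power_mult_distrib)
  moreover have "x ^ b * \<pi> powi (- a) \<in> Qbar" using assms powi_Qbar by (intro Qb.mult Qb.pow)
  ultimately show ?thesis unfolding D_def using root_in_R[OF _ _ assms(2)] r_pow by metis
qed

lemma D_mono: "D x a b \<Longrightarrow> a' \<le> a \<Longrightarrow> D x a' b"
proof -
  assume D: "D x a b" and le: "a' \<le> a"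
  have "\<pi> powi (- a') = \<pi> powi (- a) * \<pi> powi (int (nat (a - a')))"
    using le pi_nz by (simp add: power_int_add[symmetric])
  then have "x ^ b * \<pi> powi (- a') = x ^ b * \<pi> powi (- a) * \<pi> ^ nat (a - a')"
    by (simp only: power_int_of_nat mult.assoc)
  then show ?thesis using D r_mult[OF _ r_pow[OF pi_R]] unfolding D_def by metis
qed

lemma D_le:
  assumes x: "x \<in> Qbar" and "b > 0" "b' > 0" "D x a b" "real_of_int a' / real b' \<le> real_of_int a / real b"
  shows "D x a' b'"
proof -
  have "real_of_int (a' * int b) \<le> real_of_int (a * int b')"
    using assms(2,3,5) by (simp add: field_simps)
  then have le: "a' * int b \<le> a * int b'" by linarith
  have "D x (a * int b') (b * b')" using D_scale[OF x assms(3)] assms(4) by blast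
  then have "D x (a' * int b) (b' * b)" using D_mono le by (metis mult.commute)
  then show ?thesis using D_scale[OF x assms(2)] by blast
qed

text \<open>A Dedekind cut in place of an abstract value group; it is normalised so that
  \<open>p\<close> has valuation 1.\<close>

definition val :: "complex \<Rightarrow> real" where
  "val x = Sup {real_of_int a / real b | a b. b > 0 \<and> D x a b}"

lemma pi_powi_R: "\<pi> powi a \<in> R \<longleftrightarrow> a \<ge> 0"
proof
  assume a: "\<pi> powi a \<in> R"
  show "a \<ge> 0"
  proof (rule ccontr)
    assume neg: "\<not> a \<ge> 0"
    have "\<pi> ^ nat (- a - 1) = \<pi> powi (- a - 1)" using neg by (simp add: power_int_def)
    then have "\<pi> powi a * \<pi> ^ nat (- a - 1) = \<pi> powi (a + (- a - 1))"
      using pi_nz by (metis power_int_add)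
    then have "\<pi> powi a * \<pi> ^ nat (- a - 1) = inverse \<pi>" by (simp add: power_int_minus)
    then show False using r_mult[OF a r_pow[OF pi_R]] p_notin by metis
  qed
qed (auto simp: power_int_def intro: r_pow pi_R)

text \<open>A denominator bound \<open>\<pi> ^ k\<close> for \<open>1/x\<close> limits how far
  \<open>x\<close> can be divided by powers of \<open>\<pi>\<close>.\<close>

lemma val_bdd:
  assumes "x \<in> Qbar" "x \<noteq> 0"
  shows "bdd_above {real_of_int a / real b | a b. b > 0 \<and> D x a b}"
proof -
  obtain k where k: "\<pi> ^ k * inverse x \<in> R" using clear_denominator[OF Qb.inv[OF assms(1)]] by blast
  have "real_of_int a / real b \<le> real k" if "b > 0" "D x a b" for a b
  proof -
    have "(\<pi> ^ k * inverse x) ^ b * (x ^ b * \<pi> powi (- a)) \<in> R"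
      using that(2) r_pow[OF k] r_mult unfolding D_def by blast
    also have "(\<pi> ^ k * inverse x) ^ b * (x ^ b * \<pi> powi (- a)) = \<pi> powi (int (k * b) + - a)"
    proof -
      have "\<pi> powi (int (k * b) + - a) = \<pi> ^ (k * b) * \<pi> powi (- a)"
        using pi_nz by (subst power_int_add) (auto simp only: power_int_of_nat)
      moreover have "(\<pi> ^ k * inverse x) ^ b * x ^ b = \<pi> ^ (k * b)"
        using assms(2) by (simp add: power_mult power_mult_distrib power_inverse)
      ultimately show ?thesis by (metis mult.assoc)
    qed
    finally have "a \<le> int (k * b)" using pi_powi_R by simp
    then have "real_of_int a \<le> real_of_int (int (k * b))" by linarith
    then show ?thesis using that(1) by (simp add: field_simps)
  qed
  then show ?thesis by (intro bdd_aboveI[of _ "real k"]) auto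
qed

lemma D_imp_le_val:
  assumes "x \<in> Qbar" "x \<noteq> 0" "b > 0" "D x a b" shows "real_of_int a / real b \<le> val x"
  unfolding val_def using assms by (intro cSup_upper val_bdd) auto

lemma less_val_imp_D:
  assumes "x \<in> Qbar" "b > 0" "real_of_int a / real b < val x" shows "D x a b"
proof -
  obtain k where k: "\<pi> ^ k * x \<in> R" using clear_denominator[OF assms(1)] by blast
  have "D x (- int k) 1" using k by (simp add: D_def mult.commute)
  then have "{real_of_int a / real b | a b. b > 0 \<and> D x a b} \<noteq> {}" using zero_less_one by blast
  from less_cSupE[OF assms(3)[unfolded val_def] this] obtain t
    where "t \<in> {real_of_int a / real b | a b. b > 0 \<and> D x a b}" "real_of_int a / real b < t" .
  then obtain a' b' where "b' > 0" "D x a' b'" "real_of_int a / real b < real_of_int a' / real b'"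
    by blast
  then show ?thesis using D_le[OF assms(1) _ assms(2)] by (meson less_imp_le)
qed

lemma rat_between:
  fixes s t :: real assumes "s < t"
  obtains a b where "b > 0" "s < real_of_int a / real b" "real_of_int a / real b < t"
proof -
  obtain q where q: "q \<in> \<rat>" "s < q" "q < t" using Rats_dense_in_real[OF assms] by blast
  obtain a b where "b > 0" "q = real_of_int a / real_of_int b" using q(1) by (auto elim: Rats_cases')
  then have "nat b > 0" "q = real_of_int a / real (nat b)" by auto
  then show ?thesis using that q by metis
qed

lemma val_geI:
  assumes "x \<in> Qbar" "x \<noteq> 0"
    and "\<And>a b. b > 0 \<Longrightarrow> real_of_int a / real b < t \<Longrightarrow> D x a b"
  shows "t \<le> val x"
proof (rule ccontr)
  assume "\<not> t \<le> val x"
  then have "val x < t" by simp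
  then obtain b a where ab: "b > 0" "val x < real_of_int a / real b" "real_of_int a / real b < t"
    by (rule rat_between)
  then show False using D_imp_le_val[OF assms(1,2) ab(1) assms(3)[OF ab(1,3)]] by simp
qed

lemma val_mult_ge:
  assumes x: "x \<in> Qbar" "x \<noteq> 0" and y: "y \<in> Qbar" "y \<noteq> 0"
  shows "val x + val y \<le> val (x * y)"
proof (rule val_geI)
  fix a b assume b: "b > (0::nat)" and "real_of_int a / real b < val x + val y"
  then have "real_of_int a / real b - val y < val x" by simp
  then obtain d c where cd: "d > 0" "real_of_int a / real b - val y < real_of_int c / real d"
    "real_of_int c / real d < val x" by (rule rat_between)
  have Dx: "D x (c * int b) (d * b)" using less_val_imp_D[OF x(1) cd(1,3)] D_scale[OF x(1) b] by blast
  have "real_of_int (a * int d - c * int b) / real (d * b) = real_of_int a / real b - real_of_int c / real d"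
    using cd b by (simp add: field_simps)
  then have "real_of_int (a * int d - c * int b) / real (d * b) < val y" using cd(2) by linarith
  then have Dy: "D y (a * int d - c * int b) (d * b)" using less_val_imp_D[OF y(1)] cd(1) b by simp
  have "\<pi> powi (- (a * int d)) = \<pi> powi (- (c * int b)) * \<pi> powi (- (a * int d - c * int b))"
    using pi_nz by (simp add: power_int_add[symmetric])
  then have "(x * y) ^ (b * d) * \<pi> powi (- (a * int d)) =
    (x ^ (d * b) * \<pi> powi (- (c * int b))) * (y ^ (d * b) * \<pi> powi (- (a * int d - c * int b)))"
    by (simp add: power_mult_distrib mult_ac)
  then have "D (x * y) (a * int d) (b * d)" using r_mult Dx Dy unfolding D_def by metis
  then show "D (x * y) a b" using D_scale[OF Qb.mult[OF x(1) y(1)] cd(1)] by blast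
qed (use x y Qb.mult in auto)

text \<open>Above the cut of \<open>x\<close> the tested element is not in \<open>R\<close>, so its
  inverse is, and that inverse tests \<open>1/x\<close> at the negated fraction.\<close>

lemma val_inverse_ge:
  assumes x: "x \<in> Qbar" "x \<noteq> 0" shows "- val x \<le> val (inverse x)"
proof (rule val_geI)
  fix a b assume b: "b > (0::nat)" and "real_of_int a / real b < - val x"
  then have "val x < real_of_int (- a) / real b" by simp
  then have "\<not> D x (- a) b" using D_imp_le_val[OF x b, of "- a"] by linarith
  then have "inverse (x ^ b * \<pi> powi a) \<in> R"
    unfolding D_def using valuation_ring[OF Qb.mult[OF Qb.pow[OF x(1)] powi_Qbar]] by (metis minus_minus)
  then show "D (inverse x) a b" by (simp add: D_def power_int_minus power_inverse)
qed (use x Qb.inv in auto)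

lemma val_1: "val 1 = 0"
proof -
  have "val 1 \<le> val (inverse 1 :: complex)" by simp
  moreover have "D 1 0 1" using r_one by (simp add: D_def)
  then have "0 \<le> val 1" using D_imp_le_val[OF Qb.one, of 1 0] by simp
  moreover have "val 1 + val 1 \<le> val (1 * 1)" by (rule val_mult_ge) (auto intro: Qb.one)
  ultimately show ?thesis by simp
qed

text \<open>Superadditivity for the pair \<open>x * y\<close> and \<open>1/y\<close>, together with
  the bound for \<open>1/y\<close>, gives the missing inequality.\<close>

lemma val_mult:
  assumes x: "x \<in> Qbar" "x \<noteq> 0" and y: "y \<in> Qbar" "y \<noteq> 0"
  shows "val (x * y) = val x + val y"
proof -
  have "val (x * y) + val (inverse y) \<le> val (x * y * inverse y)"
    using x y by (intro val_mult_ge) (auto intro: Qb.mult Qb.inv)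
  then have "val (x * y) + val (inverse y) \<le> val x" using y(2) by (simp add: mult.assoc)
  then show ?thesis using val_inverse_ge[OF y] val_mult_ge[OF x y] by linarith
qed

text \<open>The point is that nothing outside \<open>R\<close> has valuation 0. If \<open>x\<close>
  is missing from \<open>R\<close>, an expression of \<open>1/p\<close> in \<open>x\<close>
  multiplied by a power of \<open>1/x\<close> shows that \<open>p\<close> divides that power in
  \<open>R\<close>, so \<open>1/x\<close> has positive valuation.\<close>

lemma val_nonneg_iff:
  assumes x: "x \<in> Qbar" "x \<noteq> 0" shows "0 \<le> val x \<longleftrightarrow> x \<in> R"
proof
  assume "x \<in> R"
  then have "D x 0 1" by (simp add: D_def)
  then show "0 \<le> val x" using D_imp_le_val[OF x, of 1 0] by simp
next
  assume v: "0 \<le> val x"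
  show "x \<in> R"
  proof (rule ccontr)
    assume xR: "x \<notin> R"
    then obtain f where f: "\<forall>i. coeff f i \<in> R" "poly f x = inverse \<pi>" using notin_R x by blast
    have y: "inverse x \<in> R" using valuation_ring x xR by blast
    \<comment> \<open>The successor keeps the denominator of the lower bound \<open>1 / n\<close>
      positive.\<close>
    define n where "n = Suc (degree f)"
    have "inverse x ^ n * inverse \<pi> = inverse x ^ n * poly f x" using f by simp
    also have "\<dots> = (\<Sum>i\<le>degree f. coeff f i * (inverse x ^ n * x ^ i))"
      by (simp add: poly_altdef sum_distrib_left mult_ac)
    also have "\<dots> = (\<Sum>i\<le>degree f. coeff f i * inverse x ^ (n - i))"
    proof (rule sum.cong)
      fix i assume "i \<in> {..degree f}"
      then have "inverse x ^ n = inverse x ^ (n - i) * inverse x ^ i"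
        by (simp add: n_def flip: power_add)
      then show "coeff f i * (inverse x ^ n * x ^ i) = coeff f i * inverse x ^ (n - i)"
        using x(2) by (simp flip: power_mult_distrib add: mult.assoc)
    qed simp
    also have "\<dots> \<in> R" using f(1) y by (auto intro!: r_sum r_mult r_pow)
    finally have "D (inverse x) 1 n" by (simp add: D_def power_int_minus)
    then have "1 / real n \<le> val (inverse x)"
      using D_imp_le_val[OF Qb.inv[OF x(1)], of n 1] x by (simp add: n_def)
    moreover have "val x + val (inverse x) \<le> val 1" using val_mult_ge[OF x Qb.inv[OF x(1)]] x by simp
    moreover have "1 / real n > 0" by (simp add: n_def)
    ultimately show False using v val_1 by linarith
  qed
qed

lemma val_int:
  assumes "a \<noteq> 0" shows "val (of_int a) = real (multiplicity (int p) a)"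
proof -
  have piQ: "\<pi> \<in> Qbar" using Qb.nat by simp
  have "val \<pi> = 1"
  proof (rule antisym)
    have "D \<pi> 1 1" using pi_nz r_one by (simp add: D_def power_int_minus)
    then show "1 \<le> val \<pi>" using D_imp_le_val[OF piQ pi_nz, of 1 1] by simp
    show "val \<pi> \<le> 1"
    proof (rule ccontr)
      assume "\<not> val \<pi> \<le> 1"
      then have "1 < val \<pi>" by simp
      then obtain d c where cd: "d > 0" "1 < real_of_int c / real d" "real_of_int c / real d < val \<pi>"
        by (rule rat_between)
      then have "D \<pi> c d" using less_val_imp_D[OF piQ] by blast
      moreover have "\<pi> ^ d * \<pi> powi (- c) = \<pi> powi (int d + - c)"
        using pi_nz by (subst power_int_add) auto
      ultimately have "int d + - c \<ge> 0" unfolding D_def using pi_powi_R by metis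
      then have "real_of_int c \<le> real d" by linarith
      then show False using cd by (simp add: field_simps)
    qed
  qed
  then have pow: "val (\<pi> ^ k) = real k" for k
  proof (induction k)
    case (Suc k)
    then show ?case using val_mult[OF piQ pi_nz Qb.pow[OF piQ], of k] pi_nz by simp
  qed (use val_1 in simp)
  have "\<not> is_unit (int p)" using p by (auto dest: prime_gt_1_nat)
  with assms obtain u where u: "a = int p ^ multiplicity (int p) a * u" "\<not> int p dvd u"
    by (metis multiplicity_decompose')
  have u0: "complex_of_int u \<noteq> 0" using u(2) by auto
  have "val (of_int u) \<ge> 0" "val (inverse (of_int u)) \<ge> 0"
    using val_nonneg_iff[OF Qb.int u0] val_nonneg_iff[OF Qb.inv[OF Qb.int[of u]]] u0 r_int unit_int[OF u(2)] by auto
  moreover have "val (of_int u) + val (inverse (of_int u)) = 0"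
    using val_mult[OF Qb.int u0 Qb.inv[OF Qb.int[of u]]] u0 val_1 by simp
  ultimately have vu: "val (of_int u) = 0" by linarith
  have "complex_of_int a = \<pi> ^ multiplicity (int p) a * of_int u"
    using arg_cong[OF u(1), of complex_of_int] by simp
  then show ?thesis using vu val_mult[OF Qb.pow[OF piQ] _ Qb.int u0] pow pi_nz by simp
qed

definition ext :: "complex \<Rightarrow> real" where
  "ext x = (if x = 0 then 0 else real p powr - val x)"

lemma ext_mult: "x \<in> Qbar \<Longrightarrow> y \<in> Qbar \<Longrightarrow> ext (x * y) = ext x * ext y"
  by (auto simp: ext_def val_mult powr_add[symmetric])

lemma ext_int: "a \<noteq> 0 \<Longrightarrow> ext (of_int a) = 1 / real p ^ multiplicity (int p) a"
  using p by (simp add: ext_def val_int powr_minus powr_realpow prime_gt_0_nat divide_inverse)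

lemma ext_add_le:
  assumes x: "x \<in> Qbar" and y: "y \<in> Qbar" and le: "ext x \<le> ext y" shows "ext (x + y) \<le> ext y"
proof -
  have p1: "real p > 1" using p prime_gt_1_nat by simp
  consider "x = 0" | "x + y = 0" | "x \<noteq> 0" "y = 0" | "x \<noteq> 0" "y \<noteq> 0" "x + y \<noteq> 0" by blast
  then show ?thesis
  proof cases
    case 4
    have z: "x / y \<in> Qbar" "x / y \<noteq> 0" using x y 4 by (auto intro: Qb.div)
    have eq: "x + y = y * (1 + x / y)" using 4 by (simp add: field_simps)
    then have z1: "1 + x / y \<in> Qbar" "1 + x / y \<noteq> 0" using z 4 by (auto intro: Qb.add Qb.one)
    have "val y \<le> val x" using le 4 p1 by (simp add: ext_def)
    moreover have "val x = val y + val (x / y)" using val_mult[OF y 4(2) z] 4(2) by simp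
    ultimately have "x / y \<in> R" using val_nonneg_iff[OF z] by simp
    then have "0 \<le> val (1 + x / y)" using val_nonneg_iff[OF z1] r_add[OF r_one] by blast
    moreover have "val (x + y) = val y + val (1 + x / y)"
      using val_mult[OF y 4(2) z1] eq by simp
    ultimately show ?thesis using 4 p1 by (simp add: ext_def)
  next
    case 2
    then show ?thesis by (simp add: ext_def)
  next
    case 3
    then show ?thesis using le p1 by (simp add: ext_def)
  qed (use le in simp)
qed

end

lemma ex_max_subring:
  assumes "prime p" shows "\<exists>R. max_subring R p"
proof -
  define A where "A = {R. csubring R \<and> R \<subseteq> Qbar \<and> inverse (of_nat p :: complex) \<notin> R}"
  have "csubring \<int>" by unfold_locales auto
  moreover have "\<int> \<subseteq> Qbar" using Qb.int by (auto elim: Ints_cases)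
  moreover have "inverse (of_nat p :: complex) \<notin> \<int>"
  proof
    assume "inverse (of_nat p :: complex) \<in> \<int>"
    then obtain k where k: "inverse (of_nat p :: complex) = of_int k" by (auto elim: Ints_cases)
    have "(of_int (int p * k) :: complex) = of_nat p * inverse (of_nat p)" by (simp add: k)
    also have "\<dots> = 1" using prime_gt_0_nat[OF assms] by (intro right_inverse) simp
    finally have "int p * k = 1" by (metis of_int_eq_1_iff)
    then have "int p dvd 1" by (metis dvd_triv_left)
    then show False using prime_gt_1_nat[OF assms] by simp
  qed
  ultimately have ZA: "\<int> \<in> A" by (simp add: A_def)
  have "\<exists>M\<in>A. \<forall>X\<in>A. M \<subseteq> X \<longrightarrow> X = M"
  proof (rule subset_Zorn_nonempty)
    show "A \<noteq> {}" using ZA by auto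
    fix C assume C: "C \<noteq> {}" "subset.chain A C"
    have CA: "C \<subseteq> A" using C(2) by (simp add: subset.chain_def)
    have two: "\<exists>X\<in>C. x \<in> X \<and> y \<in> X" if xy: "x \<in> \<Union>C" "y \<in> \<Union>C" for x y
    proof -
      obtain X Y where "X \<in> C" "x \<in> X" "Y \<in> C" "y \<in> Y" using xy by blast
      moreover from this have "X \<subseteq> Y \<or> Y \<subseteq> X" using C(2) by (auto simp: subset.chain_def)
      ultimately show ?thesis by blast
    qed
    have sub: "csubring X" if "X \<in> C" for X using that CA by (auto simp: A_def)
    have "csubring (\<Union>C)"
    proof
      show "1 \<in> \<Union>C" using C(1) csubring.r_one[OF sub] by auto
      fix x y assume "x \<in> \<Union>C" "y \<in> \<Union>C"
      from two[OF this] obtain X where "X \<in> C" "x \<in> X" "y \<in> X" by blast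
      then show "x - y \<in> \<Union>C" "x * y \<in> \<Union>C"
        using csubring.r_diff[OF sub] csubring.r_mult[OF sub] by blast+
    qed
    then show "\<Union>C \<in> A" using CA unfolding A_def by auto
  qed
  then obtain M where M: "M \<in> A" "\<forall>X\<in>A. M \<subseteq> X \<longrightarrow> X = M" by (rule bexE)
  then have "csubring M" by (simp add: A_def)
  then interpret csubring M .
  have "max_subring M p"
    using M assms by unfold_locales (auto simp: A_def)
  then show ?thesis by blast
qed

section \<open>Absolute values and local degrees\<close>

locale absval = cfield K for K +
  fixes v :: "complex \<Rightarrow> real"
  assumes av: "absolute_value K v"
begin

lemma v_nonneg: "x \<in> K \<Longrightarrow> 0 \<le> v x"
  and v_zero_iff: "x \<in> K \<Longrightarrow> v x = 0 \<longleftrightarrow> x = 0"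
  and v_mult: "x \<in> K \<Longrightarrow> y \<in> K \<Longrightarrow> v (x * y) = v x * v y"
  and v_add_le: "x \<in> K \<Longrightarrow> y \<in> K \<Longrightarrow> v (x + y) \<le> v x + v y"
  using av unfolding absolute_value_def by auto

lemma v_pos: "x \<in> K \<Longrightarrow> x \<noteq> 0 \<Longrightarrow> 0 < v x"
  using v_nonneg[of x] v_zero_iff[of x] by linarith

lemma v_zero: "v 0 = 0"
  using v_zero_iff[OF zero] by simp

lemma v_one: "v 1 = 1"
  using v_mult[OF one one] v_pos[OF one] by simp

lemma v_uminus_one: "v (- 1) = 1"
proof -
  have "v (- 1) * v (- 1) = 1" using v_mult[of "-1" "-1"] uminus[OF one] v_one by simp
  moreover have "v (- 1) \<ge> 0" using v_nonneg uminus[OF one] by simp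
  ultimately show ?thesis by (metis abs_of_nonneg abs_square_eq_1 power2_eq_square)
qed

lemma v_uminus: "x \<in> K \<Longrightarrow> v (- x) = v x"
  using v_mult[of "-1" x] uminus[OF one] v_uminus_one by simp

lemma v_diff_le: "x \<in> K \<Longrightarrow> y \<in> K \<Longrightarrow> v (x - y) \<le> v x + v y"
  using v_add_le[of x "- y"] uminus[of y] v_uminus[of y] by simp

lemma v_inverse: "x \<in> K \<Longrightarrow> v (inverse x) = inverse (v x)"
proof (cases "x = 0")
  case False
  assume x: "x \<in> K"
  have "v x * v (inverse x) = 1" using v_mult[OF x inv[OF x]] False v_one by simp
  then show ?thesis by (metis inverse_unique)
qed (simp add: v_zero)

lemma v_divide: "x \<in> K \<Longrightarrow> y \<in> K \<Longrightarrow> v (x / y) = v x / v y"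
  by (simp add: divide_inverse v_mult inv v_inverse)

lemma v_power: "x \<in> K \<Longrightarrow> v (x ^ n) = v x ^ n"
  by (induction n) (simp_all add: v_one v_mult pow)

lemma v_prod: "(\<And>i. i \<in> I \<Longrightarrow> f i \<in> K) \<Longrightarrow> v (prod f I) = (\<Prod>i\<in>I. v (f i))"
  by (induction I rule: infinite_finite_induct) (simp_all add: v_one v_mult prod)

lemma v_sum_le: "(\<And>i. i \<in> I \<Longrightarrow> f i \<in> K) \<Longrightarrow> v (sum f I) \<le> (\<Sum>i\<in>I. v (f i))"
proof (induction I rule: infinite_finite_induct)
  case (insert x A)
  then show ?case using v_add_le[of "f x" "sum f A"] sum[of A f] by simp
qed (simp_all add: v_zero)

end

lemma absvalI: "is_subfield K \<Longrightarrow> absolute_value K v \<Longrightarrow> absval K v"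
  by unfold_locales

section \<open>The chosen extensions of the rational places\<close>

text \<open>\<open>qplace 0\<close> is the usual absolute value, \<open>qplace p\<close> a \<open>p\<close>-adic one.\<close>

definition qplace :: "nat \<Rightarrow> complex \<Rightarrow> real" where
  "qplace q = restrict (if q = 0 then cmod else max_subring.ext (SOME R. max_subring R q) q) Qbar"

definition pindex :: "nat set" where
  "pindex = insert 0 {p. prime p}"

lemma pindex_cases:
  assumes "q \<in> pindex" obtains "q = 0" | "prime q"
  using assms by (auto simp: pindex_def)

lemma qplace_0: "x \<in> Qbar \<Longrightarrow> qplace 0 x = cmod x"
  by (simp add: qplace_def)

lemma qplace_prime:
  assumes "prime p"
  obtains R where "max_subring R p" "\<And>x. x \<in> Qbar \<Longrightarrow> qplace p x = max_subring.ext R p x"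
proof -
  have "max_subring (SOME R. max_subring R p) p" using ex_max_subring[OF assms] by (rule someI_ex)
  moreover have "p \<noteq> 0" using assms by auto
  ultimately show thesis using that by (simp add: qplace_def)
qed

lemma qplace_ultrametric:
  assumes "prime p" "x \<in> Qbar" "y \<in> Qbar" shows "qplace p (x + y) \<le> max (qplace p x) (qplace p y)"
proof -
  obtain R where R: "max_subring R p" "\<And>x. x \<in> Qbar \<Longrightarrow> qplace p x = max_subring.ext R p x"
    by (rule qplace_prime[OF assms(1)]) blast
  interpret max_subring R p by (rule R)
  show ?thesis using ext_add_le[OF assms(2,3)] ext_add_le[OF assms(3,2)] assms(2,3) Qb.add
    by (cases "ext x \<le> ext y") (auto simp: R(2) add.commute)
qed

lemma absolute_value_qplace:
  assumes "q \<in> pindex" shows "absolute_value Qbar (qplace q)"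
  using assms
proof (cases rule: pindex_cases)
  case 1
  then show ?thesis unfolding absolute_value_def
    by (auto simp: qplace_def norm_mult norm_triangle_ineq Qb.add Qb.mult)
next
  case 2
  obtain R where R: "max_subring R q" "\<And>x. x \<in> Qbar \<Longrightarrow> qplace q x = max_subring.ext R q x"
    by (rule qplace_prime[OF 2]) blast
  interpret max_subring R q by (rule R)
  have nn: "qplace q x \<ge> 0" if "x \<in> Qbar" for x using that by (simp add: R(2) ext_def)
  have "qplace q (x + y) \<le> qplace q x + qplace q y" if "x \<in> Qbar" "y \<in> Qbar" for x y
    using qplace_ultrametric[OF 2 that] nn[OF that(1)] nn[OF that(2)] by linarith
  moreover have "qplace q (x * y) = qplace q x * qplace q y" if "x \<in> Qbar" "y \<in> Qbar" for x y
    using that by (simp add: R(2) ext_mult Qb.mult)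
  moreover have "qplace q x = 0 \<longleftrightarrow> x = 0" if "x \<in> Qbar" for x
    using that 2 by (auto simp: R(2) ext_def)
  ultimately show ?thesis using nn unfolding absolute_value_def by (auto simp: qplace_def)
qed

lemma qplace_absval: "q \<in> pindex \<Longrightarrow> absval Qbar (qplace q)"
  by (intro absvalI is_subfield_Qbar absolute_value_qplace)

lemma qplace_prime_int:
  assumes "prime p" "a \<noteq> 0"
  shows "qplace p (of_int a) = 1 / real p ^ multiplicity (int p) a"
proof -
  obtain R where R: "max_subring R p" "\<And>x. x \<in> Qbar \<Longrightarrow> qplace p x = max_subring.ext R p x"
    by (rule qplace_prime[OF assms(1)]) blast
  interpret max_subring R p by (rule R)
  show ?thesis using ext_int[OF assms(2)] Qb.int by (simp add: R(2))
qed

text \<open>Archimedean and \<open>p\<close>-adic places are brought under one description, so that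
  every later estimate is proved once for all \<open>q\<close>.\<close>

definition places_over :: "nat \<Rightarrow> complex set \<Rightarrow> (complex \<Rightarrow> real) set" where
  "places_over q K = {v. absolute_value K v \<and> (\<forall>a::int. v (of_int a) = qplace q (of_int a))}"

lemma archimedean_place_iff: "archimedean_place K v \<longleftrightarrow> v \<in> places_over 0 K"
  by (auto simp: archimedean_place_def places_over_def qplace_0 Qb.int)

lemma padic_place_iff:
  assumes "prime p" "is_subfield K" shows "padic_place p K v \<longleftrightarrow> v \<in> places_over p K"
proof -
  have "qplace p 0 = 0" using absval.v_zero[OF qplace_absval] assms(1) by (simp add: pindex_def)
  moreover have "absolute_value K v \<Longrightarrow> v 0 = 0" using absval.v_zero[OF absvalI[OF assms(2)]] by blast
  ultimately show ?thesis using qplace_prime_int[OF assms(1)]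
    unfolding padic_place_def places_over_def by (auto simp: of_int_eq_0_iff) (metis of_int_0)
qed

lemma places_eq: "is_subfield K \<Longrightarrow> places K = (\<Union>q\<in>pindex. places_over q K)"
  by (auto simp: places_def pindex_def archimedean_place_iff padic_place_iff)

text \<open>The witnesses are 2 and \<open>1/q\<close>. Being rational, such a number has the same
  value at every place over \<open>q\<close> and serves as a common yardstick for comparing these
  places.\<close>

lemma qplace_gt_1:
  assumes "q \<in> pindex" obtains t where "t \<in> \<rat>" "qplace q t > 1"
  using assms
proof (cases rule: pindex_cases)
  case 1
  then show ?thesis using that[of 2] Qb.int[of 2] by (simp add: qplace_0)
next
  case 2
  interpret absval Qbar "qplace q" by (rule qplace_absval[OF assms])
  have "multiplicity (int q) (int q) = 1"
    using 2 by (intro multiplicity_self) (auto dest: prime_gt_1_nat)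
  then have "qplace q (of_int (int q)) = 1 / real q"
    using qplace_prime_int[OF 2, of "int q"] 2 by auto
  then have "qplace q (inverse (of_nat q)) = real q" using v_inverse[OF Qb.nat] by simp
  then show ?thesis using that[of "inverse (of_nat q)"] prime_gt_1_nat[OF 2] by simp
qed

section \<open>Finite spanning families of the completion\<close>

locale place = absval K v for K v +
  fixes q :: nat
  assumes q: "q \<in> pindex" and over: "v \<in> places_over q K"
begin

lemma v_rat: "x \<in> \<rat> \<Longrightarrow> v x = qplace q x"
proof -
  interpret w: absval Qbar "qplace q" by (rule qplace_absval[OF q])
  assume "x \<in> \<rat>"
  then obtain a b where "x = of_int a / of_int b" by (auto elim: Rats_cases')
  then show ?thesis using over int Qb.int by (simp add: v_divide w.v_divide places_over_def)
qed

text \<open>A quantitative form of linear independence: the uniform bound on coordinates passes to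
  limits, so it expresses independence in the completion and makes coordinates of Cauchy sequences
  Cauchy.\<close>

definition indep :: "'i set \<Rightarrow> ('i \<Rightarrow> complex) \<Rightarrow> bool" where
  "indep S e \<longleftrightarrow> (\<exists>c>0. \<forall>a. (\<forall>i\<in>S. a i \<in> \<rat>) \<longrightarrow> (\<forall>i\<in>S. c * v (a i) \<le> v (\<Sum>i\<in>S. a i * e i)))"

definition approx :: "complex set \<Rightarrow> complex \<Rightarrow> bool" where
  "approx V x \<longleftrightarrow> (\<forall>\<epsilon>>0. \<exists>s\<in>V. v (x - s) < \<epsilon>)"

lemma qspan_subset: "(\<And>i. i \<in> I \<Longrightarrow> e i \<in> K) \<Longrightarrow> qspan I e \<subseteq> K"
  unfolding qspan_def using rats_subset by (auto intro!: sum mult)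

text \<open>The distance \<open>\<delta>\<close> of the new vector from the old span bounds the new
  coordinate; subtracting the new term then reduces the other coordinates to the old bound.\<close>

lemma indep_insert:
  assumes S: "finite S" "j \<notin> S" "indep S e" and e: "\<And>i. i \<in> insert j S \<Longrightarrow> e i \<in> K"
    and na: "\<not> approx (qspan S e) (e j)"
  shows "indep (insert j S) e"
proof -
  obtain c where c: "c > 0" "\<And>a i. (\<forall>i\<in>S. a i \<in> \<rat>) \<Longrightarrow> i \<in> S \<Longrightarrow> c * v (a i) \<le> v (\<Sum>i\<in>S. a i * e i)"
    using S(3) unfolding indep_def by blast
  obtain \<delta> where d: "\<delta> > 0" "\<And>s. s \<in> qspan S e \<Longrightarrow> \<delta> \<le> v (e j - s)"
    using na unfolding approx_def by force
  \<comment> \<open>If \<open>t\<close> is a combination with coefficient \<open>a j\<close> at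
    \<open>j\<close>, then \<open>v (a j) \<le> v t / \<delta>\<close>, so removing that term
    enlarges the bound \<open>v t\<close> by at most the factor \<open>B\<close>.\<close>
  define B where "B = 1 + v (e j) / \<delta>"
  have ej: "e j \<in> K" "v (e j) \<ge> 0" using e v_nonneg by auto
  have B: "B > 0" using ej d(1) by (simp add: B_def add_pos_nonneg)
  define c' where "c' = min \<delta> (c / B)"
  have c': "c' > 0" using d(1) c(1) B by (simp add: c'_def)
  have "c' * v (a i) \<le> v (\<Sum>i\<in>insert j S. a i * e i)"
    if a: "\<forall>i\<in>insert j S. a i \<in> \<rat>" and i: "i \<in> insert j S" for a i
  proof -
    define s where "s = (\<Sum>i\<in>S. a i * e i)"
    define t where "t = (\<Sum>i\<in>insert j S. a i * e i)"
    have aK: "a i \<in> K" if "i \<in> insert j S" for i using a that rats_subset by blast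
    have sK: "s \<in> K" unfolding s_def using aK e by (intro sum mult) auto
    have t: "t = a j * e j + s" using S by (simp add: t_def s_def)
    have tK: "t \<in> K" unfolding t using aK ej sK by (intro add mult) auto
    have j: "\<delta> * v (a j) \<le> v t"
    proof (cases "a j = 0")
      case False
      have "(\<Sum>i\<in>S. (- a i / a j) * e i) \<in> qspan S e" using a by (intro qspanI) auto
      also have "(\<Sum>i\<in>S. (- a i / a j) * e i) = - s / a j"
        by (simp add: s_def sum_negf sum_divide_distrib)
      finally have "\<delta> \<le> v (e j - - s / a j)" by (rule d(2))
      moreover have "t = a j * (e j - - s / a j)" using False by (simp add: t field_simps)
      moreover have "e j - - s / a j \<in> K" using ej sK aK by (intro diff div uminus) auto
      ultimately have "v t = v (a j) * v (e j - - s / a j)" using v_mult aK by simp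
      moreover have "v (a j) * \<delta> \<le> v (a j) * v (e j - - s / a j)"
        using \<open>\<delta> \<le> v (e j - - s / a j)\<close> v_nonneg[OF aK, of j] by (intro mult_left_mono) auto
      ultimately show ?thesis by (simp only: mult.commute)
    qed (use v_nonneg[OF tK] in \<open>simp add: v_zero\<close>)
    show ?thesis
    proof (cases "i = j")
      case True
      have "c' * v (a j) \<le> \<delta> * v (a j)"
        using v_nonneg[OF aK, of j] by (intro mult_right_mono) (auto simp: c'_def)
      then show ?thesis using j True by (simp add: t_def)
    next
      case False
      then have iS: "i \<in> S" using i by simp
      have "c * v (a i) \<le> v s" unfolding s_def using c(2)[of a i] a iS by auto
      also have "s = t - a j * e j" by (simp add: t)
      also have "v (t - a j * e j) \<le> v t + v (a j) * v (e j)"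
        using v_diff_le[OF tK mult[OF aK[of j] ej(1)]] v_mult aK ej by simp
      also have "v (a j) * v (e j) \<le> v t / \<delta> * v (e j)"
        using j d(1) ej(2) by (intro mult_right_mono) (simp_all add: field_simps)
      also have "v t + v t / \<delta> * v (e j) = v t * B" by (simp add: B_def field_simps)
      finally have "c / B * v (a i) \<le> v t" using B by (simp add: field_simps)
      moreover have "c' * v (a i) \<le> c / B * v (a i)"
        using v_nonneg[OF aK[OF i]] by (intro mult_right_mono) (auto simp: c'_def)
      ultimately show ?thesis by (simp add: t_def)
    qed
  qed
  then show ?thesis unfolding indep_def using c' by blast
qed

lemma approx_qspan:
  assumes "finite I" "S \<subseteq> I" and e: "\<And>i. i \<in> I \<Longrightarrow> e i \<in> K"
    and appr: "\<And>i. i \<in> I \<Longrightarrow> approx (qspan S e) (e i)" and x: "x \<in> qspan I e"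
  shows "approx (qspan S e) x"
proof -
  let ?V = "qspan S e"
  have VK: "?V \<subseteq> K" using assms(2) e by (intro qspan_subset) auto
  obtain a where a: "x = (\<Sum>i\<in>I. a i * e i)" "\<forall>i\<in>I. a i \<in> \<rat>"
    using x unfolding qspan_def by blast
  have aK: "a i \<in> K" if "i \<in> I" for i using a(2) that rats_subset by blast
  show ?thesis unfolding approx_def
  proof (intro allI impI)
    fix \<epsilon> :: real assume \<epsilon>: "\<epsilon> > 0"
    define M where "M = 1 + (\<Sum>i\<in>I. v (a i))"
    have M: "M > 0" "(\<Sum>i\<in>I. v (a i)) < M"
      using sum_nonneg[of I "\<lambda>i. v (a i)"] v_nonneg[OF aK] by (auto simp: M_def)
    have "\<forall>i\<in>I. \<exists>s\<in>?V. v (e i - s) < \<epsilon> / M" using appr \<epsilon> M(1) by (simp add: approx_def)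
    then obtain s where s: "\<And>i. i \<in> I \<Longrightarrow> s i \<in> ?V" "\<And>i. i \<in> I \<Longrightarrow> v (e i - s i) < \<epsilon> / M" by metis
    have sK: "s i \<in> K" if "i \<in> I" for i using s(1)[OF that] VK by blast
    have "v (x - (\<Sum>i\<in>I. a i * s i)) = v (\<Sum>i\<in>I. a i * (e i - s i))"
      by (simp add: a(1) sum_subtractf right_diff_distrib)
    also have "\<dots> \<le> (\<Sum>i\<in>I. v (a i * (e i - s i)))" using aK e sK by (intro v_sum_le mult diff)
    also have "\<dots> = (\<Sum>i\<in>I. v (a i) * v (e i - s i))"
      using aK e sK by (intro sum.cong refl v_mult diff) auto
    also have "\<dots> \<le> (\<Sum>i\<in>I. v (a i) * (\<epsilon> / M))"
      using s(2) v_nonneg[OF aK] by (intro sum_mono mult_left_mono) (auto intro: less_imp_le)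
    also have "\<dots> = (\<Sum>i\<in>I. v (a i)) * (\<epsilon> / M)" by (simp only: sum_distrib_right)
    also have "\<dots> < M * (\<epsilon> / M)" using M \<epsilon> by (intro mult_strict_right_mono) auto
    also have "\<dots> = \<epsilon>" using M(1) by simp
    finally have "v (x - (\<Sum>i\<in>I. a i * s i)) < \<epsilon>" .
    moreover have "(\<Sum>i\<in>I. a i * s i) \<in> ?V" using a(2) s(1) by (intro qspan_sum qspan_scale) auto
    ultimately show "\<exists>s\<in>?V. v (x - s) < \<epsilon>" by blast
  qed
qed

definition spans_completion :: "nat \<Rightarrow> (nat \<Rightarrow> nat \<Rightarrow> complex) \<Rightarrow> bool" where
  "spans_completion n b \<longleftrightarrow> (\<forall>i<n. b i \<in> cauchy_seqs K v) \<and>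
     (\<forall>x\<in>cauchy_seqs K v. \<exists>c :: nat \<Rightarrow> nat \<Rightarrow> complex.
        (\<forall>i<n. c i \<in> cauchy_seqs \<rat> v) \<and>
        (\<lambda>k. v (x k - (\<Sum>i<n. c i k * b i k))) \<longlonglongrightarrow> 0)"

lemma local_degree_eq: "local_degree K v = (LEAST n. \<exists>b. spans_completion n b)"
  by (simp add: local_degree_def spans_completion_def)

lemma const_cauchy: "x \<in> K \<Longrightarrow> (\<lambda>_. x) \<in> cauchy_seqs K v"
  by (simp add: cauchy_seqs_def v_zero)

text \<open>The completion is spanned by a maximal subset of a basis whose coordinates are bounded with
  respect to \<open>v\<close>; no completeness is needed for this.\<close>

lemma ex_spans_completion:
  assumes I: "finite I" and K: "K = qspan I e"
  shows "\<exists>n b. spans_completion n b"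
proof -
  have eK: "e i \<in> K" if "i \<in> I" for i unfolding K using qspan_base[OF I that] .
  have "indep {} e" unfolding indep_def by (auto intro: exI[of _ 1])
  then have "\<exists>S. S \<subseteq> I \<and> indep S e \<and> (\<forall>S'. S' \<subseteq> I \<and> indep S' e \<longrightarrow> card S' \<le> card S)"
    using ex_has_greatest_nat[of "\<lambda>S. S \<subseteq> I \<and> indep S e" "{}" card "Suc (card I)"] card_mono[OF I]
    by (auto simp: less_Suc_eq_le)
  then obtain S where S: "S \<subseteq> I" "indep S e"
    and max: "\<And>S'. S' \<subseteq> I \<Longrightarrow> indep S' e \<Longrightarrow> card S' \<le> card S" by blast
  have fS: "finite S" using S(1) I finite_subset by blast
  let ?V = "qspan S e"
  have VK: "?V \<subseteq> K" using S(1) eK by (intro qspan_subset) auto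
  have "approx ?V (e i)" if i: "i \<in> I" for i
  proof (cases "i \<in> S")
    case True
    then have "e i \<in> ?V" using qspan_base[OF fS] by blast
    then show ?thesis unfolding approx_def by (auto intro!: bexI[of _ "e i"] simp: v_zero)
  next
    case False
    show ?thesis
    proof (rule ccontr)
      assume "\<not> approx ?V (e i)"
      moreover have "\<And>k. k \<in> insert i S \<Longrightarrow> e k \<in> K" using S(1) i eK by auto
      ultimately have "indep (insert i S) e" using indep_insert[OF fS False S(2)] by blast
      then show False using max[of "insert i S"] S(1) i fS False by simp
    qed
  qed
  then have appr: "approx ?V x" if "x \<in> K" for x
    using approx_qspan[OF I S(1), of e] eK that K by blast
  obtain c where c: "c > 0" "\<And>a i. (\<forall>i\<in>S. a i \<in> \<rat>) \<Longrightarrow> i \<in> S \<Longrightarrow> c * v (a i) \<le> v (\<Sum>i\<in>S. a i * e i)"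
    using S(2) unfolding indep_def by blast
  define n where "n = card S"
  obtain f where f: "bij_betw f {..<n} S" using ex_bij_betw_nat_finite[OF fS] by (auto simp: n_def atLeast0LessThan)
  have "spans_completion n (\<lambda>i _. e (f i))"
    unfolding spans_completion_def
  proof (intro conjI allI impI ballI)
    fix i assume "i < n"
    then have "f i \<in> S" using f by (auto simp: bij_betw_def)
    then show "(\<lambda>_. e (f i)) \<in> cauchy_seqs K v" using S(1) eK by (intro const_cauchy) auto
  next
    fix x assume x: "x \<in> cauchy_seqs K v"
    then have xK: "x k \<in> K" for k by (simp add: cauchy_seqs_def)
    have "\<exists>a. (\<forall>i\<in>S. a i \<in> \<rat>) \<and> v (x k - (\<Sum>i\<in>S. a i * e i)) < 1 / real (Suc k)" for k
    proof -
      have "1 / real (Suc k) > 0" by simp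
      then obtain s where "s \<in> ?V" "v (x k - s) < 1 / real (Suc k)"
        using appr[OF xK[of k]] unfolding approx_def by blast
      then show ?thesis unfolding qspan_def by blast
    qed
    then obtain a where a: "\<And>k i. i \<in> S \<Longrightarrow> a k i \<in> \<rat>"
      and ax: "\<And>k. v (x k - (\<Sum>i\<in>S. a k i * e i)) < 1 / real (Suc k)" by metis
    define s where "s k = (\<Sum>i\<in>S. a k i * e i)" for k
    have sK: "s k \<in> K" for k unfolding s_def using a S(1) eK rats_subset by (intro sum mult) auto
    have cau: "(\<lambda>k. a k i) \<in> cauchy_seqs \<rat> v" if i: "i \<in> S" for i
      unfolding cauchy_seqs_def
    proof (intro CollectI conjI allI impI)
      show "a k i \<in> \<rat>" for k using a[OF i] .
      fix \<epsilon> :: real assume \<epsilon>: "\<epsilon> > 0"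
      \<comment> \<open>One third for each of the three differences in the triangle inequality
        below; the factor \<open>c\<close> pays for passing from a vector to its coordinate.\<close>
      define \<eta> where "\<eta> = c * \<epsilon> / 3"
      have \<eta>: "\<eta> > 0" using \<epsilon> c(1) by (simp add: \<eta>_def)
      obtain M where M: "\<And>k l. k \<ge> M \<Longrightarrow> l \<ge> M \<Longrightarrow> v (x k - x l) < \<eta>"
        using x \<eta> unfolding cauchy_seqs_def by blast
      obtain M' where M': "1 / real (Suc M') < \<eta>" using \<eta> nat_approx_posE by blast
      have small: "v (x k - s k) < \<eta>" if "k \<ge> M'" for k
      proof -
        have "1 / real (Suc k) \<le> 1 / real (Suc M')" using that by (simp add: frac_le)
        then show ?thesis using ax[of k] M' by (simp add: s_def)
      qed
      have "v (a k i - a l i) < \<epsilon>" if kl: "k \<ge> max M M'" "l \<ge> max M M'" for k l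
      proof -
        have "c * v (a k i - a l i) \<le> v (\<Sum>i\<in>S. (a k i - a l i) * e i)"
          using c(2)[of "\<lambda>i. a k i - a l i" i] a i by auto
        also have "(\<Sum>i\<in>S. (a k i - a l i) * e i) = s k - s l"
          by (simp add: s_def left_diff_distrib sum_subtractf)
        also have "s k - s l = (x k - x l) - (x k - s k) + (x l - s l)" by simp
        also have "v \<dots> \<le> v (x k - x l) + v (x k - s k) + v (x l - s l)"
        proof -
          have "v ((x k - x l) - (x k - s k) + (x l - s l)) \<le> v ((x k - x l) - (x k - s k)) + v (x l - s l)"
            using xK sK by (intro v_add_le diff)
          moreover have "v ((x k - x l) - (x k - s k)) \<le> v (x k - x l) + v (x k - s k)"
            using xK sK by (intro v_diff_le diff)
          ultimately show ?thesis by linarith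
        qed
        also have "\<dots> < \<eta> + \<eta> + \<eta>" using M[of k l] small[of k] small[of l] kl by linarith
        also have "\<dots> = c * \<epsilon>" by (simp add: \<eta>_def)
        finally show ?thesis using c(1) by simp
      qed
      then show "\<exists>M. \<forall>i'\<ge>M. \<forall>j\<ge>M. v (a i' i - a j i) < \<epsilon>" by blast
    qed
    have fS': "f i \<in> S" if "i < n" for i using f that by (auto simp: bij_betw_def)
    have "(\<Sum>i<n. a k (f i) * e (f i)) = s k" for k
      unfolding s_def using sum.reindex_bij_betw[OF f, of "\<lambda>i. a k i * e i"] .
    then have "(\<lambda>k. v (x k - (\<Sum>i<n. a k (f i) * e (f i)))) = (\<lambda>k. v (x k - s k))" by simp
    moreover have "(\<lambda>k. v (x k - s k)) \<longlonglongrightarrow> 0"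
    proof (rule tendsto_sandwich[OF _ _ tendsto_const LIMSEQ_inverse_real_of_nat])
      show "\<forall>\<^sub>F k in sequentially. 0 \<le> v (x k - s k)" using v_nonneg[OF diff[OF xK sK]] by simp
      show "\<forall>\<^sub>F k in sequentially. v (x k - s k) \<le> inverse (real (Suc k))"
        using ax by (intro always_eventually allI) (simp add: s_def less_imp_le inverse_eq_divide)
    qed
    ultimately show "\<exists>c. (\<forall>i<n. c i \<in> cauchy_seqs \<rat> v) \<and>
        (\<lambda>k. v (x k - (\<Sum>i<n. c i k * e (f i)))) \<longlonglongrightarrow> 0"
      using cau fS' by (intro exI[of _ "\<lambda>i k. a k (f i)"]) auto
  qed
  then show ?thesis by blast
qed

end

section \<open>Counting the embeddings that induce a place\<close>

lemma lagrange_basis: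
  assumes "finite J" "\<And>i. i \<in> J \<Longrightarrow> z i \<in> Qbar" "inj_on z J" "j \<in> J"
  shows "\<exists>L. (\<forall>t. coeff L t \<in> Qbar) \<and> degree L \<le> card J \<and> (\<forall>i\<in>J. poly L (z i) = (if i = j then 1 else 0))"
proof -
  define P where "P = (\<Prod>i\<in>J - {j}. [:- z i, 1:])"
  interpret chom Qbar id by (rule qaut_chom[OF qaut_id])
  have cP: "coeff P t \<in> Qbar" for t unfolding P_def using coeff_linear_prod[of "J - {j}" z t] assms(2) by auto
  have Pj: "poly P (z j) \<noteq> 0" using assms by (auto simp: P_def poly_prod inj_on_def)
  have P0: "poly P (z i) = 0" if "i \<in> J" "i \<noteq> j" for i using that assms(1) by (auto simp: P_def poly_prod)
  have "degree P \<le> (\<Sum>i\<in>J - {j}. degree [:- z i, 1:])"     unfolding P_def using degree_prod_sum_le[of "J - {j}" "\<lambda>i. [:- z i, 1:]"] assms(1) by (simp add: o_def)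
  also have "\<dots> \<le> card J" using assms(1) by (simp add: card_Diff_subset assms(4))
  finally have dP: "degree P \<le> card J" .
  have "poly P (z j) \<in> Qbar" using cP assms by (intro Qb.poly) auto
  then show ?thesis using cP dP P0 Pj
    by (intro exI[of _ "smult (inverse (poly P (z j))) P"]) (auto intro!: Qb.mult Qb.inv)
qed

text \<open>A quantitative independence of embeddings. With fewer generators than embeddings there
  are nontrivial weights \<open>l j\<close> for which the weighted sum of the
  \<open>\<sigma> j\<close> vanishes on all generators at one index \<open>k\<close>. The powers of
  \<open>y\<close> are close to rational combinations of these generators, and the embeddings fix
  rationals and carry \<open>v\<close> to \<open>qplace q\<close>, so the weighted power sums of the
  \<open>\<sigma> j y\<close> are small. Lagrange interpolation recovers a weight of largest
  absolute value from those sums, which makes it smaller than itself.\<close>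

lemma (in place) card_embeddings_le:
  assumes spans: "spans_completion n b" and KQ: "K \<subseteq> Qbar" and J: "finite J"
    and s: "\<And>j. j \<in> J \<Longrightarrow> \<sigma> j \<in> qaut" "\<And>j x. j \<in> J \<Longrightarrow> x \<in> K \<Longrightarrow> qplace q (\<sigma> j x) = v x"
    and y: "y \<in> K" and inj: "inj_on (\<lambda>j. \<sigma> j y) J"
  shows "card J \<le> n"
proof (rule ccontr)
  assume less: "\<not> card J \<le> n"
  define m where "m = card J"
  interpret w: absval Qbar "qplace q" by (rule qplace_absval[OF q])
  have hom: "chom Qbar (\<sigma> j)" if "j \<in> J" for j using qaut_chom s(1) that by blast
  have yQ: "y \<in> Qbar" and sy: "\<sigma> j y \<in> Qbar" if "j \<in> J" for j
    using y KQ qaut_Qbar[OF s(1)[OF that]] by auto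
  have "\<forall>j\<in>J. \<exists>L. (\<forall>t. coeff L t \<in> Qbar) \<and> degree L \<le> m \<and>
      (\<forall>i\<in>J. poly L (\<sigma> i y) = (if i = j then 1 else 0))"
    unfolding m_def using lagrange_basis[OF J, of "\<lambda>i. \<sigma> i y"] sy inj by blast
  then obtain L where "\<forall>j\<in>J. (\<forall>t. coeff (L j) t \<in> Qbar) \<and> degree (L j) \<le> m \<and>
      (\<forall>i\<in>J. poly (L j) (\<sigma> i y) = (if i = j then 1 else 0))" by (rule bchoice[THEN exE])
  then have L: "\<And>j t. j \<in> J \<Longrightarrow> coeff (L j) t \<in> Qbar" "\<And>j. j \<in> J \<Longrightarrow> degree (L j) \<le> m"
    "\<And>j i. j \<in> J \<Longrightarrow> i \<in> J \<Longrightarrow> poly (L j) (\<sigma> i y) = (if i = j then 1 else 0)" by blast+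
  \<comment> \<open>\<open>C\<close> bounds the coefficients of all interpolation polynomials at
    once. It has to be fixed in advance, because the weights and the largest among them depend on
    the index \<open>k\<close>, which depends on \<open>\<epsilon>\<close>.\<close>
  define C where "C = 1 + (\<Sum>j\<in>J. \<Sum>t\<le>m. qplace q (coeff (L j) t))"
  have Cpos: "C > 0" unfolding C_def using L(1) w.v_nonneg by (intro add_pos_nonneg sum_nonneg) auto
  define \<epsilon> where "\<epsilon> = 1 / (C * real m)"
  have m: "m > 0" using less by (simp add: m_def)
  have \<epsilon>: "\<epsilon> > 0" using Cpos m by (simp add: \<epsilon>_def)
  have "\<forall>t. \<exists>c. (\<forall>i<n. c i \<in> cauchy_seqs \<rat> v) \<and> (\<lambda>k. v (y ^ t - (\<Sum>i<n. c i k * b i k))) \<longlonglongrightarrow> 0"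
    using bspec[OF conjunct2[OF spans[unfolded spans_completion_def]] const_cauchy[OF pow[OF y]]]
    by (rule allI)
  then obtain c where "\<forall>t. (\<forall>i<n. c t i \<in> cauchy_seqs \<rat> v) \<and>
      (\<lambda>k. v (y ^ t - (\<Sum>i<n. c t i k * b i k))) \<longlonglongrightarrow> 0" by (rule choice[THEN exE])
  then have c: "\<And>t i. i < n \<Longrightarrow> c t i \<in> cauchy_seqs \<rat> v"
    and lim: "\<And>t. (\<lambda>k. v (y ^ t - (\<Sum>i<n. c t i k * b i k))) \<longlonglongrightarrow> 0" by blast+
  have "\<forall>\<^sub>F k in sequentially. v (y ^ t - (\<Sum>i<n. c t i k * b i k)) < \<epsilon>" for t
    using order_tendstoD(2)[OF lim \<epsilon>] .
  then have "\<forall>\<^sub>F k in sequentially. \<forall>t\<in>{..m}. v (y ^ t - (\<Sum>i<n. c t i k * b i k)) < \<epsilon>"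
    by (intro eventually_ball_finite) auto
  from eventually_happens'[OF sequentially_bot this]
  obtain k where "\<forall>t\<in>{..m}. v (y ^ t - (\<Sum>i<n. c t i k * b i k)) < \<epsilon>" ..
  then have k: "\<And>t. t \<le> m \<Longrightarrow> v (y ^ t - (\<Sum>i<n. c t i k * b i k)) < \<epsilon>" by simp
  define r where "r t = y ^ t - (\<Sum>i<n. c t i k * b i k)" for t
  have bK: "b i k \<in> K" if "i < n" for i using spans that unfolding spans_completion_def cauchy_seqs_def by blast
  have cQ: "c t i k \<in> \<rat>" if "i < n" for i t using c[OF that] unfolding cauchy_seqs_def by blast
  have rK: "r t \<in> K" for t unfolding r_def using bK cQ rats_subset y by (intro diff pow sum mult) auto
  have "card {..<n} < card J" using less by simp
  moreover have "\<sigma> j (b i k) \<in> Qbar" if "i \<in> {..<n}" "j \<in> J" for i j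
    using qaut_Qbar[OF s(1)[OF that(2)]] bK that KQ by auto
  ultimately obtain l where l: "\<forall>j\<in>J. l j \<in> Qbar" "\<exists>j\<in>J. l j \<noteq> 0"
    "\<forall>i\<in>{..<n}. (\<Sum>j\<in>J. \<sigma> j (b i k) * l j) = 0"
    using Qb.homogeneous_system[of "{..<n}" J "\<lambda>i j. \<sigma> j (b i k)"] J by auto
  have "J \<noteq> {}" using l(2) by blast
  then have "Max ((\<lambda>j. qplace q (l j)) ` J) \<in> (\<lambda>j. qplace q (l j)) ` J" using J by (intro Max_in) auto
  then obtain j0 where "j0 \<in> J" "qplace q (l j0) = Max ((\<lambda>j. qplace q (l j)) ` J)" by force
  then have j0: "j0 \<in> J" "\<And>j. j \<in> J \<Longrightarrow> qplace q (l j) \<le> qplace q (l j0)"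
    using J by simp_all
  have l0: "qplace q (l j0) > 0"
  proof -
    obtain j where j: "j \<in> J" "l j \<noteq> 0" using l(2) by blast
    then have "qplace q (l j) > 0" using l(1) w.v_pos by blast
    then show ?thesis using j0(2)[OF j(1)] by linarith
  qed
  have expand: "(\<Sum>j\<in>J. l j * \<sigma> j y ^ t) = (\<Sum>j\<in>J. l j * \<sigma> j (r t))" for t
  proof -
    have "\<sigma> j y ^ t = (\<Sum>i<n. c t i k * \<sigma> j (b i k)) + \<sigma> j (r t)" if j: "j \<in> J" for j
    proof -
      interpret h: chom Qbar "\<sigma> j" by (rule hom[OF j])
      have Qs: "b i k \<in> Qbar" "c t i k \<in> Qbar" if "i < n" for i using bK[OF that] cQ[OF that] KQ Qb.rat by auto
      have "\<sigma> j y ^ t = \<sigma> j (y ^ t)" using h.hom_power yQ[OF j] by simp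
      also have "y ^ t = (\<Sum>i<n. c t i k * b i k) + r t" by (simp add: r_def)
      also have "\<sigma> j \<dots> = \<sigma> j (\<Sum>i<n. c t i k * b i k) + \<sigma> j (r t)"
        using rK KQ Qs by (intro h.hom_add Qb.sum Qb.mult) auto
      also have "\<sigma> j (\<Sum>i<n. c t i k * b i k) = (\<Sum>i<n. \<sigma> j (c t i k * b i k))"
        using Qs by (intro h.hom_sum Qb.mult) auto
      also have "\<dots> = (\<Sum>i<n. c t i k * \<sigma> j (b i k))"
        using Qs cQ by (intro sum.cong) (auto simp: h.hom_mult h.hom_rat)
      finally show ?thesis .
    qed
    then have "(\<Sum>j\<in>J. l j * \<sigma> j y ^ t) =
        (\<Sum>j\<in>J. \<Sum>i<n. c t i k * (\<sigma> j (b i k) * l j)) + (\<Sum>j\<in>J. l j * \<sigma> j (r t))"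
      by (simp add: distrib_left sum.distrib sum_distrib_left mult_ac)
    also have "(\<Sum>j\<in>J. \<Sum>i<n. c t i k * (\<sigma> j (b i k) * l j)) = (\<Sum>i<n. c t i k * (\<Sum>j\<in>J. \<sigma> j (b i k) * l j))"
      by (subst sum.swap) (simp add: sum_distrib_left)
    also have "\<dots> = 0" using l(3) by simp
    finally show ?thesis by simp
  qed
  have bound: "qplace q (\<Sum>j\<in>J. l j * \<sigma> j y ^ t) \<le> real m * (qplace q (l j0) * \<epsilon>)" if t: "t \<le> m" for t
  proof -
    have sr: "\<sigma> j (r t) \<in> Qbar" if "j \<in> J" for j using qaut_Qbar[OF s(1)[OF that]] rK KQ by auto
    have "qplace q (\<Sum>j\<in>J. l j * \<sigma> j (r t)) \<le> (\<Sum>j\<in>J. qplace q (l j * \<sigma> j (r t)))"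
      using l(1) sr by (intro w.v_sum_le Qb.mult) auto
    also have "\<dots> \<le> (\<Sum>j\<in>J. qplace q (l j0) * \<epsilon>)"
    proof (rule sum_mono)
      fix j assume j: "j \<in> J"
      have "qplace q (l j * \<sigma> j (r t)) = qplace q (l j) * v (r t)"
        using w.v_mult l(1) sr[OF j] j s(2)[OF j rK] by simp
      also have "\<dots> \<le> qplace q (l j0) * \<epsilon>"
        using j0(2)[OF j] k[OF t] v_nonneg[OF rK] l0 by (intro mult_mono) (auto simp: r_def)
      finally show "qplace q (l j * \<sigma> j (r t)) \<le> qplace q (l j0) * \<epsilon>" .
    qed
    finally show ?thesis by (simp add: expand m_def)
  qed
  have "(\<Sum>j\<in>J. l j * poly (L j0) (\<sigma> j y)) = (\<Sum>j\<in>J. if j = j0 then l j else 0)"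
    using L(3)[OF j0(1)] by (intro sum.cong) auto
  then have "l j0 = (\<Sum>j\<in>J. l j * poly (L j0) (\<sigma> j y))" using J j0(1) by simp
  also have "\<dots> = (\<Sum>j\<in>J. l j * (\<Sum>t\<le>m. coeff (L j0) t * \<sigma> j y ^ t))"
  proof -
    have "poly (L j0) x = (\<Sum>t\<le>m. coeff (L j0) t * x ^ t)" for x
      unfolding poly_altdef using L(2)[OF j0(1)] by (intro sum.mono_neutral_left) (auto simp: coeff_eq_0)
    then show ?thesis by simp
  qed
  also have "\<dots> = (\<Sum>t\<le>m. coeff (L j0) t * (\<Sum>j\<in>J. l j * \<sigma> j y ^ t))"
    by (simp add: sum_distrib_left mult_ac) (rule sum.swap)
  finally have eq: "l j0 = (\<Sum>t\<le>m. coeff (L j0) t * (\<Sum>j\<in>J. l j * \<sigma> j y ^ t))" .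
  have inner: "(\<Sum>j\<in>J. l j * \<sigma> j y ^ t) \<in> Qbar" for t using l(1) sy by (intro Qb.sum Qb.mult Qb.pow) auto
  have "qplace q (l j0) \<le> (\<Sum>t\<le>m. qplace q (coeff (L j0) t * (\<Sum>j\<in>J. l j * \<sigma> j y ^ t)))"
    by (subst eq) (intro w.v_sum_le Qb.mult inner L(1) j0(1))
  also have "\<dots> = (\<Sum>t\<le>m. qplace q (coeff (L j0) t) * qplace q (\<Sum>j\<in>J. l j * \<sigma> j y ^ t))"
    using w.v_mult[OF L(1)[OF j0(1)] inner] by simp
  also have "\<dots> \<le> (\<Sum>t\<le>m. qplace q (coeff (L j0) t) * (real m * (qplace q (l j0) * \<epsilon>)))"
    using bound w.v_nonneg[OF L(1)[OF j0(1)]] by (intro sum_mono mult_left_mono) auto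
  also have "\<dots> = (\<Sum>t\<le>m. qplace q (coeff (L j0) t)) * (real m * (qplace q (l j0) * \<epsilon>))"
    by (simp add: sum_distrib_right)
  also have "\<dots> < C * (real m * (qplace q (l j0) * \<epsilon>))"
  proof (rule mult_strict_right_mono)
    have "(\<Sum>t\<le>m. qplace q (coeff (L j0) t)) \<le> (\<Sum>j\<in>J. \<Sum>t\<le>m. qplace q (coeff (L j) t))"
      using J j0(1) L(1) w.v_nonneg by (intro member_le_sum sum_nonneg) auto
    then show "(\<Sum>t\<le>m. qplace q (coeff (L j0) t)) < C" by (simp add: C_def)
  qed (use m l0 \<epsilon> in simp)
  also have "\<dots> = qplace q (l j0)" using Cpos m by (simp add: \<epsilon>_def)
  finally show False by simp
qed

section \<open>Conjugates and the degree\<close>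

definition conjs :: "complex \<Rightarrow> complex set" where
  "conjs y = (\<lambda>\<sigma>. \<sigma> y) ` qaut"

lemma conjs_self: "y \<in> conjs y"
  unfolding conjs_def using qaut_id by (metis id_apply image_eqI)

lemma conjs_Qbar: "y \<in> Qbar \<Longrightarrow> conjs y \<subseteq> Qbar"
  by (auto simp: conjs_def qaut_Qbar)

lemma conjs_root:
  assumes "y \<in> Qbar" "\<And>i. coeff p i \<in> \<rat>" "poly p y = 0" "z \<in> conjs y" shows "poly p z = 0"
proof -
  obtain \<sigma> where s: "\<sigma> \<in> qaut" "z = \<sigma> y" using assms(4) by (auto simp: conjs_def)
  interpret chom Qbar \<sigma> by (rule qaut_chom[OF s(1)])
  show ?thesis using hom_poly[of p y] hom_rat[OF assms(2)] Qb.rat[OF assms(2)] assms(1,3) s(2) hom_zero by simp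
qed

lemma finite_conjs:
  assumes "y \<in> Qbar" shows "finite (conjs y)"
proof -
  obtain p where "\<forall>i. coeff p i \<in> \<rat>" "p \<noteq> 0" "poly p y = 0"
    using assms unfolding Qbar_def algebraic_altdef by blast
  then show ?thesis using conjs_root[OF assms, of p] poly_roots_finite[of p]
    by (metis (mono_tags, lifting) finite_subset mem_Collect_eq subsetI)
qed

lemma card_conjs_pos: "y \<in> Qbar \<Longrightarrow> card (conjs y) > 0"
  using finite_conjs conjs_self by (auto simp: card_gt_0_iff)

lemma conjs_perm:
  assumes "y \<in> Qbar" "\<tau> \<in> qaut" shows "bij_betw \<tau> (conjs y) (conjs y)"
proof -
  have "\<tau> ` conjs y \<subseteq> conjs y"
    using qaut_comp[OF assms(2)] unfolding conjs_def by (auto intro!: image_eqI[of _ _ "\<tau> \<circ> _"])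
  moreover have "inj_on \<tau> (conjs y)" using qaut_bij[OF assms(2)] by (meson bij_is_inj inj_on_subset subset_UNIV)
  ultimately show ?thesis using finite_conjs[OF assms(1)] by (simp add: bij_betw_def endo_inj_surj)
qed

lemma fixed_imp_mem:
  assumes "is_subfield K" "K \<subseteq> Qbar" "x \<in> Qbar"
    and "\<And>\<sigma>. \<sigma> \<in> qaut \<Longrightarrow> (\<And>a. a \<in> K \<Longrightarrow> \<sigma> a = a) \<Longrightarrow> \<sigma> x = x"
  shows "x \<in> K"
  using qaut_moves[OF assms(1-3)] assms(4) by blast

lemma Rats_subset_Qbar: "\<rat> \<subseteq> Qbar"
  by (rule Qb.rats_subset)

definition conj_poly :: "complex \<Rightarrow> complex poly" where
  "conj_poly y = (\<Prod>z\<in>conjs y. [:- z, 1:])"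

lemma conj_poly_root: "y \<in> Qbar \<Longrightarrow> poly (conj_poly y) x = 0 \<longleftrightarrow> x \<in> conjs y"
  using finite_conjs by (auto simp: conj_poly_def poly_prod)

lemma coeff_conj_poly_Qbar:
  assumes "y \<in> Qbar" shows "coeff (conj_poly y) i \<in> Qbar"
proof -
  interpret chom Qbar id by (rule qaut_chom[OF qaut_id])
  show ?thesis using coeff_linear_prod[of "conjs y" "\<lambda>z. z" i] conjs_Qbar[OF assms]
    unfolding conj_poly_def by auto
qed

lemma coeff_conj_poly:
  assumes "y \<in> Qbar" shows "coeff (conj_poly y) i \<in> \<rat>"
proof (rule fixed_imp_mem[OF is_subfield_Rats Rats_subset_Qbar coeff_conj_poly_Qbar[OF assms]])
  fix \<sigma> assume s: "\<sigma> \<in> qaut"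
  interpret chom Qbar \<sigma> by (rule qaut_chom[OF s])
  have "\<sigma> (coeff (conj_poly y) i) = coeff (\<Prod>z\<in>conjs y. [:- \<sigma> z, 1:]) i"
    using coeff_linear_prod[of "conjs y" "\<lambda>z. z" i] conjs_Qbar[OF assms] unfolding conj_poly_def by auto
  also have "(\<Prod>z\<in>conjs y. [:- \<sigma> z, 1:]) = conj_poly y"
    unfolding conj_poly_def using prod.reindex_bij_betw[OF conjs_perm[OF assms s], of "\<lambda>z. [:- z, 1:]"] .
  finally show "\<sigma> (coeff (conj_poly y) i) = coeff (conj_poly y) i" .
qed

lemma degree_conj_poly: "degree (conj_poly y) = card (conjs y)" and lead_conj_poly: "lead_coeff (conj_poly y) = 1"
proof -
  show "degree (conj_poly y) = card (conjs y)"
    unfolding conj_poly_def using degree_prod_eq_sum_degree[of "conjs y" "\<lambda>z. [:- z, 1:]"] by simp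
  show "lead_coeff (conj_poly y) = 1"
    unfolding conj_poly_def by (simp add: lead_coeff_prod)
qed

lemma inverse_eq_poly:
  assumes "x \<in> Qbar" "x \<noteq> 0" shows "\<exists>r. (\<forall>i. coeff r i \<in> \<rat>) \<and> inverse x = poly r x"
proof -
  have "algebraic x" using assms(1) by (simp add: Qbar_def)
  then obtain p where p: "\<And>i. coeff p i \<in> \<rat>" "coeff p 0 \<noteq> 0" "poly p x = 0"
  proof (rule algebraicE'_nonzero[OF _ assms(2)])
    fix p assume "coeff p 0 \<noteq> 0" "poly (map_poly of_int p) x = 0"
    then show thesis using that[of "map_poly of_int p"] by (simp add: coeff_map_poly)
  qed
  obtain c r where cr: "p = pCons c r" by (cases p) auto
  have c: "c \<noteq> 0" "c \<in> \<rat>" using p(1)[of 0] p(2) by (auto simp: cr)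
  have r: "coeff r i \<in> \<rat>" for i using p(1)[of "Suc i"] by (simp add: cr)
  have "c + x * poly r x = 0" using p(3) by (simp add: cr)
  then have "inverse x = poly (smult (- inverse c) r) x" using c(1) assms(2) by (simp add: field_simps add_eq_0_iff)
  moreover have "\<forall>i. coeff (smult (- inverse c) r) i \<in> \<rat>" using r c(2) by simp
  ultimately show ?thesis by blast
qed

text \<open>The polynomial with the conjugates as roots is rational and monic, so it reduces
  \<open>y ^ d\<close> and makes the span a ring; inverses exist because each is a rational
  polynomial in the element itself.\<close>

lemma rat_adjoin_eq:
  assumes y: "y \<in> Qbar"
  shows "rat_adjoin y = qspan {..<card (conjs y)} (\<lambda>i. y ^ i)" (is "_ = ?V")
    and "is_subfield (rat_adjoin y)" and "y \<in> rat_adjoin y" and "rat_adjoin y \<subseteq> Qbar"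
proof -
  define d where "d = card (conjs y)"
  have d: "d > 0" using card_conjs_pos[OF y] by (simp add: d_def)
  let ?g = "conj_poly y"
  have yd: "y ^ d \<in> ?V"
  proof -
    have "0 = poly ?g y" using conj_poly_root[OF y] conjs_self by simp
    also have "\<dots> = (\<Sum>i\<le>d. coeff ?g i * y ^ i)" by (simp add: poly_altdef degree_conj_poly d_def)
    also have "{..d} = insert d {..<d}" by auto
    also have "(\<Sum>i\<in>insert d {..<d}. coeff ?g i * y ^ i) = y ^ d + (\<Sum>i<d. coeff ?g i * y ^ i)"
      using lead_conj_poly[of y] by (simp add: degree_conj_poly d_def)
    finally have "y ^ d = - (\<Sum>i<d. coeff ?g i * y ^ i)" by (simp add: add_eq_0_iff2)
    also have "\<dots> = (\<Sum>i<d. (- coeff ?g i) * y ^ i)" by (simp add: sum_negf)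
    also have "\<dots> \<in> ?V" using coeff_conj_poly[OF y] unfolding d_def by (intro qspanI) auto
    finally show ?thesis .
  qed
  have ybase: "y ^ i \<in> ?V" if "i \<le> d" for i
    using that yd qspan_base[of "{..<d}" i "\<lambda>i. y ^ i"] by (cases "i = d") (auto simp: d_def)
  have yV: "y * x \<in> ?V" if "x \<in> ?V" for x
    by (rule qspan_mult[OF _ that]) (use ybase in \<open>auto simp: d_def simp flip: power_Suc\<close>)
  have ypow: "y ^ k * x \<in> ?V" if "x \<in> ?V" for k x
    by (induction k) (use that yV in \<open>auto simp: mult.assoc\<close>)
  have mult: "x * z \<in> ?V" if x: "x \<in> ?V" and z: "z \<in> ?V" for x z
    by (rule qspan_mult[OF _ z]) (use ypow[OF x] in \<open>simp add: mult.commute\<close>)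
  have one: "1 \<in> ?V" using ybase[of 0] by simp
  have ratV: "q \<in> ?V" if "q \<in> \<rat>" for q using qspan_scale[OF that one] by simp
  have polyV: "poly r x \<in> ?V" if "\<And>i. coeff r i \<in> \<rat>" "x \<in> ?V" for r x
  proof -
    have "x ^ k \<in> ?V" for k by (induction k) (auto intro: one mult that)
    then show ?thesis unfolding poly_altdef using that by (intro qspan_sum qspan_scale)
  qed
  have VQ: "?V \<subseteq> Qbar"
    unfolding qspan_def using y Qb.rat by (auto intro!: Qb.sum Qb.mult Qb.pow)
  have sub: "is_subfield ?V"
    unfolding is_subfield_def
  proof (intro conjI ballI)
    show "- x \<in> ?V" if "x \<in> ?V" for x using qspan_scale[OF _ that, of "-1"] by simp
    show "inverse x \<in> ?V" if "x \<in> ?V" for x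
    proof (cases "x = 0")
      case False
      then show ?thesis using inverse_eq_poly[of x] polyV that VQ by (metis subsetD)
    qed (simp add: qspan_0)
  qed (auto intro: one mult qspan_add qspan_0)
  have yV1: "y \<in> ?V" using ybase[of 1] d by simp
  have "?V \<subseteq> F" if F: "is_subfield F" "y \<in> F" for F
  proof -
    interpret cfield F by (rule cfieldI[OF F(1)])
    show ?thesis unfolding qspan_def using F(2) rat by (auto intro!: sum mult pow)
  qed
  then show eq: "rat_adjoin y = ?V" unfolding rat_adjoin_def using sub yV1 by blast
  show "is_subfield (rat_adjoin y)" "y \<in> rat_adjoin y" "rat_adjoin y \<subseteq> Qbar"
    using sub yV1 VQ by (simp_all add: eq)
qed

lemma rat_poly_degree_ge:
  assumes "y \<in> Qbar" "\<And>i. coeff p i \<in> \<rat>" "poly p y = 0" "p \<noteq> 0"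
  shows "card (conjs y) \<le> degree p"
proof -
  have "conjs y \<subseteq> {z. poly p z = 0}" using conjs_root[OF assms(1-3)] by auto
  then have "card (conjs y) \<le> card {z. poly p z = 0}"
    using poly_roots_finite[OF assms(4)] by (intro card_mono)
  also have "\<dots> \<le> degree p" using assms(4) by (rule card_poly_roots_bound)
  finally show ?thesis .
qed

lemma field_degree_rat_adjoin:
  assumes y: "y \<in> Qbar" shows "field_degree (rat_adjoin y) = card (conjs y)"
proof -
  define d where "d = card (conjs y)"
  interpret V: vector_space "\<lambda>(q::rat) (x::complex). of_rat q * x"
    by unfold_locales (auto simp: algebra_simps of_rat_add of_rat_mult)
  have zero: "a i = 0" if a: "(\<Sum>j<d. a j * y ^ j) = 0" "\<And>j. a j \<in> \<rat>" and i: "i < d" for a i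
  proof -
    define p where "p = (\<Sum>j<d. monom (a j) j)"
    have cp: "coeff p k = (if k < d then a k else 0)" for k
      by (simp add: p_def coeff_sum)
    have "poly p y = 0" using a(1) by (simp add: p_def poly_sum poly_monom)
    moreover have "coeff p k \<in> \<rat>" for k using a(2) by (simp add: cp)
    moreover have "degree p < d" if "p \<noteq> 0"
      using cp[of "degree p"] that by (metis leading_coeff_0_iff)
    ultimately have "p = 0" using rat_poly_degree_ge[OF y, of p] unfolding d_def by fastforce
    then show ?thesis using cp[of i] i by simp
  qed
  define B where "B = (\<lambda>i. y ^ i) ` {..<d}"
  have inj: "inj_on (\<lambda>i. y ^ i) {..<d}"
  proof (rule inj_onI, rule ccontr)
    fix i j assume ij: "i \<in> {..<d}" "j \<in> {..<d}" "y ^ i = y ^ j" "i \<noteq> j"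
    define a :: "nat \<Rightarrow> complex" where "a k = (if k = i then 1 else if k = j then -1 else 0)" for k
    have "(\<Sum>k<d. a k * y ^ k) = (\<Sum>k\<in>{i, j}. a k * y ^ k)"
      using ij by (intro sum.mono_neutral_right) (auto simp: a_def)
    also have "\<dots> = 0" using ij by (simp add: a_def)
    finally have "(\<Sum>k<d. a k * y ^ k) = 0" .
    then have "a i = 0" by (rule zero) (use ij in \<open>auto simp: a_def\<close>)
    then show False by (simp add: a_def)
  qed
  have fB: "finite B" "card B = d" using inj by (simp_all add: B_def card_image)
  have sumB: "(\<Sum>b\<in>B. of_rat (u b) * b) = (\<Sum>i<d. of_rat (u (y ^ i)) * y ^ i)" for u
    unfolding B_def using sum.reindex[OF inj, of "\<lambda>b. of_rat (u b) * b"] by (simp add: o_def)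
  have "V.independent B"
    unfolding V.dependent_finite[OF fB(1)]
  proof clarify
    fix u b assume b: "b \<in> B" "u b \<noteq> 0" and 0: "(\<Sum>b\<in>B. of_rat (u b) * b) = 0"
    obtain i where i: "i < d" "b = y ^ i" using b(1) by (auto simp: B_def)
    have "of_rat (u (y ^ i)) = (0::complex)" by (rule zero[OF _ _ i(1)]) (use 0 sumB in auto)
    then show False using b(2) i(2) by simp
  qed
  moreover have span: "V.span B = rat_adjoin y"
  proof
    show "V.span B \<subseteq> rat_adjoin y"
      unfolding V.span_finite[OF fB(1)] rat_adjoin_eq(1)[OF y] sumB d_def by (auto intro!: qspanI)
    show "rat_adjoin y \<subseteq> V.span B"
    proof
      fix x assume "x \<in> rat_adjoin y"
      then obtain c where c: "x = (\<Sum>i<d. c i * y ^ i)" "\<forall>i<d. c i \<in> \<rat>"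
        unfolding rat_adjoin_eq(1)[OF y] qspan_def d_def by auto
      have "c i * y ^ i \<in> V.span B" if "i < d" for i
      proof -
        have "c i \<in> \<rat>" using c(2) that by blast
        then obtain r where r: "c i = of_rat r" by (rule Rats_cases)
        have "y ^ i \<in> V.span B" using that by (intro V.span_base) (simp add: B_def)
        then show ?thesis unfolding r by (rule V.span_scale)
      qed
      then show "x \<in> V.span B" unfolding c(1) by (intro V.span_sum) auto
    qed
  qed
  ultimately have "V.dim (rat_adjoin y) = card B"
    using V.dim_span[of B] V.dim_eq_card_independent[of B] by metis
  then show ?thesis by (simp add: field_degree_def fB(2) d_def)
qed

section \<open>Finiteness of the places over a rational place\<close>

context absval
begin

lemma v_powi: "x \<in> K \<Longrightarrow> v (x powi k) = v x powi k"
  by (simp add: power_int_def v_power v_inverse inv)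

lemma powi: "x \<in> K \<Longrightarrow> x powi k \<in> K"
  by (simp add: power_int_def pow inv)

text \<open>Together with \<open>tendsto_zero\<close>, this turns an element large at one place and
  small at others into approximate idempotents, as in the proof of weak approximation.\<close>

lemma tendsto_one:
  assumes x: "x \<in> K" "v x > 1"
  shows "(\<lambda>r. v (x ^ r / (1 + x ^ r) - 1)) \<longlonglongrightarrow> 0"
proof -
  have "filterlim (\<lambda>r. v x ^ r) at_infinity sequentially"
    using filterlim_realpow_sequentially_gt1[of "v x"] x(2) by simp
  then have "filterlim (\<lambda>r. v x ^ r) at_top sequentially"
    by (rule filterlim_at_infinity_imp_filterlim_at_top) (use x(2) in simp)
  from filterlim_tendsto_add_at_top[OF tendsto_const[of "-1"] this]
  have inf: "filterlim (\<lambda>r. v x ^ r - 1) at_top sequentially" by simp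
  have bd: "v x ^ r - 1 \<le> v (1 + x ^ r)" for r
    using v_diff_le[of "1 + x ^ r" 1] add[OF one pow[OF x(1)]] v_one v_power[OF x(1)] one by simp
  have lim: "(\<lambda>r. inverse (v x ^ r - 1)) \<longlonglongrightarrow> 0"
    using inf by (rule tendsto_inverse_0_at_top)
  have upper: "\<forall>\<^sub>F r in sequentially. v (x ^ r / (1 + x ^ r) - 1) \<le> inverse (v x ^ r - 1)"
    using filterlim_at_top_dense[THEN iffD1, OF inf, rule_format, of 0]
  proof eventually_elim
    case (elim r)
    have nz: "1 + x ^ r \<noteq> 0" using bd[of r] elim v_zero by auto
    then have "x ^ r / (1 + x ^ r) - 1 = - inverse (1 + x ^ r)" by (simp add: field_simps)
    then have "v (x ^ r / (1 + x ^ r) - 1) = inverse (v (1 + x ^ r))"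
      using v_uminus v_inverse inv add[OF one pow[OF x(1)]] by simp
    then show ?case using bd[of r] elim by (simp add: le_imp_inverse_le)
  qed
  have "x ^ r / (1 + x ^ r) - 1 \<in> K" for r using x by (intro diff div add pow one)
  then have lower: "\<forall>\<^sub>F r in sequentially. 0 \<le> v (x ^ r / (1 + x ^ r) - 1)" using v_nonneg by simp
  show ?thesis by (rule tendsto_sandwich[OF lower upper tendsto_const lim])
qed

lemma tendsto_zero:
  assumes x: "x \<in> K" "v x < 1"
  shows "(\<lambda>r. v (x ^ r / (1 + x ^ r))) \<longlonglongrightarrow> 0"
proof -
  have pw: "(\<lambda>r. v x ^ r) \<longlonglongrightarrow> 0" using x v_nonneg by (intro LIMSEQ_power_zero) auto
  have bd: "1 - v x ^ r \<le> v (1 + x ^ r)" for r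
    using v_diff_le[of "1 + x ^ r" "x ^ r"] add[OF one pow[OF x(1)]] v_one v_power[OF x(1)] pow[OF x(1)] by simp
  have "(\<lambda>r. v x ^ r / (1 - v x ^ r)) \<longlonglongrightarrow> 0 / (1 - 0)"     by (intro tendsto_divide[OF pw tendsto_diff[OF tendsto_const pw]]) simp
  then have lim: "(\<lambda>r. v x ^ r / (1 - v x ^ r)) \<longlonglongrightarrow> 0" by simp
  have upper: "\<forall>\<^sub>F r in sequentially. v (x ^ r / (1 + x ^ r)) \<le> v x ^ r / (1 - v x ^ r)"
    using order_tendstoD(2)[OF pw zero_less_one]
  proof eventually_elim
    case (elim r)
    have "v (x ^ r / (1 + x ^ r)) = v x ^ r / v (1 + x ^ r)"
      using x by (simp add: v_divide v_power add one pow)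
    moreover have "v x ^ r / v (1 + x ^ r) \<le> v x ^ r / (1 - v x ^ r)"
      using bd[of r] elim v_nonneg[OF x(1)] by (intro frac_le) auto
    ultimately show ?case by simp
  qed
  have "x ^ r / (1 + x ^ r) \<in> K" for r using x by (intro div add pow one)
  then have lower: "\<forall>\<^sub>F r in sequentially. 0 \<le> v (x ^ r / (1 + x ^ r))" using v_nonneg by simp
  show ?thesis by (rule tendsto_sandwich[OF lower upper tendsto_const lim])
qed

end

section \<open>Separating the places over a rational place\<close>

locale rational_place = cfield K for K +
  fixes q :: nat
  assumes q: "q \<in> pindex"
begin

lemma placeI: "v \<in> places_over q K \<Longrightarrow> place K v q"
  using subfield q by unfold_locales (auto simp: places_over_def)

text \<open>Since \<open>t\<close> has the same value \<open>T\<close> at both places, it suffices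
  to raise \<open>x\<close> to a power so high that the two values differ by more than the factor
  \<open>T\<close>, and then to divide by a power of \<open>t\<close> that falls between
  them.\<close>

lemma separate_lt:
  assumes v: "v \<in> places_over q K" "u \<in> places_over q K" and x: "x \<in> K" "v x < u x"
  shows "\<exists>z\<in>K. v z < 1 \<and> 1 < u z \<and> z \<noteq> 0"
proof -
  interpret v: place K v q by (rule placeI[OF v(1)])
  interpret u: place K u q by (rule placeI[OF v(2)])
  obtain t where t: "t \<in> \<rat>" "qplace q t > 1" using qplace_gt_1[OF q] .
  define T where "T = qplace q t"
  have vt: "v t = T" "u t = T" using t v.v_rat u.v_rat by (auto simp: T_def)
  have tK: "t \<in> K" using rat t(1) .
  have t0: "t \<noteq> 0" using vt t v.v_zero by (auto simp: T_def)
  have x0: "x \<noteq> 0" using x(2) v.v_zero u.v_zero by auto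
  have pos: "v x > 0" "u x > 0" using x0 x(1) v.v_pos u.v_pos by auto
  have lT: "ln T > 0" using t(2) by (simp add: T_def)
  have "ln (u x) - ln (v x) > 0" using x(2) pos by simp
  then obtain n where n: "ln T < real n * (ln (u x) - ln (v x))" using ex_less_of_nat_mult by blast
  \<comment> \<open>The floor plus one puts \<open>k * ln T\<close> strictly above
    \<open>n * ln (v x)\<close> and by at most \<open>ln T\<close>; the choice of \<open>n\<close>
    leaves more room than that below \<open>n * ln (u x)\<close>.\<close>
  define k where "k = \<lfloor>real n * ln (v x) / ln T\<rfloor> + 1"
  have "real n * ln (v x) / ln T < real_of_int k" "real_of_int k \<le> real n * ln (v x) / ln T + 1"
    unfolding k_def by linarith+
  then have k: "real n * ln (v x) < real_of_int k * ln T" "real_of_int k * ln T \<le> real n * ln (v x) + ln T"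
    using lT by (simp_all add: field_simps)
  define z where "z = x ^ n * t powi (- k)"
  have zK: "z \<in> K" unfolding z_def using x tK by (intro mult pow v.powi)
  have z0: "z \<noteq> 0" using x0 t0 by (simp add: z_def)
  have T0: "T > 0" using t(2) by (simp add: T_def)
  have "v z = v x ^ n * T powi (- k)" "u z = u x ^ n * T powi (- k)"
    using x tK vt by (simp_all add: z_def v.v_mult u.v_mult v.powi pow v.v_power u.v_power v.v_powi u.v_powi)
  moreover have "T powi (- k) > 0" using T0 by simp
  moreover have "ln (T powi (- k)) = - (real_of_int k * ln T)"
    using powr_real_of_int'[of T "- k"] ln_powr[of T "real_of_int (- k)"] T0 by simp
  ultimately have "ln (v z) = real n * ln (v x) - real_of_int k * ln T"
    "ln (u z) = real n * ln (u x) - real_of_int k * ln T"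
    using pos by (simp_all add: ln_mult_pos ln_realpow)
  then have "ln (v z) < 0" "ln (u z) > 0" using k n by (simp_all add: algebra_simps)
  moreover have "v z > 0" "u z > 0" using v.v_pos u.v_pos zK z0 by auto
  ultimately show ?thesis using zK z0 by (intro bexI[of _ z]) auto
qed

lemma separate:
  assumes v: "v \<in> places_over q K" "u \<in> places_over q K" "v \<noteq> u"
  shows "\<exists>z\<in>K. v z > 1 \<and> u z < 1"
proof -
  interpret v: place K v q by (rule placeI[OF v(1)])
  interpret u: place K u q by (rule placeI[OF v(2)])
  \<comment> \<open>Both functions are extensional, so distinct places already differ at a point of
    \<open>K\<close>.\<close>
  have "\<exists>x\<in>K. v x \<noteq> u x"
    using v.av u.av v(3) unfolding absolute_value_def by (metis extensionalityI)
  then obtain x where x: "x \<in> K" "v x \<noteq> u x" by blast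
  show ?thesis
  proof (cases "v x < u x")
    case True
    then obtain z where z: "z \<in> K" "v z < 1" "1 < u z" "z \<noteq> 0" using separate_lt[OF v(1,2) x(1)] by blast
    have "v (inverse z) > 1" "u (inverse z) < 1"
      using z v.v_inverse u.v_inverse v.v_pos by (simp_all add: one_less_inverse inverse_less_1_iff)
    then show ?thesis using inv[OF z(1)] by blast
  next
    case False
    then show ?thesis using separate_lt[OF v(2,1) x(1)] x(2) by force
  qed
qed

text \<open>Let \<open>x\<close> separate \<open>v\<close> from \<open>F\<close> and let
  \<open>z\<close> separate \<open>v\<close> from the new place \<open>u\<close>. According as
  \<open>u x\<close> is below, equal to or above 1, the separating element is \<open>x\<close>, a
  multiple \<open>x ^ r * z\<close>, or \<open>z\<close> times the approximate idempotent of
  \<open>x\<close>, with \<open>r\<close> large.\<close>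

lemma separate_finite:
  assumes "finite F" "F \<subseteq> places_over q K" "v \<in> places_over q K" "v \<notin> F"
  shows "\<exists>x\<in>K. v x > 1 \<and> (\<forall>u\<in>F. u x < 1)"
  using assms
proof (induction F rule: finite_induct)
  case empty
  interpret v: place K v q by (rule placeI[OF assms(3)])
  obtain t where "t \<in> \<rat>" "qplace q t > 1" using qplace_gt_1[OF q] .
  then show ?case using v.v_rat rat by force
next
  case (insert u F)
  interpret v: place K v q by (rule placeI[OF assms(3)])
  interpret u: place K u q using placeI insert.prems by simp
  have av: "absval K w" if "w \<in> F" for w using that placeI insert.prems by (auto simp: place_def)
  obtain x where x: "x \<in> K" "v x > 1" "\<forall>w\<in>F. w x < 1" using insert by auto
  obtain z where z: "z \<in> K" "v z > 1" "u z < 1" using separate[of v u] insert.prems by auto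
  consider "u x < 1" | "u x = 1" | "u x > 1" by linarith
  then show ?case
  proof cases
    case 1
    then show ?thesis using x by auto
  next
    case 2
    have "\<forall>\<^sub>F r in sequentially. \<forall>w\<in>F. w (x ^ r * z) < 1"
    proof (intro eventually_ball_finite[OF insert.hyps(1)] ballI)
      fix w assume w: "w \<in> F"
      interpret w: absval K w by (rule av[OF w])
      have "(\<lambda>r. w x ^ r * w z) \<longlonglongrightarrow> 0 * w z"
        using x w w.v_nonneg by (intro tendsto_mult LIMSEQ_power_zero tendsto_const) auto
      then have "\<forall>\<^sub>F r in sequentially. w x ^ r * w z < 1" using order_tendstoD(2) by fastforce
      then show "\<forall>\<^sub>F r in sequentially. w (x ^ r * z) < 1"
        using x z by (simp add: w.v_mult pow w.v_power)
    qed
    from eventually_happens'[OF sequentially_bot this]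
    obtain r where r: "\<forall>w\<in>F. w (x ^ r * z) < 1" ..
    have "v (x ^ r * z) = v x ^ r * v z" "u (x ^ r * z) = u z"
      using x z 2 by (simp_all add: v.v_mult u.v_mult pow v.v_power u.v_power)
    moreover have "v x ^ r * v z > 1" using x(2) z(2) by (metis less_1_mult less_imp_le mult.commute mult_1 one_le_power order_le_less)
    ultimately show ?thesis using r z x by (intro bexI[of _ "x ^ r * z"]) (auto intro: mult pow)
  next
    case 3
    define c where "c r = x ^ r / (1 + x ^ r)" for r
    have cK: "c r \<in> K" for r unfolding c_def using x by (intro div add pow one)
    have lim1: "(\<lambda>r. w (c r * z)) \<longlonglongrightarrow> w z" if "absval K w" "w x > 1" for w
    proof -
      interpret w: absval K w by (rule that(1))
      have le: "\<bar>w (c r * z) - w z\<bar> \<le> w (c r - 1) * w z" for r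
      proof -
        have cz: "c r * z \<in> K" "c r - 1 \<in> K" "(c r - 1) * z \<in> K" using cK z one by (auto intro: mult diff)
        have "w (c r * z) \<le> w ((c r - 1) * z) + w z" using w.v_add_le[OF cz(3) z(1)] by (simp add: algebra_simps)
        moreover have "w z \<le> w (c r * z) + w ((c r - 1) * z)"
          using w.v_diff_le[OF cz(1,3)] by (simp add: algebra_simps)
        ultimately show ?thesis using w.v_mult[OF cz(2) z(1)] by (simp add: abs_le_iff)
      qed
      then have ev: "\<forall>\<^sub>F r in sequentially. norm (w (c r * z) - w z) \<le> w (c r - 1) * w z"
        by (simp only: real_norm_def eventually_True simp_thms)
      have "(\<lambda>r. w (c r - 1) * w z) \<longlonglongrightarrow> 0 * w z"
        using w.tendsto_one[OF x(1) that(2)] unfolding c_def by (rule tendsto_mult[OF _ tendsto_const])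
      then have "(\<lambda>r. w (c r - 1) * w z) \<longlonglongrightarrow> 0" by (simp only: mult_zero_left)
      with ev have "(\<lambda>r. w (c r * z) - w z) \<longlonglongrightarrow> 0" by (rule Lim_null_comparison)
      then show ?thesis by (simp add: LIM_zero_iff)
    qed
    have "\<forall>\<^sub>F r in sequentially. v (c r * z) > 1"
      using order_tendstoD(1)[OF lim1[OF v.absval_axioms x(2)] z(2)] .
    moreover have "\<forall>\<^sub>F r in sequentially. u (c r * z) < 1"
      using order_tendstoD(2)[OF lim1[OF u.absval_axioms 3] z(3)] .
    moreover have "\<forall>\<^sub>F r in sequentially. \<forall>w\<in>F. w (c r * z) < 1"
    proof (intro eventually_ball_finite[OF insert.hyps(1)] ballI)
      fix w assume w: "w \<in> F"
      interpret w: absval K w by (rule av[OF w])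
      have "(\<lambda>r. w (c r) * w z) \<longlonglongrightarrow> 0 * w z"
        using w.tendsto_zero[OF x(1)] x(3) w unfolding c_def by (intro tendsto_mult tendsto_const) auto
      then have "\<forall>\<^sub>F r in sequentially. w (c r) * w z < 1" using order_tendstoD(2) by fastforce
      then show "\<forall>\<^sub>F r in sequentially. w (c r * z) < 1"
        using cK z by (simp add: w.v_mult)
    qed
    ultimately have "\<forall>\<^sub>F r in sequentially. v (c r * z) > 1 \<and> u (c r * z) < 1 \<and> (\<forall>w\<in>F. w (c r * z) < 1)"
      by eventually_elim blast
    from eventually_happens'[OF sequentially_bot this]
    obtain r where "v (c r * z) > 1 \<and> u (c r * z) < 1 \<and> (\<forall>w\<in>F. w (c r * z) < 1)" ..
    then show ?thesis using cK z by (intro bexI[of _ "c r * z"]) (auto intro: mult)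
  qed
qed

text \<open>Approximate idempotents belonging to distinct places are linearly independent over \<open>\<rat>\<close>.\<close>

lemma card_places_le:
  assumes I: "finite I" and K: "K = qspan I e" and F: "finite F" "F \<subseteq> places_over q K"
  shows "card F \<le> card I"
proof (rule ccontr)
  assume less: "\<not> card F \<le> card I"
  \<comment> \<open>Below, \<open>card F\<close> errors, each at most \<open>\<epsilon>\<close>
    times the largest coefficient, add up to half of that coefficient.\<close>
  define \<epsilon> where "\<epsilon> = 1 / (2 * real (card F))"
  have cF: "card F > 0" using less by simp
  have \<epsilon>: "\<epsilon> > 0" using cF by (simp add: \<epsilon>_def)
  have pl: "place K w q" if "w \<in> F" for w using placeI that F by blast
  have "\<exists>c\<in>K. w (c - 1) < \<epsilon> \<and> (\<forall>u\<in>F - {w}. u c < \<epsilon>)" if w: "w \<in> F" for w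
  proof -
    interpret w: place K w q by (rule pl[OF w])
    obtain x where x: "x \<in> K" "w x > 1" "\<forall>u\<in>F - {w}. u x < 1"
      using separate_finite[of "F - {w}" w] F w by blast
    define c where "c r = x ^ r / (1 + x ^ r)" for r
    have "\<forall>\<^sub>F r in sequentially. w (c r - 1) < \<epsilon>"
      using order_tendstoD(2)[OF w.tendsto_one[OF x(1,2)] \<epsilon>] by (simp add: c_def)
    moreover have "\<forall>\<^sub>F r in sequentially. \<forall>u\<in>F - {w}. u (c r) < \<epsilon>"
    proof (intro eventually_ball_finite ballI)
      fix u assume u: "u \<in> F - {w}"
      interpret u: place K u q using pl u by blast
      show "\<forall>\<^sub>F r in sequentially. u (c r) < \<epsilon>"
        using order_tendstoD(2)[OF u.tendsto_zero[OF x(1)] \<epsilon>] x(3) u by (simp add: c_def)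
    qed (use F in auto)
    ultimately have "\<forall>\<^sub>F r in sequentially. w (c r - 1) < \<epsilon> \<and> (\<forall>u\<in>F - {w}. u (c r) < \<epsilon>)"
      by eventually_elim blast
    from eventually_happens'[OF sequentially_bot this]
    obtain r where "w (c r - 1) < \<epsilon> \<and> (\<forall>u\<in>F - {w}. u (c r) < \<epsilon>)" ..
    moreover have "c r \<in> K" unfolding c_def using x by (intro div add pow one)
    ultimately show ?thesis by blast
  qed
  then have "\<forall>w\<in>F. \<exists>c. c \<in> K \<and> w (c - 1) < \<epsilon> \<and> (\<forall>u\<in>F - {w}. u c < \<epsilon>)" by blast
  then obtain c where c: "\<forall>w\<in>F. c w \<in> K \<and> w (c w - 1) < \<epsilon> \<and> (\<forall>u\<in>F - {w}. u (c w) < \<epsilon>)"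
    by (rule bchoice[THEN exE])
  have "\<forall>w\<in>F. \<exists>a. c w = (\<Sum>i\<in>I. a i * e i) \<and> (\<forall>i\<in>I. a i \<in> \<rat>)"
    using c K unfolding qspan_def by blast
  then obtain a where a: "\<forall>w\<in>F. c w = (\<Sum>i\<in>I. a w i * e i) \<and> (\<forall>i\<in>I. a w i \<in> \<rat>)"
    by (rule bchoice[THEN exE])
  obtain l where l: "\<forall>w\<in>F. l w \<in> \<rat>" "\<exists>w\<in>F. l w \<noteq> 0" "\<forall>i\<in>I. (\<Sum>w\<in>F. a w i * l w) = 0"
    using Q.homogeneous_system[OF I F(1), of "\<lambda>i w. a w i"] a less by auto
  have "(\<Sum>w\<in>F. l w * c w) = (\<Sum>w\<in>F. \<Sum>i\<in>I. a w i * l w * e i)"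
    using a by (intro sum.cong) (auto simp: sum_distrib_left mult_ac)
  also have "\<dots> = (\<Sum>i\<in>I. (\<Sum>w\<in>F. a w i * l w) * e i)"
    by (subst sum.swap) (simp add: sum_distrib_right)
  also have "\<dots> = 0" using l(3) by (intro sum.neutral) auto
  finally have 0: "(\<Sum>w\<in>F. l w * c w) = 0" .
  interpret b: absval Qbar "qplace q" by (rule qplace_absval[OF q])
  have "F \<noteq> {}" using l(2) by blast
  then have "Max ((\<lambda>w. qplace q (l w)) ` F) \<in> (\<lambda>w. qplace q (l w)) ` F" using F by (intro Max_in) auto
  then obtain w where "w \<in> F" "qplace q (l w) = Max ((\<lambda>w. qplace q (l w)) ` F)" by force
  then have w: "w \<in> F" "\<And>u. u \<in> F \<Longrightarrow> qplace q (l u) \<le> qplace q (l w)"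
    using F by simp_all
  have l0: "qplace q (l w) > 0"
  proof -
    obtain u where u: "u \<in> F" "l u \<noteq> 0" using l(2) by blast
    then have "qplace q (l u) > 0" using l(1) b.v_pos Qb.rat by blast
    then show ?thesis using w(2)[OF u(1)] by linarith
  qed
  interpret w: place K w q by (rule pl[OF w(1)])
  \<comment> \<open>Subtracting 1 at \<open>w\<close> makes every \<open>d u\<close> small at
    \<open>w\<close>, and the vanishing relation then expresses \<open>- l w\<close> through the
    \<open>d u\<close>.\<close>
  define d where "d u = (if u = w then c w - 1 else c u)" for u
  have lK: "l u \<in> K" "c u \<in> K" if "u \<in> F" for u using that l(1) c rat by auto
  have dK: "d u \<in> K" "w (d u) < \<epsilon>" if "u \<in> F" for u
    using that c w(1) by (auto simp: d_def intro: diff one)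
  have "(\<Sum>u\<in>F. l u * d u) = (\<Sum>u\<in>F. l u * c u - (if u = w then l w else 0))"
    by (intro sum.cong) (auto simp: d_def algebra_simps)
  also have "\<dots> = - l w" using 0 F(1) w(1) by (simp add: sum_subtractf)
  finally have "w (l w) = w (\<Sum>u\<in>F. l u * d u)" using w.v_uminus[OF lK(1)[OF w(1)]] by simp
  also have "\<dots> \<le> (\<Sum>u\<in>F. w (l u * d u))" using lK dK by (intro w.v_sum_le mult)
  also have "\<dots> \<le> (\<Sum>u\<in>F. qplace q (l w) * \<epsilon>)"
  proof (rule sum_mono)
    fix u assume u: "u \<in> F"
    have "w (l u * d u) = qplace q (l u) * w (d u)" using u lK dK l(1) by (simp add: w.v_mult w.v_rat)
    also have "\<dots> \<le> qplace q (l w) * \<epsilon>"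
      using w(2)[OF u] dK[OF u] l0 w.v_nonneg by (intro mult_mono) (auto intro: less_imp_le)
    finally show "w (l u * d u) \<le> qplace q (l w) * \<epsilon>" .
  qed
  also have "\<dots> = qplace q (l w) / 2" using cF by (simp add: \<epsilon>_def)
  finally show False using w.v_rat l(1) w(1) l0 by simp
qed

lemma finite_places_over:
  assumes "finite I" "K = qspan I e" shows "finite (places_over q K)"
  using finite_if_finite_subsets_card_bdd[of "places_over q K" "card I"] card_places_le[OF assms] by blast

end

section \<open>A lower bound for the Weil height\<close>

lemma qplace_prime_int_cases:
  assumes "prime p"
  shows "qplace p (of_int a) \<le> 1" and "\<not> int p dvd a \<Longrightarrow> qplace p (of_int a) = 1"
    and "qplace p (of_int (int p)) < 1"
proof -
  interpret absval Qbar "qplace p" by (rule qplace_absval) (simp add: pindex_def assms)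
  have p1: "real p > 1" using prime_gt_1_nat[OF assms] by simp
  show "qplace p (of_int a) \<le> 1"
  proof (cases "a = 0")
    case False
    have "1 \<le> real p ^ multiplicity (int p) a" using p1 by simp
    then have "1 / real p ^ multiplicity (int p) a \<le> 1"
      using p1 by (intro divide_le_eq_1_pos[THEN iffD2]) auto
    then show ?thesis using qplace_prime_int[OF assms False] by simp
  qed (simp add: v_zero)
  show "qplace p (of_int a) = 1" if "\<not> int p dvd a"
    using qplace_prime_int[OF assms, of a] that by (cases "a = 0") (simp_all add: not_dvd_imp_multiplicity_0)
  have "multiplicity (int p) (int p) = 1"
    using assms by (intro multiplicity_self) (auto dest: prime_gt_1_nat)
  then show "qplace p (of_int (int p)) < 1" using qplace_prime_int[OF assms, of "int p"] p1 by auto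
qed

lemma places_over_disjoint:
  assumes "q \<in> pindex" "q' \<in> pindex" "q \<noteq> q'"
  shows "places_over q K \<inter> places_over q' K = {}"
proof -
  have ge: "qplace q (of_int (int p)) \<ge> 1" if "prime p" "q \<in> pindex" "q \<noteq> p" for p q
    using that(2)
  proof (cases rule: pindex_cases)
    case 1
    then show ?thesis using qplace_0[OF Qb.int, of "int p"] prime_gt_0_nat[OF that(1)] by simp
  next
    case 2
    then have "\<not> int q dvd int p" using that primes_dvd_imp_eq[OF 2 that(1)] by auto
    then show ?thesis using qplace_prime_int_cases(2)[OF 2, of "int p"] by simp
  qed
  have ne: "\<exists>a::int. qplace q (of_int a) \<noteq> qplace q' (of_int a)"
  proof (cases "q = 0")
    case True
    then have "prime q'" using assms by (auto simp: pindex_def)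
    then show ?thesis using ge[OF _ assms(1,3)] qplace_prime_int_cases(3) by (metis not_le)
  next
    case False
    then have "prime q" using assms by (auto simp: pindex_def)
    then show ?thesis using ge[OF _ assms(2)] assms(3) qplace_prime_int_cases(3) by (metis not_le)
  qed
  then show ?thesis unfolding places_over_def by auto
qed

text \<open>The number \<open>a * y\<close> is integral over the integers, so all its powers are
  integer combinations of finitely many of them. Boundedness of the powers gives
  \<open>v (a * y) \<le> 1\<close> from the plain triangle inequality, the only one that
  \<open>absolute_value\<close> supplies; and \<open>v\<close> of \<open>a\<close> is 1 if
  \<open>q\<close> does not divide \<open>a\<close>.\<close>

lemma (in place) prime_dvd_lead_coeff:
  assumes p: "prime q" and f: "\<And>i. coeff f i \<in> \<int>" "f \<noteq> 0" "poly f y = 0" "lead_coeff f = of_int a"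
    and y: "y \<in> K" "v y > 1"
  shows "int q dvd a"
proof (rule ccontr)
  assume nd: "\<not> int q dvd a"
  have vint: "v c \<le> 1" if "c \<in> \<int>" for c
    using that v_rat[of c] qplace_prime_int_cases(1)[OF p] by (auto elim!: Ints_cases)
  have cK: "c \<in> K" if "c \<in> \<int>" for c using that int by (auto elim!: Ints_cases)
  define n where "n = degree f"
  have "n > 0"
  proof (rule ccontr)
    assume "\<not> n > 0"
    then obtain c where "f = [:c:]" unfolding n_def by (metis degree_eq_zeroE neq0_conv)
    then show False using f by auto
  qed
  then obtain m where m: "n = Suc m" by (cases n) auto
  define x where "x = of_int a * y"
  have xK: "x \<in> K" unfolding x_def by (intro mult int y)
  \<comment> \<open>Multiplying \<open>f\<close> at \<open>y\<close> by \<open>a ^ (n - 1)\<close>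
    yields a monic equation for \<open>x = a * y\<close>; the \<open>C i\<close> are its lower
    coefficients, moved to the other side.\<close>
  define C where "C i = - coeff f i * of_int a ^ (m - i)" for i
  have CZ: "C i \<in> \<int>" for i unfolding C_def using f(1) by auto
  have trm: "coeff f i * of_int a ^ m * y ^ i = - C i * x ^ i" if "i < n" for i
  proof -
    have "m = (m - i) + i" using that m by simp
    then have "complex_of_int a ^ m = of_int a ^ (m - i) * of_int a ^ i" by (metis power_add)
    then show ?thesis by (simp add: C_def x_def power_mult_distrib)
  qed
  have "0 = of_int a ^ m * poly f y" using f(3) by simp
  also have "\<dots> = (\<Sum>i\<le>n. coeff f i * of_int a ^ m * y ^ i)"
    unfolding poly_altdef n_def sum_distrib_left by (simp add: mult_ac)
  also have "{..n} = insert n {..<n}" by auto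
  also have "(\<Sum>i\<in>insert n {..<n}. coeff f i * of_int a ^ m * y ^ i) =
      x ^ n + (\<Sum>i<n. coeff f i * of_int a ^ m * y ^ i)"
    using f(4) by (simp add: n_def[symmetric]) (simp add: m x_def power_mult_distrib)
  also have "(\<Sum>i<n. coeff f i * of_int a ^ m * y ^ i) = - (\<Sum>i<n. C i * x ^ i)"
    using trm by (simp add: sum_negf)
  finally have xn: "x ^ n = (\<Sum>i<n. C i * x ^ i)" by simp
  have "\<exists>d. (\<forall>i. d i \<in> \<int>) \<and> x ^ k = (\<Sum>i<n. d i * x ^ i)" for k
  proof (induction k)
    case 0
    have "(\<Sum>i<n. (if i = 0 then 1 else 0) * x ^ i) = (\<Sum>i<n. if i = 0 then x ^ i else 0)"
      by (intro sum.cong) auto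
    also have "\<dots> = 1" using m by simp
    finally show ?case by (intro exI[of _ "\<lambda>i. if i = 0 then 1 else 0"]) auto
  next
    case (Suc k)
    then obtain d where d: "\<forall>i. d i \<in> \<int>" "x ^ k = (\<Sum>i<n. d i * x ^ i)" by blast
    define d' where "d' i = (if i = 0 then 0 else d (i - 1)) + d m * C i" for i
    have "x ^ Suc k = (\<Sum>i<n. d i * x ^ Suc i)" by (simp add: d(2) sum_distrib_left mult_ac)
    also have "\<dots> = (\<Sum>i<m. d i * x ^ Suc i) + d m * x ^ n" by (simp add: m)
    also have "(\<Sum>i<m. d i * x ^ Suc i) = (\<Sum>i<n. (if i = 0 then 0 else d (i - 1)) * x ^ i)"
      unfolding m by (subst sum.lessThan_Suc_shift) simp
    also have "d m * x ^ n = (\<Sum>i<n. d m * C i * x ^ i)" by (simp add: xn sum_distrib_left mult_ac)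
    finally have "x ^ Suc k = (\<Sum>i<n. d' i * x ^ i)" by (simp add: d'_def sum.distrib distrib_right)
    moreover have "\<forall>i. d' i \<in> \<int>" using d(1) CZ by (auto simp: d'_def)
    ultimately show ?case by blast
  qed
  then have bound: "v x ^ k \<le> (\<Sum>i<n. v x ^ i)" for k
  proof -
    obtain d where d: "\<forall>i. d i \<in> \<int>" "x ^ k = (\<Sum>i<n. d i * x ^ i)"
      using \<open>\<And>k. \<exists>d. (\<forall>i. d i \<in> \<int>) \<and> x ^ k = (\<Sum>i<n. d i * x ^ i)\<close> by blast
    have "v x ^ k = v (\<Sum>i<n. d i * x ^ i)" using v_power[OF xK] d(2) by metis
    also have "\<dots> \<le> (\<Sum>i<n. v (d i * x ^ i))" using d(1) cK xK by (intro v_sum_le mult pow) auto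
    also have "\<dots> \<le> (\<Sum>i<n. v x ^ i)"
    proof (rule sum_mono)
      fix i
      have "v (d i * x ^ i) = v (d i) * v x ^ i" using d(1) cK xK by (simp add: v_mult pow v_power)
      also have "\<dots> \<le> 1 * v x ^ i" using vint d(1) v_nonneg[OF xK] by (intro mult_right_mono) auto
      finally show "v (d i * x ^ i) \<le> v x ^ i" by simp
    qed
    finally show ?thesis .
  qed
  have "v x \<le> 1"
  proof (rule ccontr)
    assume "\<not> v x \<le> 1"
    then obtain k where "(\<Sum>i<n. v x ^ i) < v x ^ k" using real_arch_pow[of "v x"] by auto
    then show False using bound[of k] by simp
  qed
  moreover have "v x = v y"
    using v_mult[OF int y(1), of a] v_rat[of "of_int a"] qplace_prime_int_cases(2)[OF p nd] by (simp add: x_def)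
  ultimately show False using y(2) by simp
qed

section \<open>Comparison of the height with sums over conjugates\<close>

context
  fixes y assumes y: "y \<in> Qbar"
begin

lemma rational_place_adjoin: "q \<in> pindex \<Longrightarrow> rational_place (rat_adjoin y) q"
  using rat_adjoin_eq(2)[OF y] by unfold_locales

lemma place_adjoin: "q \<in> pindex \<Longrightarrow> v \<in> places_over q (rat_adjoin y) \<Longrightarrow> place (rat_adjoin y) v q"
  using rational_place.placeI[OF rational_place_adjoin] .

lemma finite_places_over_adjoin: "q \<in> pindex \<Longrightarrow> finite (places_over q (rat_adjoin y))"
  using rational_place.finite_places_over[OF rational_place_adjoin _ rat_adjoin_eq(1)[OF y]] by simp

text \<open>Besides the archimedean places, only places over primes dividing the leading coefficient
  of an integer polynomial for \<open>y\<close> can contribute, and over each index there are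
  finitely many.\<close>

lemma finite_places_gt_1: "finite {v \<in> places (rat_adjoin y). v y > 1}"
proof -
  obtain f where f: "\<forall>i. coeff f i \<in> \<int>" "f \<noteq> 0" "poly f y = 0"
    using y unfolding Qbar_def algebraic_def by blast
  obtain a where a: "lead_coeff f = of_int a" using f(1) by (auto elim: Ints_cases)
  then have a0: "a \<noteq> 0" using f(2) by auto
  define B where "B = insert 0 {p. prime p \<and> int p dvd a}"
  have "{p. prime p \<and> int p dvd a} \<subseteq> {p. p dvd nat \<bar>a\<bar>}" by auto
  then have "finite B" using a0 finite_divisors_nat[of "nat \<bar>a\<bar>"] finite_subset by (auto simp: B_def)
  moreover have "B \<subseteq> pindex" by (auto simp: B_def pindex_def)
  ultimately have "finite (\<Union>q\<in>B. places_over q (rat_adjoin y))" using finite_places_over_adjoin by auto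
  moreover have "{v \<in> places (rat_adjoin y). v y > 1} \<subseteq> (\<Union>q\<in>B. places_over q (rat_adjoin y))"
  proof
    fix v assume "v \<in> {v \<in> places (rat_adjoin y). v y > 1}"
    then obtain q where v: "q \<in> pindex" "v \<in> places_over q (rat_adjoin y)" "v y > 1"
      using places_eq[OF rat_adjoin_eq(2)[OF y]] by auto
    interpret place "rat_adjoin y" v q by (rule place_adjoin[OF v(1,2)])
    have "q \<in> B"
      using v(1)
    proof (cases rule: pindex_cases)
      case 2
      then show ?thesis using prime_dvd_lead_coeff[OF 2 _ f(2,3) a rat_adjoin_eq(3)[OF y] v(3)] f(1) by (simp add: B_def)
    qed (simp add: B_def)
    then show "v \<in> (\<Union>q\<in>B. places_over q (rat_adjoin y))" using v(2) by blast
  qed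
  ultimately show ?thesis by (rule rev_finite_subset)
qed

text \<open>\<open>LEAST\<close> has a meaning only because some finite spanning family exists, by
  \<open>ex_spans_completion\<close>; the least one must then obey the bound of
  \<open>card_embeddings_le\<close>.\<close>

lemma local_degree_ge:
  assumes q: "q \<in> pindex" and v: "v \<in> places_over q (rat_adjoin y)"
  shows "card {z \<in> conjs y. \<exists>\<sigma>\<in>qaut. \<sigma> y = z \<and> (\<forall>x\<in>rat_adjoin y. qplace q (\<sigma> x) = v x)}
    \<le> local_degree (rat_adjoin y) v"
proof -
  interpret place "rat_adjoin y" v q by (rule place_adjoin[OF q v])
  define J where "J = {z \<in> conjs y. \<exists>\<sigma>\<in>qaut. \<sigma> y = z \<and> (\<forall>x\<in>rat_adjoin y. qplace q (\<sigma> x) = v x)}"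
  have "\<exists>n b. spans_completion n b" using ex_spans_completion[OF _ rat_adjoin_eq(1)[OF y]] by simp
  then have "\<exists>b. spans_completion (local_degree (rat_adjoin y) v) b"
    unfolding local_degree_eq by (rule LeastI_ex)
  then obtain b where b: "spans_completion (local_degree (rat_adjoin y) v) b" ..
  have "\<forall>z\<in>J. \<exists>\<sigma>. \<sigma> \<in> qaut \<and> \<sigma> y = z \<and> (\<forall>x\<in>rat_adjoin y. qplace q (\<sigma> x) = v x)" by (auto simp: J_def)
  then obtain \<sigma> where s: "\<forall>z\<in>J. \<sigma> z \<in> qaut \<and> \<sigma> z y = z \<and> (\<forall>x\<in>rat_adjoin y. qplace q (\<sigma> z x) = v x)"
    by (rule bchoice[THEN exE])
  have "finite J" using finite_conjs[OF y] by (simp add: J_def)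
  moreover have "inj_on (\<lambda>z. \<sigma> z y) J" using s by (auto intro: inj_onI)
  ultimately have "card J \<le> local_degree (rat_adjoin y) v"
    using card_embeddings_le[OF b rat_adjoin_eq(4)[OF y], of J \<sigma> y] s rat_adjoin_eq(3)[OF y] by simp
  then show ?thesis by (simp add: J_def)
qed

text \<open>Each conjugate \<open>z\<close> determines an embedding of the field and hence a place
  over \<open>q\<close>. Grouping the conjugates by this place, each fibre has at most as many
  elements as the local degree.\<close>

lemma sum_conjs_le:
  assumes q: "q \<in> pindex"
  shows "(\<Sum>z\<in>conjs y. ln (max 1 (qplace q z))) \<le>
    (\<Sum>v\<in>places_over q (rat_adjoin y). real (local_degree (rat_adjoin y) v) * ln (max 1 (v y)))"
proof -
  let ?K = "rat_adjoin y"
  interpret w: absval Qbar "qplace q" by (rule qplace_absval[OF q])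
  have KQ: "?K \<subseteq> Qbar" and yK: "y \<in> ?K" and sub: "is_subfield ?K" using rat_adjoin_eq[OF y] by auto
  interpret K: cfield ?K by (rule cfieldI[OF sub])
  have "\<forall>z\<in>conjs y. \<exists>\<sigma>. \<sigma> \<in> qaut \<and> \<sigma> y = z" by (auto simp: conjs_def)
  then obtain \<sigma> where s: "\<forall>z\<in>conjs y. \<sigma> z \<in> qaut \<and> \<sigma> z y = z" by (rule bchoice[THEN exE])
  \<comment> \<open>\<open>restrict\<close> produces the extensional function that represents the
    place.\<close>
  define g where "g z = restrict (\<lambda>x. qplace q (\<sigma> z x)) ?K" for z
  have g: "g z \<in> places_over q ?K" "g z y = qplace q z" if z: "z \<in> conjs y" for z
  proof -
    have sz: "\<sigma> z \<in> qaut" "\<sigma> z y = z" using s z by auto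
    interpret chom Qbar "\<sigma> z" by (rule qaut_chom[OF sz(1)])
    have Q: "x \<in> Qbar" if "x \<in> ?K" for x using that KQ by auto
    have gx: "g z x = qplace q (\<sigma> z x)" if "x \<in> ?K" for x using that by (simp add: g_def)
    have "absolute_value ?K (g z)"
      unfolding absolute_value_def
    proof (intro conjI ballI)
      show "g z \<in> extensional ?K" by (simp add: g_def)
      fix x assume x: "x \<in> ?K"
      show "0 \<le> g z x" "(g z x = 0) = (x = 0)"
        using x Q[OF x] hom_in w.v_nonneg w.v_zero_iff hom_eq_0_iff by (simp_all add: gx)
      fix u assume u: "u \<in> ?K"
      show "g z (x * u) = g z x * g z u"
        using x u Q hom_in by (simp add: gx K.mult hom_mult w.v_mult)
      show "g z (x + u) \<le> g z x + g z u"
        using x u Q hom_in by (simp add: gx K.add hom_add w.v_add_le)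
    qed
    moreover have "g z (of_int a) = qplace q (of_int a)" for a using K.int hom_int by (simp add: g_def)
    ultimately show "g z \<in> places_over q ?K" by (simp add: places_over_def)
    show "g z y = qplace q z" using yK sz by (simp add: g_def)
  qed
  have fin: "finite (places_over q ?K)" by (rule finite_places_over_adjoin[OF q])
  have "(\<Sum>z\<in>conjs y. ln (max 1 (qplace q z))) = (\<Sum>z\<in>conjs y. ln (max 1 (g z y)))"
    using g(2) by simp
  also have "\<dots> = (\<Sum>v\<in>places_over q ?K. \<Sum>z\<in>{z \<in> conjs y. g z = v}. ln (max 1 (g z y)))"
    using g(1) by (intro sum.group[symmetric] finite_conjs[OF y] fin) auto
  also have "\<dots> = (\<Sum>v\<in>places_over q ?K. real (card {z \<in> conjs y. g z = v}) * ln (max 1 (v y)))"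
    by (intro sum.cong) auto
  also have "\<dots> \<le> (\<Sum>v\<in>places_over q ?K. real (local_degree ?K v) * ln (max 1 (v y)))"
  proof (intro sum_mono mult_right_mono)
    fix v assume v: "v \<in> places_over q ?K"
    have "{z \<in> conjs y. g z = v} \<subseteq> {z \<in> conjs y. \<exists>\<sigma>\<in>qaut. \<sigma> y = z \<and> (\<forall>x\<in>?K. qplace q (\<sigma> x) = v x)}"
      using s by (auto simp: g_def)
    then have "card {z \<in> conjs y. g z = v} \<le>
        card {z \<in> conjs y. \<exists>\<sigma>\<in>qaut. \<sigma> y = z \<and> (\<forall>x\<in>?K. qplace q (\<sigma> x) = v x)}"
      using finite_conjs[OF y] by (intro card_mono) auto
    also note local_degree_ge[OF q v]
    finally have "card {z \<in> conjs y. g z = v} \<le> local_degree ?K v" .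
    then show "real (card {z \<in> conjs y. g z = v}) \<le> real (local_degree ?K v)" by simp
  qed simp
  finally show ?thesis .
qed

lemma weil_height_ge:
  assumes Q: "finite Q" "Q \<subseteq> pindex"
  shows "(\<Sum>q\<in>Q. \<Sum>z\<in>conjs y. ln (max 1 (qplace q z))) / real (card (conjs y)) \<le> weil_height y"
proof -
  let ?K = "rat_adjoin y"
  define d where "d = real (card (conjs y))"
  have d: "d > 0" using card_conjs_pos[OF y] by (simp add: d_def)
  define F where "F v = real (local_degree ?K v) / d * ln (max 1 (v y))" for v
  have F0: "F v \<ge> 0" for v using d by (simp add: F_def)
  \<comment> \<open>\<open>A\<close> contains every place with a nonzero term, so the infinite sum
    is a genuine finite one, and also all places over \<open>Q\<close>, so the comparison is a sum
    over a subset.\<close>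
  define A where "A = {v \<in> places ?K. v y > 1} \<union> (\<Union>q\<in>Q. places_over q ?K)"
  have QA: "(\<Union>q\<in>Q. places_over q ?K) \<subseteq> places ?K"
    using places_eq[OF rat_adjoin_eq(2)[OF y]] Q(2) by auto
  have fA: "finite A" "A \<subseteq> places ?K"
    using finite_places_gt_1 finite_places_over_adjoin Q QA by (auto simp: A_def)
  have "weil_height y = (\<Sum>\<^sub>\<infinity>v\<in>places ?K. F v)"
    by (simp add: weil_height_def Let_def field_degree_rat_adjoin[OF y] F_def d_def)
  also have "\<dots> = (\<Sum>\<^sub>\<infinity>v\<in>A. F v)"
  proof (rule infsum_cong_neutral)
    fix v assume "v \<in> places ?K - A"
    then have "max 1 (v y) = 1" by (auto simp: A_def)
    then show "F v = 0" by (simp add: F_def)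
  qed (use fA in auto)
  also have "\<dots> = sum F A" using fA by simp
  finally have h: "weil_height y = sum F A" .
  have "(\<Sum>q\<in>Q. \<Sum>z\<in>conjs y. ln (max 1 (qplace q z))) / d \<le>
      (\<Sum>q\<in>Q. \<Sum>v\<in>places_over q ?K. real (local_degree ?K v) * ln (max 1 (v y))) / d"
    using d Q(2) sum_conjs_le by (intro divide_right_mono sum_mono) auto
  also have "\<dots> = (\<Sum>q\<in>Q. \<Sum>v\<in>places_over q ?K. F v)"
    by (simp add: F_def sum_divide_distrib)
  also have "\<dots> = sum F (\<Union>q\<in>Q. places_over q ?K)"
    using Q finite_places_over_adjoin places_over_disjoint by (intro sum.UNION_disjoint[symmetric]) (auto, blast+)
  also have "\<dots> \<le> sum F A" using fA F0 by (intro sum_mono2) (auto simp: A_def)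
  finally show ?thesis by (simp add: h d_def)
qed

end

lemma weil_height_nonneg: "weil_height y \<ge> 0"
  unfolding weil_height_def Let_def by (intro infsum_nonneg) simp

lemma weil_height_one: "weil_height 1 = 0"
proof -
  have sub: "is_subfield (rat_adjoin 1)" by (rule rat_adjoin_eq(2)[OF Qb.one])
  have "v 1 = 1" if "v \<in> places (rat_adjoin 1)" for v
  proof -
    have "absolute_value (rat_adjoin 1) v"
      using that by (auto simp: places_def archimedean_place_def padic_place_def)
    then interpret absval "rat_adjoin 1" v by (intro absvalI sub)
    show ?thesis by (rule v_one)
  qed
  then show ?thesis unfolding weil_height_def Let_def by (intro infsum_0) (metis ln_one max.idem mult_zero_right)
qed

section \<open>The product formula\<close>

lemma product_formula_int:
  assumes a: "a \<noteq> 0" and Q: "finite Q" "Q \<subseteq> pindex" "0 \<in> Q" "{p. prime p \<and> int p dvd a} \<subseteq> Q"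
  shows "(\<Sum>q\<in>Q. ln (qplace q (of_int a))) = 0"
proof -
  define P where "P = Q - {0}"
  have P: "finite P" "0 \<notin> P" "Q = insert 0 P" "\<And>p. p \<in> P \<Longrightarrow> prime p" using Q by (auto simp: P_def pindex_def)
  have sub: "prime_factors a \<subseteq> int ` P"
  proof
    fix r assume r: "r \<in> prime_factors a"
    then have "prime r" "r dvd a" "r \<ge> 0" by (auto simp: in_prime_factors_iff prime_ge_0_int)
    then have "prime (nat r)" "int (nat r) = r" by simp_all
    moreover have "nat r \<in> Q" using Q(4) \<open>r dvd a\<close> calculation by auto
    ultimately show "r \<in> int ` P" unfolding P_def by (metis Diff_iff image_eqI not_prime_0 singletonD)
  qed
  have "\<bar>a\<bar> = (\<Prod>p\<in>prime_factors a. p ^ multiplicity p a)"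
    using prod_prime_factors[OF a] by simp
  also have "\<dots> = (\<Prod>p\<in>int ` P. p ^ multiplicity p a)"
  proof (rule prod.mono_neutral_left)
    show "\<forall>i\<in>int ` P - prime_factors a. i ^ multiplicity i a = 1"
    proof
      fix i assume i: "i \<in> int ` P - prime_factors a"
      then have "prime i" using P(4) by auto
      then have "\<not> i dvd a" using i a by (auto simp: in_prime_factors_iff)
      then show "i ^ multiplicity i a = 1" by (simp add: not_dvd_imp_multiplicity_0)
    qed
  qed (use P(1) sub in auto)
  also have "\<dots> = (\<Prod>p\<in>P. int p ^ multiplicity (int p) a)"
    by (subst prod.reindex) (auto simp: inj_on_def)
  finally have "real_of_int \<bar>a\<bar> = (\<Prod>p\<in>P. real p ^ multiplicity (int p) a)"
    by (metis (mono_tags, lifting) of_int_of_nat_eq of_int_power of_int_prod prod.cong)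
  moreover have "ln (\<Prod>p\<in>P. real p ^ multiplicity (int p) a) = (\<Sum>p\<in>P. ln (real p ^ multiplicity (int p) a))"
    using P(1,4) by (intro ln_prod) (auto dest: prime_gt_0_nat)
  moreover have "qplace 0 (of_int a) = real_of_int \<bar>a\<bar>" by (simp add: qplace_0 Qb.int)
  moreover have "ln (qplace p (of_int a)) = - ln (real p ^ multiplicity (int p) a)" if "p \<in> P" for p
    using qplace_prime_int[OF P(4)[OF that] a] prime_gt_0_nat[OF P(4)[OF that]] by (simp add: ln_div)
  ultimately show ?thesis using P(1-3) by (simp add: sum_negf)
qed

text \<open>A threshold set replaces the infinite sum: the logarithms cancel over every finite set
  of places that contains the usual one and all primes dividing numerator or denominator.\<close>

lemma product_formula:
  assumes "x \<in> \<rat>" "x \<noteq> 0"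
  shows "\<exists>Q0. finite Q0 \<and> Q0 \<subseteq> pindex \<and>
    (\<forall>Q. finite Q \<longrightarrow> Q \<subseteq> pindex \<longrightarrow> Q0 \<subseteq> Q \<longrightarrow> (\<Sum>q\<in>Q. ln (qplace q x)) = 0)"
proof -
  obtain a b where ab: "x = of_int a / of_int b" "b > 0" using assms(1) by (auto elim: Rats_cases')
  have nz: "a \<noteq> 0" "b \<noteq> 0" using ab assms(2) by auto
  have fin: "finite {p. prime p \<and> int p dvd c}" if "c \<noteq> 0" for c
  proof -
    have "{p. prime p \<and> int p dvd c} \<subseteq> {p. p dvd nat \<bar>c\<bar>}" by auto
    then show ?thesis using finite_divisors_nat[of "nat \<bar>c\<bar>"] that finite_subset by auto
  qed
  define Q0 where "Q0 = insert 0 ({p. prime p \<and> int p dvd a} \<union> {p. prime p \<and> int p dvd b})"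
  have "(\<Sum>q\<in>Q. ln (qplace q x)) = 0" if Q: "finite Q" "Q \<subseteq> pindex" "Q0 \<subseteq> Q" for Q
  proof -
    have "ln (qplace q x) = ln (qplace q (of_int a)) - ln (qplace q (of_int b))" if "q \<in> Q" for q
    proof -
      interpret absval Qbar "qplace q" using qplace_absval that Q by blast
      have "qplace q (of_int a) > 0" "qplace q (of_int b) > 0" using nz v_pos[OF Qb.int] by simp_all
      then show ?thesis by (simp add: ab(1) v_divide Qb.int ln_div)
    qed
    then have "(\<Sum>q\<in>Q. ln (qplace q x)) = (\<Sum>q\<in>Q. ln (qplace q (of_int a))) - (\<Sum>q\<in>Q. ln (qplace q (of_int b)))"
      by (simp add: sum_subtractf)
    moreover have "(\<Sum>q\<in>Q. ln (qplace q (of_int a))) = 0" "(\<Sum>q\<in>Q. ln (qplace q (of_int b))) = 0"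
      using Q nz by (auto intro!: product_formula_int simp: Q0_def)
    ultimately show ?thesis by simp
  qed
  moreover have "finite Q0" "Q0 \<subseteq> pindex" using fin nz by (auto simp: Q0_def pindex_def)
  ultimately show ?thesis by blast
qed

definition nrm :: "nat set \<Rightarrow> complex \<Rightarrow> real" where
  "nrm Q x = (\<Sum>q\<in>Q. \<bar>ln (qplace q x)\<bar>)"

text \<open>For \<open>t > 0\<close> the absolute value of \<open>ln t\<close> is
  \<open>2 * ln (max 1 t) - ln t\<close>, whence the factor 2. The subtracted terms add up to the
  logarithms of the rational number \<open>N\<close>, which cancel once \<open>Q\<close> has been
  enlarged for the product formula.\<close>

lemma nrm_conjs_le_weil_height:
  assumes y: "y \<in> Qbar" "y \<noteq> 0" and Q: "finite Q" "Q \<subseteq> pindex"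
  shows "(\<Sum>z\<in>conjs y. nrm Q z) / real (card (conjs y)) \<le> 2 * weil_height y"
proof -
  define d where "d = real (card (conjs y))"
  have d: "d > 0" using card_conjs_pos[OF y(1)] by (simp add: d_def)
  have cQ: "z \<in> Qbar" "z \<noteq> 0" if "z \<in> conjs y" for z
  proof -
    obtain \<sigma> where s: "\<sigma> \<in> qaut" "z = \<sigma> y" using \<open>z \<in> conjs y\<close> by (auto simp: conjs_def)
    interpret chom Qbar \<sigma> by (rule qaut_chom[OF s(1)])
    show "z \<in> Qbar" "z \<noteq> 0" using s y hom_in hom_eq_0_iff by auto
  qed
  define N where "N = (\<Prod>z\<in>conjs y. z)"
  have NQ: "N \<in> \<rat>"
  proof (rule fixed_imp_mem[OF is_subfield_Rats Rats_subset_Qbar])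
    show "N \<in> Qbar" unfolding N_def using cQ by (intro Qb.prod)
    fix \<sigma> assume s: "\<sigma> \<in> qaut"
    interpret chom Qbar \<sigma> by (rule qaut_chom[OF s])
    have "\<sigma> N = (\<Prod>z\<in>conjs y. \<sigma> z)" unfolding N_def using cQ by (intro hom_prod)
    also have "\<dots> = N" unfolding N_def using prod.reindex_bij_betw[OF conjs_perm[OF y(1) s], of "\<lambda>z. z"] .
    finally show "\<sigma> N = N" .
  qed
  have "N \<noteq> 0" unfolding N_def using cQ finite_conjs[OF y(1)] by simp
  then obtain Q0 where Q0: "finite Q0" "Q0 \<subseteq> pindex"
    "\<And>Q. finite Q \<Longrightarrow> Q \<subseteq> pindex \<Longrightarrow> Q0 \<subseteq> Q \<Longrightarrow> (\<Sum>q\<in>Q. ln (qplace q N)) = 0"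
    using product_formula[OF NQ] by blast
  define Q' where "Q' = Q \<union> Q0"
  have Q': "finite Q'" "Q' \<subseteq> pindex" using Q Q0 by (auto simp: Q'_def)
  have lnN: "ln (qplace q N) = (\<Sum>z\<in>conjs y. ln (qplace q z))" if "q \<in> Q'" for q
  proof -
    interpret absval Qbar "qplace q" using qplace_absval that Q' by blast
    have "qplace q N = (\<Prod>z\<in>conjs y. qplace q z)" unfolding N_def using cQ by (intro v_prod)
    moreover have "ln (\<Prod>z\<in>conjs y. qplace q z) = (\<Sum>z\<in>conjs y. ln (qplace q z))"
      by (rule ln_prod[OF finite_conjs[OF y(1)]]) (metis cQ less_irrefl v_pos)
    ultimately show ?thesis by simp
  qed
  have abs: "\<bar>ln t\<bar> = 2 * ln (max 1 t) - ln t" if "t > 0" for t :: real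
    using that by (cases "t \<ge> 1") (auto simp: max_def)
  have pos: "qplace q z > 0" if "q \<in> Q'" "z \<in> conjs y" for q z
    using absval.v_pos[OF qplace_absval] that Q' cQ by blast
  have "(\<Sum>z\<in>conjs y. nrm Q z) \<le> (\<Sum>z\<in>conjs y. nrm Q' z)"
    unfolding nrm_def using Q' by (intro sum_mono sum_mono2) (auto simp: Q'_def)
  also have "\<dots> = (\<Sum>q\<in>Q'. \<Sum>z\<in>conjs y. \<bar>ln (qplace q z)\<bar>)"
    unfolding nrm_def by (rule sum.swap)
  also have "\<dots> = (\<Sum>q\<in>Q'. \<Sum>z\<in>conjs y. 2 * ln (max 1 (qplace q z)) - ln (qplace q z))"
    using pos abs by (intro sum.cong) auto
  also have "\<dots> = 2 * (\<Sum>q\<in>Q'. \<Sum>z\<in>conjs y. ln (max 1 (qplace q z))) - (\<Sum>q\<in>Q'. ln (qplace q N))"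
    using lnN by (simp add: sum_subtractf sum_distrib_left)
  also have "(\<Sum>q\<in>Q'. ln (qplace q N)) = 0" using Q0(3)[OF Q'] by (simp add: Q'_def)
  finally have "(\<Sum>z\<in>conjs y. nrm Q z) \<le> 2 * (\<Sum>q\<in>Q'. \<Sum>z\<in>conjs y. ln (max 1 (qplace q z)))" by simp
  then have "(\<Sum>z\<in>conjs y. nrm Q z) / d \<le> 2 * ((\<Sum>q\<in>Q'. \<Sum>z\<in>conjs y. ln (max 1 (qplace q z))) / d)"
    using d by (simp add: divide_right_mono)
  also have "\<dots> \<le> 2 * weil_height y" using weil_height_ge[OF y(1) Q'] by (simp add: d_def)
  finally show ?thesis by (simp add: d_def)
qed

section \<open>Kronecker's theorem\<close>

lemma rat_int_if_qplace_le_1: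
  assumes x: "x \<in> \<rat>" "\<And>p. prime p \<Longrightarrow> qplace p x \<le> 1" shows "x \<in> \<int>"
proof -
  obtain a b where ab: "x = of_int a / of_int b" "b > 0" "coprime a b"
    using x(1) by (auto elim: Rats_cases')
  have "b = 1"
  proof (rule ccontr)
    assume "b \<noteq> 1"
    then have "nat b \<noteq> 1" using ab(2) by simp
    then obtain p where p: "prime p" "p dvd nat b" using prime_factor_nat by blast
    then have pb: "int p dvd b" using ab(2) by (metis int_dvd_int_iff int_nat_eq order_less_imp_le)
    have pa: "\<not> int p dvd a"
    proof
      assume "int p dvd a"
      then have "is_unit (int p)" using pb ab(3) by (metis coprime_common_divisor)
      then show False using prime_gt_1_nat[OF p(1)] by simp
    qed
    interpret absval Qbar "qplace p" by (rule qplace_absval) (simp add: pindex_def p)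
    have "multiplicity (int p) b > 0" using pb ab(2) prime_gt_1_nat[OF p(1)] by (simp add: multiplicity_gt_zero_iff)
    then have "real p ^ multiplicity (int p) b > 1" using prime_gt_1_nat[OF p(1)] by (intro one_less_power) auto
    then have "qplace p x > 1"
      using qplace_prime_int[OF p(1), of b] qplace_prime_int_cases(2)[OF p(1) pa] ab(2)
      by (simp add: ab(1) v_divide Qb.int)
    then show False using x(2)[OF p(1)] by simp
  qed
  then show ?thesis by (simp add: ab(1))
qed

lemma coeff_linear_mult:
  "coeff ([:- a, 1:] * q) n = - a * coeff q n + (if n = 0 then 0 else coeff q (n - 1))"
  for a :: complex
  by (cases n) (simp_all add: coeff_pCons)

lemma qplace_coeff_linear_prod:
  assumes "prime p" "\<And>z. z \<in> I \<Longrightarrow> z \<in> Qbar \<and> qplace p z \<le> 1"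
  shows "coeff (\<Prod>z\<in>I. [:- z, 1:]) n \<in> Qbar \<and> qplace p (coeff (\<Prod>z\<in>I. [:- z, 1:]) n) \<le> 1"
  using assms(2)
proof (induction I arbitrary: n rule: infinite_finite_induct)
  case (insert a I)
  interpret absval Qbar "qplace p" by (rule qplace_absval) (simp add: pindex_def assms)
  let ?q = "\<Prod>z\<in>I. [:- z, 1:]"
  have IH: "coeff ?q n \<in> Qbar" "qplace p (coeff ?q n) \<le> 1" for n using insert by auto
  define c where "c = - a * coeff ?q n"
  define d where "d = (if n = 0 then 0 else coeff ?q (n - 1))"
  have a: "a \<in> Qbar" "qplace p a \<le> 1" using insert.prems by auto
  have c: "c \<in> Qbar" "qplace p c \<le> 1"
    using a IH[of n] v_nonneg[of "coeff ?q n"] Qb.mult[of a "coeff ?q n"] v_uminus[of "a * coeff ?q n"]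
    by (simp_all add: c_def v_mult Qb.uminus mult_le_one)
  have d: "d \<in> Qbar" "qplace p d \<le> 1" using IH by (auto simp: d_def v_zero Qb.zero)
  have "coeff (\<Prod>z\<in>insert a I. [:- z, 1:]) n = c + d"
    using insert.hyps by (simp add: coeff_linear_mult c_def d_def del: mult_pCons_left)
  then show ?case using qplace_ultrametric[OF assms(1) c(1) d(1)] c d Qb.add by simp
next
  case (infinite A)
  interpret absval Qbar "qplace p" by (rule qplace_absval) (simp add: pindex_def assms)
  show ?case using infinite Qb.one Qb.zero v_one v_zero by (auto simp: coeff_pCons split: nat.split)
next
  case empty
  interpret absval Qbar "qplace p" by (rule qplace_absval) (simp add: pindex_def assms)
  show ?case using Qb.one Qb.zero v_one v_zero by (auto simp: coeff_pCons split: nat.split)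
qed

lemma cmod_coeff_linear_prod:
  assumes "finite I" "\<And>z. z \<in> I \<Longrightarrow> cmod z \<le> 1"
  shows "cmod (coeff (\<Prod>z\<in>I. [:- z, 1:]) n) \<le> 2 ^ card I"
  using assms
proof (induction I arbitrary: n rule: finite_induct)
  case (insert a I)
  let ?q = "\<Prod>z\<in>I. [:- z, 1:]"
  have IH: "cmod (coeff ?q n) \<le> 2 ^ card I" for n using insert by auto
  have "coeff (\<Prod>z\<in>insert a I. [:- z, 1:]) n = - a * coeff ?q n + (if n = 0 then 0 else coeff ?q (n - 1))"
    using insert.hyps by (simp add: coeff_linear_mult del: mult_pCons_left)
  then have "cmod (coeff (\<Prod>z\<in>insert a I. [:- z, 1:]) n) \<le>
      cmod (- a * coeff ?q n) + cmod (if n = 0 then 0 else coeff ?q (n - 1))"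
    using norm_triangle_ineq by metis
  also have "cmod (- a * coeff ?q n) \<le> 1 * 2 ^ card I"
    unfolding norm_mult using insert.prems IH by (intro mult_mono) auto
  also have "cmod (if n = 0 then 0 else coeff ?q (n - 1)) \<le> 2 ^ card I" using IH by simp
  finally show ?case using insert.hyps by simp
qed (auto simp: coeff_pCons split: nat.split)

lemma finite_bounded_polys:
  assumes "finite B" shows "finite {f :: complex poly. degree f \<le> d \<and> (\<forall>i. coeff f i \<in> B)}"
proof (rule finite_subset)
  show "finite (Poly ` {l. set l \<subseteq> B \<and> length l \<le> Suc d})"
    using finite_lists_length_le[OF assms] by simp
  show "{f. degree f \<le> d \<and> (\<forall>i. coeff f i \<in> B)} \<subseteq> Poly ` {l. set l \<subseteq> B \<and> length l \<le> Suc d}"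
  proof
    fix f assume f: "f \<in> {f. degree f \<le> d \<and> (\<forall>i. coeff f i \<in> B)}"
    have "set (coeffs f) \<subseteq> B"
      using f by (auto simp: coeffs_def split: if_splits)
    moreover have "length (coeffs f) \<le> Suc d"
      using f by (cases "f = 0") (auto simp: length_coeffs)
    ultimately show "f \<in> Poly ` {l. set l \<subseteq> B \<and> length l \<le> Suc d}"
      by (intro image_eqI[of _ _ "coeffs f"]) simp_all
  qed
qed

text \<open>The polynomials of the conjugates of all powers \<open>x ^ k\<close> have integer
  coefficients, degree at most \<open>d\<close> and bounded coefficients. There are finitely many of
  them, so two powers of \<open>x\<close> coincide.\<close>

lemma kronecker:
  assumes x: "x \<in> Qbar" and one: "\<And>q z. q \<in> pindex \<Longrightarrow> z \<in> conjs x \<Longrightarrow> qplace q z = 1"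
  shows "\<exists>k>0. x ^ k = 1"
proof -
  define d where "d = card (conjs x)"
  \<comment> \<open>Expanding at most \<open>d\<close> linear factors with roots of modulus at most
    1 gives coefficients of modulus at most \<open>2 ^ d\<close>.\<close>
  define B where "B = (\<lambda>a. complex_of_int a) ` {- (2 ^ d)..2 ^ d}"
  define Ps where "Ps = {f :: complex poly. degree f \<le> d \<and> (\<forall>i. coeff f i \<in> B)} - {0}"
  have x0: "x \<noteq> 0" using one[of 0 x] conjs_self x by (auto simp: pindex_def qplace_0)
  have "conj_poly (x ^ k) \<in> Ps" for k
  proof -
    have xk: "x ^ k \<in> Qbar" using x by (rule Qb.pow)
    have sub: "conjs (x ^ k) \<subseteq> (\<lambda>z. z ^ k) ` conjs x"
    proof
      fix z assume "z \<in> conjs (x ^ k)"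
      then obtain \<sigma> where s: "\<sigma> \<in> qaut" "z = \<sigma> (x ^ k)" by (auto simp: conjs_def)
      interpret chom Qbar \<sigma> by (rule qaut_chom[OF s(1)])
      show "z \<in> (\<lambda>z. z ^ k) ` conjs x" using s x by (auto simp: hom_power conjs_def)
    qed
    have le: "card (conjs (x ^ k)) \<le> d"
      using card_mono[OF _ sub] card_image_le[of "conjs x" "\<lambda>z. z ^ k"] finite_conjs[OF x] by (simp add: d_def)
    have one': "qplace q z = 1" if q: "q \<in> pindex" and z: "z \<in> conjs (x ^ k)" for q z
    proof -
      interpret absval Qbar "qplace q" by (rule qplace_absval[OF q])
      obtain y where "y \<in> conjs x" "z = y ^ k" using z sub by auto
      then show ?thesis using one[OF q] conjs_Qbar[OF x] by (auto simp: v_power)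
    qed
    have zQ: "z \<in> Qbar" if "z \<in> conjs (x ^ k)" for z using that conjs_Qbar[OF xk] by auto
    have "coeff (conj_poly (x ^ k)) i \<in> B" for i
    proof -
      have "coeff (conj_poly (x ^ k)) i \<in> \<int>"
      proof (rule rat_int_if_qplace_le_1[OF coeff_conj_poly[OF xk]])
        fix p :: nat assume p: "prime p"
        then show "qplace p (coeff (conj_poly (x ^ k)) i) \<le> 1"
          unfolding conj_poly_def using qplace_coeff_linear_prod[OF p, of "conjs (x ^ k)" i] zQ one'[of p]
          by (auto simp: pindex_def)
      qed
      then obtain a where a: "coeff (conj_poly (x ^ k)) i = of_int a" by (auto elim: Ints_cases)
      have "cmod (coeff (conj_poly (x ^ k)) i) \<le> 2 ^ card (conjs (x ^ k))"
        unfolding conj_poly_def using one'[of 0] zQ finite_conjs[OF xk]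
        by (intro cmod_coeff_linear_prod) (auto simp: pindex_def qplace_0 order.eq_iff)
      also have "\<dots> \<le> (2::real) ^ d" using le by (intro power_increasing) auto
      finally have "real_of_int \<bar>a\<bar> \<le> real_of_int (2 ^ d)" by (simp add: a)
      then have "\<bar>a\<bar> \<le> 2 ^ d" by linarith
      then show ?thesis unfolding a B_def by (intro imageI) auto
    qed
    moreover have "conj_poly (x ^ k) \<noteq> 0" using lead_conj_poly[of "x ^ k"] by auto
    ultimately show ?thesis using le by (simp add: Ps_def degree_conj_poly)
  qed
  then have "range (\<lambda>k. x ^ k) \<subseteq> (\<Union>f\<in>Ps. {z. poly f z = 0})"
    using conj_poly_root[OF Qb.pow[OF x]] conjs_self by blast
  moreover have "finite (\<Union>f\<in>Ps. {z. poly f z = 0})"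
    using finite_bounded_polys[of B d] poly_roots_finite by (auto simp: Ps_def B_def)
  ultimately have "finite (range (\<lambda>k. x ^ k))" by (rule finite_subset)
  then have "\<not> inj (\<lambda>k::nat. x ^ k)" using finite_imageD infinite_UNIV_nat by blast
  then obtain i j where ij: "i \<noteq> j" "x ^ i = x ^ j" by (auto simp: inj_def)
  have "\<exists>k>0. x ^ k = 1" if "i < j" "x ^ i = x ^ j" for i j
  proof -
    have "x ^ j = x ^ i * x ^ (j - i)" using that(1) by (simp flip: power_add)
    then have "x ^ (j - i) = 1" using that(2) x0 by simp
    then show ?thesis using that(1) by (intro exI[of _ "j - i"]) simp
  qed
  from this[of i j] this[of j i] show ?thesis using ij by (metis linorder_neqE_nat)
qed

section \<open>Finite levels\<close>

text \<open>\<open>level A\<close> is the normal closure of \<open>\<rat>(A)\<close>; for finite \<open>A\<close> only finitely many maps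
  arise by restricting automorphisms to it.\<close>

definition fixer :: "complex set \<Rightarrow> (complex \<Rightarrow> complex) set" where
  "fixer A = {\<sigma> \<in> qaut. \<forall>x\<in>A. \<sigma> x = x}"

definition orbs :: "complex set \<Rightarrow> complex set" where
  "orbs A = (\<Union>a\<in>A. conjs a)"

definition level :: "complex set \<Rightarrow> complex set" where
  "level A = {x \<in> Qbar. \<forall>\<sigma>\<in>fixer (orbs A). \<sigma> x = x}"

text \<open>Sets of automorphisms may be infinite; extensional restriction identifies those that
  agree on the level, so that products and cardinalities range over a finite set.\<close>

definition res :: "complex set \<Rightarrow> (complex \<Rightarrow> complex) set \<Rightarrow> (complex \<Rightarrow> complex) set" where
  "res A H = (\<lambda>\<sigma>. restrict \<sigma> (level A)) ` H"

text \<open>For finite \<open>A\<close> and \<open>H = fixer F\<close> with a field \<open>F\<close>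
  inside \<open>Qbar\<close>, this is the field norm from \<open>level A\<close> to its intersection
  with \<open>F\<close>.\<close>

definition rnorm :: "complex set \<Rightarrow> (complex \<Rightarrow> complex) set \<Rightarrow> complex \<Rightarrow> complex" where
  "rnorm A H x = (\<Prod>t\<in>res A H. t x)"

locale subgrp =
  fixes H assumes H_sub: "H \<subseteq> qaut" and H_id: "id \<in> H"
    and H_comp: "\<sigma> \<in> H \<Longrightarrow> \<tau> \<in> H \<Longrightarrow> \<sigma> \<circ> \<tau> \<in> H" and H_inv: "\<sigma> \<in> H \<Longrightarrow> inv \<sigma> \<in> H"

lemma subgrp_qaut: "subgrp qaut"
  by unfold_locales (auto intro: qaut_id qaut_comp qaut_inv)

lemma subgrp_fixer: "subgrp (fixer A)"
proof
  show "inv \<sigma> \<in> fixer A" if "\<sigma> \<in> fixer A" for \<sigma>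
  proof -
    have s: "\<sigma> \<in> qaut" "\<And>x. x \<in> A \<Longrightarrow> \<sigma> x = x" using that by (simp_all add: fixer_def)
    have "inv \<sigma> x = x" if "x \<in> A" for x using qaut_inv_cancel(2)[OF s(1), of x] s(2)[OF that] by simp
    then show ?thesis using qaut_inv[OF s(1)] by (simp add: fixer_def)
  qed
qed (auto simp: fixer_def qaut_id intro: qaut_comp)

locale finite_level =
  fixes A assumes fin: "finite A" and A_sub: "A \<subseteq> Qbar"
begin

abbreviation "L \<equiv> level A"
abbreviation "S \<equiv> orbs A"

lemma S: "finite S" "S \<subseteq> Qbar" "\<sigma> \<in> qaut \<Longrightarrow> x \<in> S \<Longrightarrow> \<sigma> x \<in> S"
proof -
  show "finite S" "S \<subseteq> Qbar"
    using fin A_sub finite_conjs conjs_Qbar by (auto simp: orbs_def)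
  assume s: "\<sigma> \<in> qaut" and "x \<in> S"
  then obtain a where a: "a \<in> A" "x \<in> conjs a" by (auto simp: orbs_def)
  then have "\<sigma> x \<in> conjs a" using conjs_perm[OF _ s, of a] A_sub by (auto simp: bij_betw_def)
  then show "\<sigma> x \<in> S" using a(1) by (auto simp: orbs_def)
qed

lemma L_Qbar: "x \<in> L \<Longrightarrow> x \<in> Qbar"
  by (simp add: level_def)

lemma A_level: "A \<subseteq> L"
  using A_sub conjs_self by (auto simp: level_def fixer_def orbs_def)

lemma level_subfield: "is_subfield L"
proof -
  have hom: "chom Qbar \<sigma>" if "\<sigma> \<in> fixer S" for \<sigma> using that qaut_chom by (simp add: fixer_def)
  show ?thesis unfolding is_subfield_def level_def
    by (auto simp: chom.hom_zero[OF hom] chom.hom_one[OF hom] chom.hom_add[OF hom] chom.hom_mult[OF hom]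
      chom.hom_uminus[OF hom] chom.hom_inverse[OF hom] Qb.zero Qb.one Qb.add Qb.mult Qb.uminus Qb.inv)
qed

sublocale cfield L
  by (rule cfieldI[OF level_subfield])

lemma normalizes: "\<sigma> \<in> qaut \<Longrightarrow> \<tau> \<in> fixer S \<Longrightarrow> inv \<sigma> \<circ> \<tau> \<circ> \<sigma> \<in> fixer S"
  by (auto simp: fixer_def qaut_inv_cancel S(3) intro: qaut_comp qaut_inv)

lemma level_stable: "\<sigma> \<in> qaut \<Longrightarrow> x \<in> L \<Longrightarrow> \<sigma> x \<in> L"
proof -
  assume s: "\<sigma> \<in> qaut" and x: "x \<in> L"
  have "\<tau> (\<sigma> x) = \<sigma> x" if t: "\<tau> \<in> fixer S" for \<tau>
  proof -
    have "inv \<sigma> (\<tau> (\<sigma> x)) = x" using normalizes[OF s t] x by (auto simp: level_def)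
    then show ?thesis using qaut_inv_cancel(1)[OF s, of "\<tau> (\<sigma> x)"] by simp
  qed
  then show ?thesis using s x qaut_Qbar by (auto simp: level_def)
qed

lemma agree:
  assumes "\<sigma> \<in> qaut" "\<tau> \<in> qaut" "\<And>x. x \<in> S \<Longrightarrow> \<sigma> x = \<tau> x" "x \<in> L" shows "\<sigma> x = \<tau> x"
proof -
  have "inv \<tau> \<circ> \<sigma> \<in> fixer S"
    using assms(1,2) by (auto simp: fixer_def qaut_inv_cancel assms(3) intro: qaut_comp qaut_inv)
  then have "inv \<tau> (\<sigma> x) = x" using assms(4) by (auto simp: level_def)
  then show ?thesis using qaut_inv_cancel(1)[OF assms(2), of "\<sigma> x"] by simp
qed

text \<open>A restriction is determined by how it maps the finite stable set \<open>S\<close> to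
  itself.\<close>

lemma finite_res: assumes "H \<subseteq> qaut" shows "finite (res A H)"
proof -
  have "inj_on (\<lambda>t. restrict t S) (res A H)"
  proof (rule inj_onI)
    fix t u assume tu: "t \<in> res A H" "u \<in> res A H" "restrict t S = restrict u S"
    then obtain \<sigma> \<tau> where st: "\<sigma> \<in> qaut" "\<tau> \<in> qaut" "t = restrict \<sigma> L" "u = restrict \<tau> L"
      using assms by (auto simp: res_def)
    have SL: "S \<subseteq> L" using S(2) by (auto simp: level_def fixer_def)
    have "\<sigma> x = \<tau> x" if "x \<in> S" for x
      using fun_cong[OF tu(3), of x] that SL by (simp add: st(3,4) subset_iff)
    then show "t = u" using agree[OF st(1,2)] by (auto simp: st(3,4) restrict_def)
  qed
  moreover have "(\<lambda>t. restrict t S) ` res A H \<subseteq> S \<rightarrow>\<^sub>E S"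
  proof -
    have SL: "S \<subseteq> L" using S(2) by (auto simp: level_def fixer_def)
    have "restrict (restrict \<sigma> L) S \<in> S \<rightarrow>\<^sub>E S" if "\<sigma> \<in> H" for \<sigma>
      using S(3)[of \<sigma>] SL that assms by (auto simp: subset_iff)
    then show ?thesis by (auto simp only: res_def)
  qed
  moreover have "finite (S \<rightarrow>\<^sub>E S)" using S(1) by (intro finite_PiE)
  ultimately show ?thesis by (meson finite_imageD finite_subset)
qed

lemma res_nonempty: "subgrp H \<Longrightarrow> card (res A H) > 0"
  using finite_res subgrp.H_sub subgrp.H_id by (fastforce simp: card_gt_0_iff res_def)

lemma resE:
  assumes "t \<in> res A H" "H \<subseteq> qaut" obtains \<sigma> where "\<sigma> \<in> H" "\<sigma> \<in> qaut" "\<And>x. x \<in> L \<Longrightarrow> t x = \<sigma> x"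
  using assms by (auto simp: res_def)

text \<open>One statement covers three uses: left translation makes norms invariant, right
  translation makes averages independent of the chosen conjugate, and conjugation, with
  \<open>\<rho>\<close> the inverse of \<open>\<tau>\<close>, makes norms commute with
  \<open>\<tau>\<close>.\<close>

lemma res_translate:
  assumes H: "H \<subseteq> qaut" and t: "\<tau> \<in> qaut" "\<rho> \<in> qaut" "\<And>\<sigma>. \<sigma> \<in> H \<Longrightarrow> \<tau> \<circ> \<sigma> \<circ> \<rho> \<in> H"
  shows "bij_betw (\<lambda>t. restrict (\<lambda>x. \<tau> (t (\<rho> x))) L) (res A H) (res A H)"
proof -
  let ?m = "\<lambda>t. restrict (\<lambda>x. \<tau> (t (\<rho> x))) L"
  have "?m (restrict \<sigma> L) = restrict (\<tau> \<circ> \<sigma> \<circ> \<rho>) L" for \<sigma>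
    using level_stable[OF t(2)] by (auto simp: restrict_def)
  then have "?m ` res A H \<subseteq> res A H" using t(3) by (auto simp: res_def)
  moreover have "inj_on ?m (res A H)"
  proof (rule inj_onI)
    fix u v assume uv: "u \<in> res A H" "v \<in> res A H" "?m u = ?m v"
    have "u x = v x" if x: "x \<in> L" for x
    proof -
      have y: "inv \<rho> x \<in> L" using level_stable[OF qaut_inv[OF t(2)] x] .
      then have "\<tau> (u x) = \<tau> (v x)"
        using fun_cong[OF uv(3), of "inv \<rho> x"] qaut_inv_cancel(1)[OF t(2)] by simp
      then show ?thesis using qaut_bij[OF t(1)] by (simp add: bij_is_inj inj_eq)
    qed
    then show "u = v" using uv(1,2) by (auto simp: res_def restrict_def)
  qed
  ultimately show ?thesis using finite_res[OF H] by (simp add: bij_betw_def endo_inj_surj)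
qed

lemma prod_res_translate:
  assumes "H \<subseteq> qaut" "\<tau> \<in> qaut" "\<rho> \<in> qaut" "\<And>\<sigma>. \<sigma> \<in> H \<Longrightarrow> \<tau> \<circ> \<sigma> \<circ> \<rho> \<in> H" "x \<in> L"
  shows "(\<Prod>t\<in>res A H. \<tau> (t (\<rho> x))) = rnorm A H x"
  using prod.reindex_bij_betw[OF res_translate[OF assms(1-4)], of "\<lambda>t. t x"] assms(5)
  by (simp add: rnorm_def)

lemma sum_res_translate:
  assumes "\<rho> \<in> qaut" "x \<in> L"
  shows "(\<Sum>t\<in>res A qaut. F (t (\<rho> x))) = (\<Sum>t\<in>res A qaut. F (t x))"
proof -
  have "bij_betw (\<lambda>t. restrict (\<lambda>x. id (t (\<rho> x))) L) (res A qaut) (res A qaut)"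
    by (rule res_translate[OF subset_refl qaut_id assms(1)]) (use assms(1) in \<open>auto intro: qaut_comp qaut_id\<close>)
  from sum.reindex_bij_betw[OF this, of "\<lambda>t. F (t x)"] show ?thesis using assms(2) by simp
qed

lemma rnorm_hom:
  assumes H: "H \<subseteq> qaut" and x: "x \<in> L" and t: "\<tau> \<in> qaut"
  shows "rnorm A H x \<in> L" and "\<tau> (rnorm A H x) = (\<Prod>t\<in>res A H. \<tau> (t x))"
proof -
  have tL: "t x \<in> L" if "t \<in> res A H" for t using that H x level_stable by (auto simp: res_def)
  interpret h: chom Qbar \<tau> by (rule qaut_chom[OF t])
  show "rnorm A H x \<in> L" unfolding rnorm_def using tL by (intro prod)
  show "\<tau> (rnorm A H x) = (\<Prod>t\<in>res A H. \<tau> (t x))"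
    unfolding rnorm_def using tL L_Qbar by (intro h.hom_prod) auto
qed

lemma rnorm_fixed:
  assumes "subgrp H" "x \<in> L" "\<tau> \<in> H" shows "\<tau> (rnorm A H x) = rnorm A H x"
proof -
  interpret subgrp H by fact
  have "\<tau> \<in> qaut" using assms(3) H_sub by blast
  then show ?thesis
    using rnorm_hom(2)[OF H_sub assms(2)] prod_res_translate[OF H_sub _ qaut_id _ assms(2), of \<tau>] H_comp[OF assms(3)]
    by simp
qed

lemma rnorm_commute:
  assumes H: "H \<subseteq> qaut" and t: "\<tau> \<in> qaut" "\<And>\<sigma>. \<sigma> \<in> H \<Longrightarrow> \<tau> \<circ> \<sigma> \<circ> inv \<tau> \<in> H" and x: "x \<in> L"
  shows "\<tau> (rnorm A H x) = rnorm A H (\<tau> x)"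
  using rnorm_hom(2)[OF H x t(1)] prod_res_translate[OF H t(1) qaut_inv[OF t(1)] t(2) level_stable[OF t(1) x]]
  by (simp add: qaut_inv_cancel(2)[OF t(1)])

lemma res_hom:
  assumes "t \<in> res A H" "H \<subseteq> qaut" shows "chom L t"
proof -
  obtain \<sigma> where s: "\<sigma> \<in> qaut" "\<And>x. x \<in> L \<Longrightarrow> t x = \<sigma> x" using resE[OF assms] by metis
  interpret h: chom Qbar \<sigma> by (rule qaut_chom[OF s(1)])
  show ?thesis
    using s(2) level_stable[OF s(1)] L_Qbar h.hom_add h.hom_mult h.hom_one add mult one
    by unfold_locales auto
qed

lemma rnorm_mult:
  assumes "H \<subseteq> qaut" "x \<in> L" "y \<in> L" shows "rnorm A H (x * y) = rnorm A H x * rnorm A H y"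
  unfolding rnorm_def using chom.hom_mult[OF res_hom[OF _ assms(1)] assms(2,3)] by (simp flip: prod.distrib)

lemma rnorm_one: "H \<subseteq> qaut \<Longrightarrow> rnorm A H 1 = 1"
  unfolding rnorm_def using chom.hom_one[OF res_hom] by (intro prod.neutral) auto

lemma rnorm_eq_0: "H \<subseteq> qaut \<Longrightarrow> x \<in> L \<Longrightarrow> rnorm A H x = 0 \<longleftrightarrow> x = 0 \<and> H \<noteq> {}"
  unfolding rnorm_def using chom.hom_eq_0_iff[OF res_hom] finite_res by (auto simp: res_def)

lemma rnorm_power: "H \<subseteq> qaut \<Longrightarrow> x \<in> L \<Longrightarrow> rnorm A H (x ^ n) = rnorm A H x ^ n"
  by (induction n) (simp_all add: rnorm_one rnorm_mult pow)

lemma rnorm_prod: "H \<subseteq> qaut \<Longrightarrow> (\<And>i. i \<in> I \<Longrightarrow> f i \<in> L) \<Longrightarrow> rnorm A H (prod f I) = (\<Prod>i\<in>I. rnorm A H (f i))"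
  by (induction I rule: infinite_finite_induct) (simp_all add: rnorm_one rnorm_mult prod)

lemma rnorm_fixes:
  assumes "H \<subseteq> qaut" "x \<in> L" "\<And>\<sigma>. \<sigma> \<in> H \<Longrightarrow> \<sigma> x = x" shows "rnorm A H x = x ^ card (res A H)"
proof -
  have "t x = x" if "t \<in> res A H" for t using that assms(2,3) by (auto simp: res_def)
  then have "(\<Prod>t\<in>res A H. t x) = (\<Prod>t\<in>res A H. x)" by (intro prod.cong) auto
  then show ?thesis by (simp add: rnorm_def)
qed

end

section \<open>Averaging over conjugates\<close>

definition avg :: "nat set \<Rightarrow> complex \<Rightarrow> real" where
  "avg Q x = (\<Sum>z\<in>conjs x. nrm Q z) / real (card (conjs x))"

text \<open>A double count over pairs of a restriction and a conjugate. Averaging over restrictions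
  lets two numbers in a common level be moved by the same automorphism, which is what subadditivity
  of \<open>avg\<close> requires; the conjugates of a product are not paired with those of its
  factors.\<close>

lemma (in finite_level) avg_eq:
  assumes x: "x \<in> L" shows "avg Q x = (\<Sum>t\<in>res A qaut. nrm Q (t x)) / real (card (res A qaut))"
proof -
  have xQ: "x \<in> Qbar" using L_Qbar[OF x] .
  have T: "card (res A qaut) > 0" by (rule res_nonempty[OF subgrp_qaut])
  have cx: "conjs x \<subseteq> L" using level_stable x by (auto simp: conjs_def)
  have "real (card (res A qaut)) * (\<Sum>z\<in>conjs x. nrm Q z) = (\<Sum>t\<in>res A qaut. \<Sum>z\<in>conjs x. nrm Q (t z))"
  proof -
    have "(\<Sum>z\<in>conjs x. nrm Q (t z)) = (\<Sum>z\<in>conjs x. nrm Q z)" if "t \<in> res A qaut" for t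
    proof -
      obtain \<sigma> where s: "\<sigma> \<in> qaut" "\<And>x. x \<in> L \<Longrightarrow> t x = \<sigma> x"
        using resE[OF \<open>t \<in> res A qaut\<close>] by blast
      have "(\<Sum>z\<in>conjs x. nrm Q (t z)) = (\<Sum>z\<in>conjs x. nrm Q (\<sigma> z))" using s(2) cx by (intro sum.cong) auto
      then show ?thesis using sum.reindex_bij_betw[OF conjs_perm[OF xQ s(1)], of "nrm Q"] by simp
    qed
    then show ?thesis by simp
  qed
  also have "\<dots> = (\<Sum>z\<in>conjs x. \<Sum>t\<in>res A qaut. nrm Q (t z))" by (rule sum.swap)
  also have "\<dots> = (\<Sum>z\<in>conjs x. \<Sum>t\<in>res A qaut. nrm Q (t x))"
  proof (rule sum.cong)
    fix z assume "z \<in> conjs x"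
    then show "(\<Sum>t\<in>res A qaut. nrm Q (t z)) = (\<Sum>t\<in>res A qaut. nrm Q (t x))"
      using sum_res_translate[OF _ x, of _ "nrm Q"] by (auto simp only: conjs_def)
  qed simp
  also have "\<dots> = real (card (conjs x)) * (\<Sum>t\<in>res A qaut. nrm Q (t x))" by simp
  finally show ?thesis using T card_conjs_pos[OF xQ] by (simp add: avg_def field_simps)
qed

lemma finite_level2: "x \<in> Qbar \<Longrightarrow> y \<in> Qbar \<Longrightarrow> finite_level {x, y}"
  by unfold_locales auto

context
  fixes Q :: "nat set" assumes Q: "finite Q" "Q \<subseteq> pindex"
begin

lemma nrm_mult_le:
  assumes "x \<in> Qbar" "x \<noteq> 0" "y \<in> Qbar" "y \<noteq> 0" shows "nrm Q (x * y) \<le> nrm Q x + nrm Q y"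
proof -
  have "\<bar>ln (qplace q (x * y))\<bar> \<le> \<bar>ln (qplace q x)\<bar> + \<bar>ln (qplace q y)\<bar>" if "q \<in> Q" for q
  proof -
    interpret absval Qbar "qplace q" using qplace_absval that Q by blast
    have "ln (qplace q (x * y)) = ln (qplace q x) + ln (qplace q y)"
      using assms v_pos by (simp add: v_mult ln_mult_pos)
    then show ?thesis by simp
  qed
  then show ?thesis unfolding nrm_def sum.distrib[symmetric] by (rule sum_mono)
qed

lemma nrm_power: "x \<in> Qbar \<Longrightarrow> x \<noteq> 0 \<Longrightarrow> nrm Q (x ^ n) = real n * nrm Q x"
  unfolding nrm_def sum_distrib_left
proof (rule sum.cong)
  fix q assume x: "x \<in> Qbar" "x \<noteq> 0" and q: "q \<in> Q"
  interpret absval Qbar "qplace q" using qplace_absval q Q by blast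
  show "\<bar>ln (qplace q (x ^ n))\<bar> = real n * \<bar>ln (qplace q x)\<bar>"
    using x v_pos by (simp add: v_power ln_realpow abs_mult)
qed simp

lemma nrm_inverse: "x \<in> Qbar \<Longrightarrow> nrm Q (inverse x) = nrm Q x"
  unfolding nrm_def
proof (rule sum.cong)
  fix q assume x: "x \<in> Qbar" and q: "q \<in> Q"
  interpret absval Qbar "qplace q" using qplace_absval q Q by blast
  show "\<bar>ln (qplace q (inverse x))\<bar> = \<bar>ln (qplace q x)\<bar>"
    using x v_nonneg[OF x] by (simp add: v_inverse ln_inverse)
qed simp

lemma avg_mult_le:
  assumes x: "x \<in> Qbar" "x \<noteq> 0" and y: "y \<in> Qbar" "y \<noteq> 0" shows "avg Q (x * y) \<le> avg Q x + avg Q y"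
proof -
  interpret finite_level "{x, y}" by (rule finite_level2[OF x(1) y(1)])
  have L: "x \<in> L" "y \<in> L" using A_level by auto
  have "nrm Q (t (x * y)) \<le> nrm Q (t x) + nrm Q (t y)" if "t \<in> res {x, y} qaut" for t
  proof -
    interpret t: chom L t by (rule res_hom[OF that]) simp
    show ?thesis using nrm_mult_le[of "t x" "t y"] L x y t.hom_in L_Qbar t.hom_mult t.hom_eq_0_iff by simp
  qed
  then have "(\<Sum>t\<in>res {x, y} qaut. nrm Q (t (x * y))) \<le>
      (\<Sum>t\<in>res {x, y} qaut. nrm Q (t x)) + (\<Sum>t\<in>res {x, y} qaut. nrm Q (t y))"
    unfolding sum.distrib[symmetric] by (rule sum_mono)
  then show ?thesis
    by (simp add: avg_eq L mult divide_right_mono flip: add_divide_distrib)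
qed

lemma avg_power:
  assumes x: "x \<in> Qbar" "x \<noteq> 0" shows "avg Q (x ^ n) = real n * avg Q x"
proof -
  interpret finite_level "{x, x}" by (rule finite_level2[OF x(1) x(1)])
  have L: "x \<in> L" using A_level by auto
  have "nrm Q (t (x ^ n)) = real n * nrm Q (t x)" if "t \<in> res {x, x} qaut" for t
  proof -
    interpret t: chom L t by (rule res_hom[OF that]) simp
    show ?thesis using nrm_power[of "t x"] L x t.hom_in L_Qbar t.hom_power t.hom_eq_0_iff by simp
  qed
  then show ?thesis by (simp add: avg_eq[OF L] avg_eq[OF pow[OF L]] sum_distrib_left)
qed

lemma avg_inverse:
  assumes x: "x \<in> Qbar" shows "avg Q (inverse x) = avg Q x"
proof -
  interpret finite_level "{x, x}" by (rule finite_level2[OF x(1) x(1)])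
  have L: "x \<in> L" using A_level by auto
  have "nrm Q (t (inverse x)) = nrm Q (t x)" if "t \<in> res {x, x} qaut" for t
  proof -
    interpret t: chom L t by (rule res_hom[OF that]) simp
    show ?thesis using nrm_inverse[of "t x"] L t.hom_in L_Qbar t.hom_inverse by simp
  qed
  then show ?thesis by (simp add: avg_eq[OF L] avg_eq[OF inv[OF L]])
qed

lemma avg_conj: "\<sigma> \<in> qaut \<Longrightarrow> avg Q (\<sigma> x) = avg Q x"
proof -
  assume s: "\<sigma> \<in> qaut"
  have "conjs (\<sigma> x) = conjs x"
  proof
    show "conjs (\<sigma> x) \<subseteq> conjs x"
      using qaut_comp[OF _ s] unfolding conjs_def by (auto intro!: image_eqI[of _ _ "_ \<circ> \<sigma>"])
    have "\<tau> x = (\<tau> \<circ> inv \<sigma>) (\<sigma> x)" for \<tau> using qaut_inv_cancel(2)[OF s] by simp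
    then show "conjs x \<subseteq> conjs (\<sigma> x)"
      using qaut_comp[OF _ qaut_inv[OF s]] unfolding conjs_def by blast
  qed
  then show ?thesis by (simp add: avg_def)
qed

lemma avg_one: "avg Q 1 = 0"
  using avg_power[OF Qb.one, of 0] by simp

lemma avg_prod_le:
  "finite I \<Longrightarrow> (\<And>i. i \<in> I \<Longrightarrow> f i \<in> Qbar \<and> f i \<noteq> 0) \<Longrightarrow> avg Q (prod f I) \<le> (\<Sum>i\<in>I. avg Q (f i))"
proof (induction I rule: finite_induct)
  case (insert i I)
  then have "avg Q (f i * prod f I) \<le> avg Q (f i) + avg Q (prod f I)"
    by (intro avg_mult_le Qb.prod) auto
  then show ?case using insert by fastforce
qed (simp add: avg_one)

lemma avg_rnorm_le:
  assumes "finite_level A" "H \<subseteq> qaut" "x \<in> level A" "x \<noteq> 0"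
  shows "avg Q (rnorm A H x) \<le> real (card (res A H)) * avg Q x"
proof -
  interpret finite_level A by fact
  have t: "t x \<in> Qbar \<and> t x \<noteq> 0 \<and> avg Q (t x) = avg Q x" if "t \<in> res A H" for t
  proof -
    interpret t: chom L t by (rule res_hom[OF that assms(2)])
    obtain \<sigma> where "\<sigma> \<in> qaut" "t x = \<sigma> x"
      using resE[OF \<open>t \<in> res A H\<close> assms(2)] assms(3) by metis
    then show ?thesis using t.hom_in[OF assms(3)] L_Qbar t.hom_eq_0_iff[OF assms(3)] assms(4) avg_conj by simp
  qed
  have "avg Q (rnorm A H x) \<le> (\<Sum>t\<in>res A H. avg Q (t x))"
    unfolding rnorm_def using t finite_res[OF assms(2)] by (intro avg_prod_le) auto
  then show ?thesis using t by simp
qed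

lemma avg_le_weil_height: "y \<in> Qbar \<Longrightarrow> y \<noteq> 0 \<Longrightarrow> avg Q y \<le> 2 * weil_height y"
  unfolding avg_def using nrm_conjs_le_weil_height Q by blast

end

text \<open>Taking singletons for \<open>Q\<close>, a sum of nonnegative terms vanishes, so every
  conjugate has absolute value 1 at every place.\<close>

lemma avg_zero_imp_root_of_unity:
  assumes x: "x \<in> Qbar" "x \<noteq> 0" and zero: "\<And>Q. finite Q \<Longrightarrow> Q \<subseteq> pindex \<Longrightarrow> avg Q x \<le> 0"
  shows "\<exists>k>0. x ^ k = 1"
proof (rule kronecker[OF x(1)])
  fix q z assume q: "q \<in> pindex" and z: "z \<in> conjs x"
  obtain \<sigma> where s: "\<sigma> \<in> qaut" "z = \<sigma> x" using z by (auto simp: conjs_def)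
  interpret chom Qbar \<sigma> by (rule qaut_chom[OF s(1)])
  interpret w: absval Qbar "qplace q" by (rule qplace_absval[OF q])
  have zQ: "z \<in> Qbar" "z \<noteq> 0" using s x hom_in hom_eq_0_iff by auto
  have "(\<Sum>z\<in>conjs x. nrm {q} z) \<le> 0"
    using zero[of "{q}"] q card_conjs_pos[OF x(1)] by (simp add: avg_def divide_le_0_iff)
  moreover have "(\<Sum>z\<in>conjs x. nrm {q} z) \<ge> 0" by (intro sum_nonneg) (simp add: nrm_def)
  ultimately have "(\<Sum>z\<in>conjs x. nrm {q} z) = 0" by linarith
  then have "nrm {q} z = 0"
    using z finite_conjs[OF x(1)] by (subst (asm) sum_nonneg_eq_0_iff) (auto simp: nrm_def)
  then have "ln (qplace q z) = 0" by (simp add: nrm_def)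
  then show "qplace q z = 1" using w.v_pos[OF zQ] by simp
qed

section \<open>Killing the given fields\<close>

lemma mult_group_product_mult:
  assumes "\<And>i. i \<in> {1..n} \<Longrightarrow> is_subfield (K i)"
    and "x \<in> mult_group_product n K" "y \<in> mult_group_product n K"
  shows "x * y \<in> mult_group_product n K"
proof -
  obtain b c where "x = (\<Prod>i=1..n. b i)" "y = (\<Prod>i=1..n. c i)"
    and bc: "\<forall>i\<in>{1..n}. b i \<in> K i - {0}" "\<forall>i\<in>{1..n}. c i \<in> K i - {0}"
    using assms(2,3) unfolding mult_group_product_def by blast
  then have "x * y = (\<Prod>i=1..n. b i * c i)" by (simp add: prod.distrib)
  moreover have "\<forall>i\<in>{1..n}. b i * c i \<in> K i - {0}"
    using bc cfield.mult[OF cfieldI[OF assms(1)]] by auto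
  ultimately show ?thesis unfolding mult_group_product_def by blast
qed

lemma mult_group_product_one:
  assumes "\<And>i. i \<in> {1..n} \<Longrightarrow> is_subfield (K i)" shows "1 \<in> mult_group_product n K"
  unfolding mult_group_product_def using cfield.one[OF cfieldI[OF assms]]
  by (auto intro!: exI[of _ "\<lambda>_. 1"])

lemma mult_group_product_power:
  assumes "\<And>i. i \<in> {1..n} \<Longrightarrow> is_subfield (K i)" "x \<in> mult_group_product n K"
  shows "x ^ k \<in> mult_group_product n K"
proof (induction k)
  case 0
  show ?case using mult_group_product_one[OF assms(1)] by simp
next
  case (Suc k)
  show ?case using mult_group_product_mult[OF assms(1) assms(2) Suc] by simp
qed

lemma mult_group_product_inverse:
  assumes "\<And>i. i \<in> {1..n} \<Longrightarrow> is_subfield (K i)" "x \<in> mult_group_product n K"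
  shows "inverse x \<in> mult_group_product n K"
proof -
  obtain b where b: "x = (\<Prod>i=1..n. b i)" "\<forall>i\<in>{1..n}. b i \<in> K i - {0}"
    using assms(2) unfolding mult_group_product_def by blast
  then have "inverse x = (\<Prod>i=1..n. inverse (b i))" by (simp add: prod_inversef[symmetric])
  moreover have "\<forall>i\<in>{1..n}. inverse (b i) \<in> K i - {0}"
    using b(2) cfield.inv[OF cfieldI[OF assms(1)]] by auto
  ultimately show ?thesis unfolding mult_group_product_def by blast
qed

text \<open>\<open>kill A F\<close> is a homomorphism that is trivial on \<open>F\<close> and, up to elements of \<open>F\<close>, is a power
  map.\<close>

definition kill :: "complex set \<Rightarrow> complex set \<Rightarrow> complex \<Rightarrow> complex" where
  "kill A F x = x ^ card (res A (fixer F)) / rnorm A (fixer F) x"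

lemma fixer_subset: "fixer F \<subseteq> qaut"
  by (auto simp: fixer_def)

context finite_level
begin

lemma rnorm_nz: "x \<in> L \<Longrightarrow> x \<noteq> 0 \<Longrightarrow> rnorm A (fixer F) x \<noteq> 0"
  using rnorm_eq_0[OF fixer_subset] by simp

lemma rnorm_L: "x \<in> L \<Longrightarrow> rnorm A (fixer F) x \<in> L"
  using rnorm_hom(1)[OF fixer_subset _ qaut_id] .

lemma rnorm_mem:
  assumes "is_subfield F" "F \<subseteq> Qbar" "x \<in> L" shows "rnorm A (fixer F) x \<in> F"
proof (rule fixed_imp_mem[OF assms(1,2)])
  show "rnorm A (fixer F) x \<in> Qbar" using L_Qbar[OF rnorm_L[OF assms(3)]] .
  fix \<sigma> assume "\<sigma> \<in> qaut" "\<And>a. a \<in> F \<Longrightarrow> \<sigma> a = a"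
  then have "\<sigma> \<in> fixer F" by (simp add: fixer_def)
  then show "\<sigma> (rnorm A (fixer F) x) = rnorm A (fixer F) x"
    using rnorm_fixed[OF subgrp_fixer assms(3)] by blast
qed

lemma kill_L: "x \<in> L \<Longrightarrow> kill A F x \<in> L"
  unfolding kill_def using rnorm_L by (intro div pow)

lemma kill_nz: "x \<in> L \<Longrightarrow> x \<noteq> 0 \<Longrightarrow> kill A F x \<noteq> 0"
  unfolding kill_def using rnorm_nz by simp

lemma kill_mult: "x \<in> L \<Longrightarrow> y \<in> L \<Longrightarrow> kill A F (x * y) = kill A F x * kill A F y"
  unfolding kill_def using rnorm_mult[OF fixer_subset] by (simp add: power_mult_distrib)

lemma kill_power_eq: "x \<in> L \<Longrightarrow> x \<noteq> 0 \<Longrightarrow>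
    x ^ card (res A (fixer F)) = kill A F x * rnorm A (fixer F) x"
  unfolding kill_def using rnorm_nz by simp

lemma kill_eq_1: "x \<in> L \<Longrightarrow> x \<noteq> 0 \<Longrightarrow> x \<in> F \<Longrightarrow> kill A F x = 1"
proof -
  assume x: "x \<in> L" "x \<noteq> 0" "x \<in> F"
  have "rnorm A (fixer F) x = x ^ card (res A (fixer F))"
    by (rule rnorm_fixes[OF fixer_subset x(1)]) (use x(3) in \<open>simp add: fixer_def\<close>)
  then show ?thesis using x(2) by (simp add: kill_def)
qed

text \<open>The power and the norm in \<open>kill\<close> each contribute the number of restrictions
  once, whence the factor 2.\<close>

lemma avg_kill_le:
  assumes Q: "finite Q" "Q \<subseteq> pindex" and x: "x \<in> L" "x \<noteq> 0"
  shows "avg Q (kill A F x) \<le> 2 * real (card (res A (fixer F))) * avg Q x"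
proof -
  let ?T = "card (res A (fixer F))"
  let ?n = "rnorm A (fixer F) x"
  have nQ: "?n \<in> Qbar" "?n \<noteq> 0" using rnorm_nz rnorm_L L_Qbar x by auto
  have xQ: "x ^ ?T \<in> Qbar" "x ^ ?T \<noteq> 0" using x L_Qbar[OF x(1)] by (auto intro: Qb.pow)
  have "avg Q (kill A F x) \<le> avg Q (x ^ ?T) + avg Q (inverse ?n)"
    unfolding kill_def divide_inverse using nQ xQ by (intro avg_mult_le[OF Q]) (auto intro: Qb.inv)
  moreover have "avg Q (x ^ ?T) = real ?T * avg Q x" using avg_power[OF Q L_Qbar[OF x(1)] x(2)] .
  moreover have "avg Q (inverse ?n) = avg Q ?n" using avg_inverse[OF Q nQ(1)] .
  moreover have "avg Q ?n \<le> real ?T * avg Q x"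
    by (rule avg_rnorm_le[OF Q finite_level_axioms fixer_subset x])
  ultimately show ?thesis by simp
qed

text \<open>The Galois hypothesis makes the norm from \<open>F\<close> preserve \<open>F'\<close>: either every automorphism over
  \<open>F\<close> maps \<open>F'\<close> to itself, or the automorphisms over \<open>F'\<close> normalise those over \<open>F\<close>.\<close>

lemma rnorm_preserves:
  assumes F: "is_subfield F" "F \<subseteq> Qbar" and F': "is_subfield F'" "F' \<subseteq> Qbar"
    and gal: "galois_extension F (F \<inter> F') \<or> galois_extension F' (F \<inter> F')"
    and x: "x \<in> L" "x \<in> F'"
  shows "rnorm A (fixer F) x \<in> F'"
  using gal
proof
  interpret F': cfield F' by (rule cfieldI[OF F'(1)])
  assume gal: "galois_extension F' (F \<inter> F')"
  have "t x \<in> F'" if "t \<in> res A (fixer F)" for t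
  proof -
    obtain \<sigma> where s: "\<sigma> \<in> fixer F" "t x = \<sigma> x"
      using resE[OF \<open>t \<in> res A (fixer F)\<close> fixer_subset] x(1) by metis
    then show ?thesis using galois_extension_normal[OF gal F'(2), of \<sigma> x] x(2) by (simp add: fixer_def)
  qed
  then show ?thesis unfolding rnorm_def by (rule F'.prod)
next
  assume gal: "galois_extension F (F \<inter> F')"
  show ?thesis
  proof (rule fixed_imp_mem[OF F'])
    show "rnorm A (fixer F) x \<in> Qbar" using L_Qbar[OF rnorm_L[OF x(1)]] .
    fix \<tau> assume t: "\<tau> \<in> qaut" "\<And>a. a \<in> F' \<Longrightarrow> \<tau> a = a"
    have it: "inv \<tau> \<in> qaut" "\<And>a. a \<in> F' \<Longrightarrow> inv \<tau> a = a"
      using qaut_inv[OF t(1)] qaut_inv_cancel(2)[OF t(1)] t(2) by auto metis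
    have "\<tau> \<circ> \<sigma> \<circ> inv \<tau> \<in> fixer F" if s: "\<sigma> \<in> fixer F" for \<sigma>
    proof -
      have "\<tau> (\<sigma> (inv \<tau> a)) = a" if "a \<in> F" for a
      proof -
        have "inv \<tau> a \<in> F" by (rule galois_extension_normal[OF gal F(2) it(1) it(2) that]) simp
        then show ?thesis using s qaut_inv_cancel(1)[OF t(1)] by (simp add: fixer_def)
      qed
      then show ?thesis using s t(1) it(1) by (auto simp: fixer_def intro: qaut_comp)
    qed
    then have "\<tau> (rnorm A (fixer F) x) = rnorm A (fixer F) (\<tau> x)"
      by (rule rnorm_commute[OF fixer_subset t(1) _ x(1)])
    then show "\<tau> (rnorm A (fixer F) x) = rnorm A (fixer F) x" using t(2)[OF x(2)] by simp
  qed
qed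

end

section \<open>The composite over all given fields\<close>

primrec kills :: "complex set \<Rightarrow> (nat \<Rightarrow> complex set) \<Rightarrow> nat \<Rightarrow> complex \<Rightarrow> complex" where
  "kills A K 0 x = x"
| "kills A K (Suc n) x = kill A (K (Suc n)) (kills A K n x)"

locale field_family =
  fixes N :: nat and K :: "nat \<Rightarrow> complex set"
  assumes sub: "n \<in> {1..N} \<Longrightarrow> is_subfield (K n)" and KQ: "n \<in> {1..N} \<Longrightarrow> K n \<subseteq> Qbar"
    and gal: "i \<in> {1..N} \<Longrightarrow> j \<in> {1..N} \<Longrightarrow> i \<noteq> j \<Longrightarrow>
      galois_extension (K i) (K i \<inter> K j) \<or> galois_extension (K j) (K i \<inter> K j)"

locale level_family = finite_level A + field_family N K for A N K
begin

lemma kills_L: "x \<in> L \<Longrightarrow> kills A K n x \<in> L"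
  by (induction n) (simp_all add: kill_L)

lemma kills_nz: "x \<in> L \<Longrightarrow> x \<noteq> 0 \<Longrightarrow> kills A K n x \<noteq> 0"
  by (induction n) (simp_all add: kill_nz kills_L)

lemma kills_mult: "x \<in> L \<Longrightarrow> y \<in> L \<Longrightarrow> kills A K n (x * y) = kills A K n x * kills A K n y"
  by (induction n) (simp_all add: kill_mult kills_L)

lemma kills_one: "kills A K n 1 = 1"
proof -
  have "kills A K n 1 * kills A K n 1 = kills A K n 1" using kills_mult[OF one one, of n] by simp
  then show ?thesis using kills_nz[OF one, of n] by simp
qed

lemma kills_power: "x \<in> L \<Longrightarrow> kills A K n (x ^ k) = kills A K n x ^ k"
  by (induction k) (simp_all add: kills_one kills_mult pow)

lemma kills_prod: "(\<And>i. i \<in> I \<Longrightarrow> f i \<in> L) \<Longrightarrow> kills A K n (prod f I) = (\<Prod>i\<in>I. kills A K n (f i))"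
  by (induction I rule: infinite_finite_induct) (simp_all add: kills_one kills_mult prod)

lemma kill_preserves:
  assumes "i \<in> {1..N}" "j \<in> {1..N}" and x: "x \<in> L" "x \<noteq> 0" "x \<in> K j"
  shows "kill A (K i) x \<in> K j"
proof -
  interpret Kj: cfield "K j" by (rule cfieldI[OF sub[OF assms(2)]])
  show ?thesis
  proof (cases "i = j")
    case True
    then show ?thesis using kill_eq_1[OF x] Kj.one by simp
  next
    case False
    have "rnorm A (fixer (K i)) x \<in> K j"
      using rnorm_preserves[OF sub[OF assms(1)] KQ[OF assms(1)] sub[OF assms(2)] KQ[OF assms(2)] gal[OF assms(1,2) False] x(1,3)] .
    then show ?thesis unfolding kill_def using x(3) by (intro Kj.div Kj.pow)
  qed
qed

lemma kills_preserves:
  assumes "j \<in> {1..N}" "x \<in> L" "x \<noteq> 0" "x \<in> K j"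
  shows "n \<le> N \<Longrightarrow> kills A K n x \<in> K j"
proof (induction n)
  case (Suc n)
  then show ?case using kill_preserves[of "Suc n" j] kills_L kills_nz assms by simp
qed (use assms in simp)

text \<open>Up to step \<open>j - 1\<close> the element stays in \<open>K j\<close> by
  \<open>kills_preserves\<close>; step \<open>j\<close> sends it to 1, and all later steps fix
  1.\<close>

lemma kills_eq_1:
  assumes "x \<in> L" "x \<noteq> 0" "x \<in> K j" "j \<ge> 1"
  shows "j \<le> n \<Longrightarrow> n \<le> N \<Longrightarrow> kills A K n x = 1"
proof (induction n)
  case (Suc n)
  show ?case
  proof (cases "j = Suc n")
    case True
    then have "kills A K n x \<in> K (Suc n)" using kills_preserves[of j x n] assms Suc.prems by simp
    then show ?thesis using kill_eq_1 kills_L kills_nz assms by simp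
  next
    case False
    then have "kills A K n x = 1" using Suc by simp
    then show ?thesis using kills_one[of "Suc n"] kills_one[of n] by simp
  qed
qed (use assms in simp)

text \<open>Each step costs a power \<open>T\<close> and one norm, which lies in the field of that
  step. The factors collected earlier are raised to the power \<open>T\<close> and remain in their
  own fields.\<close>

lemma kills_power_eq:
  assumes "x \<in> L" "x \<noteq> 0"
  shows "n \<le> N \<Longrightarrow> \<exists>M>0. \<exists>k\<in>mult_group_product n K. x ^ M = kills A K n x * k"
proof (induction n)
  case 0
  have "1 \<in> mult_group_product 0 K" by (auto simp: mult_group_product_def)
  then show ?case by (intro exI[of _ 1]) auto
next
  case (Suc n)
  then obtain M k where M: "M > 0" "k \<in> mult_group_product n K" "x ^ M = kills A K n x * k" by auto
  have i: "Suc n \<in> {1..N}" using Suc.prems by simp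
  define T where "T = card (res A (fixer (K (Suc n))))"
  define z where "z = kills A K n x"
  define r where "r = rnorm A (fixer (K (Suc n))) z"
  have z: "z \<in> L" "z \<noteq> 0" unfolding z_def using kills_L kills_nz assms by auto
  have r: "r \<in> K (Suc n) - {0}"
    unfolding r_def using rnorm_mem[OF sub[OF i] KQ[OF i] z(1)] rnorm_nz[OF z] by simp
  have T: "T > 0" unfolding T_def by (rule res_nonempty[OF subgrp_fixer])
  obtain b where b: "k = (\<Prod>i=1..n. b i)" "\<forall>i\<in>{1..n}. b i \<in> K i - {0}"
    using M(2) unfolding mult_group_product_def by blast
  define c where "c i = (if i = Suc n then r else b i ^ T)" for i
  have "(\<Prod>i=1..Suc n. c i) = (\<Prod>i=1..n. b i ^ T) * r"
    by (simp add: c_def)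
  also have "\<dots> = k ^ T * r" by (simp add: b(1) prod_power_distrib)
  finally have cr: "k ^ T * r = (\<Prod>i=1..Suc n. c i)" ..
  have "c i \<in> K i - {0}" if i: "i \<in> {1..Suc n}" for i
  proof (cases "i = Suc n")
    case False
    then have "i \<in> {1..n}" "i \<in> {1..N}" using i Suc.prems by auto
    then show ?thesis using b(2) False cfield.pow[OF cfieldI[OF sub]] by (auto simp: c_def)
  qed (use r in \<open>simp add: c_def\<close>)
  then have "k ^ T * r \<in> mult_group_product (Suc n) K" unfolding mult_group_product_def cr by blast
  moreover have "x ^ (M * T) = kills A K (Suc n) x * (k ^ T * r)"
  proof -
    have "x ^ (M * T) = z ^ T * k ^ T" by (simp add: power_mult M(3) z_def power_mult_distrib)
    also have "z ^ T = kill A (K (Suc n)) z * r" unfolding T_def r_def using kill_power_eq[OF z] .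
    finally show ?thesis by (simp add: z_def mult_ac)
  qed
  ultimately show ?case using M(1) T by (metis nat_0_less_mult_iff)
qed

text \<open>The order of quantifiers is the point: \<open>C\<close> depends on the level and the
  fields alone, while \<open>Q\<close> and \<open>x\<close> vary in the final estimate.\<close>

lemma avg_kills_le:
  "\<exists>C\<ge>0. \<forall>Q x. finite Q \<longrightarrow> Q \<subseteq> pindex \<longrightarrow> x \<in> L \<longrightarrow> x \<noteq> 0 \<longrightarrow> avg Q (kills A K n x) \<le> C * avg Q x"
proof (induction n)
  case (Suc n)
  then obtain C where C: "C \<ge> 0" "\<And>Q x. finite Q \<Longrightarrow> Q \<subseteq> pindex \<Longrightarrow> x \<in> L \<Longrightarrow> x \<noteq> 0 \<Longrightarrow>
      avg Q (kills A K n x) \<le> C * avg Q x" by blast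
  define T where "T = 2 * real (card (res A (fixer (K (Suc n)))))"
  have "avg Q (kills A K (Suc n) x) \<le> T * C * avg Q x"
    if Q: "finite Q" "Q \<subseteq> pindex" and x: "x \<in> L" "x \<noteq> 0" for Q x
  proof -
    have "avg Q (kills A K (Suc n) x) \<le> T * avg Q (kills A K n x)"
      unfolding T_def using avg_kill_le[OF Q kills_L[OF x(1)] kills_nz[OF x]] by simp
    also have "\<dots> \<le> T * (C * avg Q x)" using C(2)[OF Q x] by (intro mult_left_mono) (simp_all add: T_def)
    finally show ?thesis by (simp add: mult_ac)
  qed
  then show ?case using C(1) by (intro exI[of _ "T * C"]) (auto simp: T_def)
qed (auto intro!: exI[of _ 1])

text \<open>The norm to the level of \<open>A\<close> from a larger level turns any \<open>\<gamma>\<close> with a power in the product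
  of the \<open>K n\<close> into an element that \<open>kills\<close> annihilates up to torsion.\<close>

lemma avg_kills_le_quotient:
  assumes a: "\<alpha> \<in> A" "\<alpha> \<noteq> 0" and g: "\<gamma> \<in> Qbar" "\<gamma> \<noteq> 0"
    and m: "m > 0" "\<gamma> ^ m \<in> mult_group_product N K"
    and Q: "finite Q" "Q \<subseteq> pindex"
    and C: "C \<ge> 0" "\<And>x. x \<in> L \<Longrightarrow> x \<noteq> 0 \<Longrightarrow> avg Q (kills A K N x) \<le> C * avg Q x"
  shows "avg Q (kills A K N \<alpha>) \<le> C * avg Q (\<alpha> / \<gamma>)"
proof -
  obtain b where b: "\<gamma> ^ m = (\<Prod>i=1..N. b i)" "\<forall>i\<in>{1..N}. b i \<in> K i - {0}"
    using m(2) unfolding mult_group_product_def by blast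
  \<comment> \<open>The larger level must hold \<open>\<gamma>\<close> and also the factors of
    \<open>\<gamma> ^ m\<close>, since the norm is taken of each factor separately.\<close>
  define B where "B = insert \<gamma> (A \<union> b ` {1..N})"
  have "b i \<in> Qbar" if "i \<in> {1..N}" for i using b(2) KQ that by blast
  then have "finite_level B"
    using fin A_sub g(1) by unfold_locales (auto simp: B_def)
  then interpret B: finite_level B .
  \<comment> \<open>With this choice \<open>rnorm B U\<close> takes values fixed by all of
    \<open>fixer S\<close>, that is, in the level of \<open>A\<close>, where \<open>kills\<close> is
    available.\<close>
  define U where "U = fixer S"
  have U: "U \<subseteq> qaut" "subgrp U" unfolding U_def by (rule fixer_subset, rule subgrp_fixer)
  have aL: "\<alpha> \<in> L" using a(1) A_level by blast
  have inB: "\<alpha> \<in> level B" "\<gamma> \<in> level B" "\<And>i. i \<in> {1..N} \<Longrightarrow> b i \<in> level B"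
    using B.A_level a(1) by (auto simp: B_def)
  define n where "n = rnorm B U"
  define u where "u = card (res B U)"
  have u: "u > 0" unfolding u_def by (rule B.res_nonempty[OF U(2)])
  have nL: "n x \<in> L" if x: "x \<in> level B" for x
    using B.rnorm_fixed[OF U(2) x] B.L_Qbar[OF B.rnorm_hom(1)[OF U(1) x qaut_id]]
    by (simp add: level_def n_def U_def)
  have nz: "n x \<noteq> 0" if "x \<in> level B" "x \<noteq> 0" for x
    using B.rnorm_eq_0[OF U(1) that(1)] that(2) by (simp add: n_def)
  \<comment> \<open>The set \<open>orbs A\<close> is stable under all automorphisms, so
    \<open>U\<close> is stable under conjugation and the norm commutes with every automorphism over
    \<open>K i\<close>; hence it maps \<open>b i\<close> to an element fixed by all of
    these.\<close>
  have nK: "n (b i) \<in> K i" if i: "i \<in> {1..N}" for i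
  proof (rule fixed_imp_mem[OF sub[OF i] KQ[OF i]])
    show "n (b i) \<in> Qbar" using nL[OF inB(3)[OF i]] L_Qbar by blast
    fix \<sigma> assume s: "\<sigma> \<in> qaut" "\<And>a. a \<in> K i \<Longrightarrow> \<sigma> a = a"
    have "\<sigma> \<circ> \<tau> \<circ> inv \<sigma> \<in> U" if t: "\<tau> \<in> U" for \<tau>
      using normalizes[OF qaut_inv[OF s(1)] t[unfolded U_def]] qaut_bij[OF s(1)]
      by (simp add: U_def inv_inv_eq)
    then have "\<sigma> (n (b i)) = n (\<sigma> (b i))"
      unfolding n_def by (rule B.rnorm_commute[OF U(1) s(1) _ inB(3)[OF i]])
    then show "\<sigma> (n (b i)) = n (b i)" using s(2) b(2) i by simp
  qed
  define y where "y = \<alpha> / \<gamma>"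
  have y: "y \<in> level B" "y \<noteq> 0" unfolding y_def using inB a(2) g(2) by (auto intro: B.div)
  define E where "E = kills A K N"
  have "n (\<gamma> ^ m) = (\<Prod>i=1..N. n (b i))"
    unfolding b(1) n_def using inB(3) by (intro B.rnorm_prod[OF U(1)])
  moreover have "E (\<Prod>i=1..N. n (b i)) = (\<Prod>i=1..N. E (n (b i)))"
    unfolding E_def by (rule kills_prod, rule nL, rule inB(3))
  moreover have "E (n (b i)) = 1" if i: "i \<in> {1..N}" for i
    unfolding E_def using kills_eq_1[OF nL[OF inB(3)[OF i]] nz[OF inB(3)[OF i]] nK[OF i]] i b(2) by auto
  ultimately have Eg: "E (n (\<gamma> ^ m)) = 1" by simp
  have "n \<alpha> = \<alpha> ^ u"
    unfolding n_def u_def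
  proof (rule B.rnorm_fixes[OF U(1) inB(1)])
    show "\<sigma> \<alpha> = \<alpha>" if "\<sigma> \<in> U" for \<sigma> using that aL by (simp add: U_def level_def)
  qed
  then have "n (\<alpha> ^ m) = \<alpha> ^ (u * m)"
    unfolding n_def using B.rnorm_power[OF U(1) inB(1)] by (simp add: power_mult)
  moreover have "\<alpha> ^ m = y ^ m * \<gamma> ^ m" using g(2) by (simp add: y_def power_divide)
  then have "n (\<alpha> ^ m) = n y ^ m * n (\<gamma> ^ m)"
    unfolding n_def using B.rnorm_mult[OF U(1) B.pow[OF y(1)] B.pow[OF inB(2)]] B.rnorm_power[OF U(1) y(1)] by simp
  ultimately have "E (\<alpha> ^ (u * m)) = E (n y ^ m * n (\<gamma> ^ m))" by simp
  also have "\<dots> = E (n y) ^ m * E (n (\<gamma> ^ m))"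
    unfolding E_def using kills_mult[OF pow[OF nL[OF y(1)]] nL[OF B.pow[OF inB(2)]]] kills_power[OF nL[OF y(1)]] by simp
  finally have eq: "E \<alpha> ^ (u * m) = E (n y) ^ m" using Eg kills_power[OF aL] by (simp add: E_def)
  have EQ: "E \<alpha> \<in> Qbar" "E \<alpha> \<noteq> 0" "E (n y) \<in> Qbar" "E (n y) \<noteq> 0"
    unfolding E_def using kills_L kills_nz nL nz aL a(2) y L_Qbar by auto
  have "real (u * m) * avg Q (E \<alpha>) = real m * avg Q (E (n y))"
    using avg_power[OF Q EQ(1,2), of "u * m"] avg_power[OF Q EQ(3,4), of m] eq by metis
  also have "\<dots> \<le> real m * (C * avg Q (n y))"
    unfolding E_def using C(2)[OF nL[OF y(1)] nz[OF y]] by (intro mult_left_mono) auto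
  \<comment> \<open>The norm costs the factor \<open>u\<close>, which equals the exponent to which
    it raised \<open>\<alpha>\<close>. The two cancel at the end, so the size of the larger level
    leaves no trace in the bound.\<close>
  also have "\<dots> \<le> real m * (C * (real u * avg Q y))"
    using C(1) avg_rnorm_le[OF Q B.finite_level_axioms U(1) y] unfolding n_def u_def
    by (intro mult_left_mono) auto
  also have "\<dots> = real (u * m) * (C * avg Q y)" by simp
  finally show ?thesis using u m(1) by (simp add: E_def y_def)
qed

end

theorem theorem1p3:
  fixes N :: nat and K :: "nat \<Rightarrow> complex set"
    and \<alpha> :: complex and \<Gamma> :: "complex set"
  assumes "1 \<le> N"
    and "\<And>n. n \<in> {1..N} \<Longrightarrow> is_subfield (K n) \<and> \<rat> \<subseteq> K n \<and> K n \<subseteq> Qbar"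
    and "\<And>n1 n2. n1 \<in> {1..N} \<Longrightarrow> n2 \<in> {1..N} \<Longrightarrow> n1 \<noteq> n2 \<Longrightarrow>
           galois_extension (K n1) (K n1 \<inter> K n2) \<or> galois_extension (K n2) (K n1 \<inter> K n2)"
    and "\<alpha> \<in> Qbar" and "\<alpha> \<noteq> 0"
    and "\<Gamma> = {\<gamma> \<in> Qbar - {0}. \<exists>m::int. m \<noteq> 0 \<and> \<gamma> powi m \<in> mult_group_product N K}"
  shows "relative_height \<Gamma> \<alpha> = 0 \<longleftrightarrow> \<alpha> \<in> \<Gamma>"
proof
  have sub: "\<And>i. i \<in> {1..N} \<Longrightarrow> is_subfield (K i)" using assms(2) by blast
  have bdd: "bdd_below ((\<lambda>\<gamma>. weil_height (\<alpha> / \<gamma>)) ` \<Gamma>)"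
    using weil_height_nonneg by (intro bdd_belowI[of _ 0]) auto
  have "1 \<in> \<Gamma>" unfolding assms(6) using mult_group_product_one[of N K, OF sub] Qb.one
    by (auto intro!: exI[of _ 1])
  then have ne: "\<Gamma> \<noteq> {}" by blast
  {
    assume a: "\<alpha> \<in> \<Gamma>"
    have "relative_height \<Gamma> \<alpha> \<le> weil_height (\<alpha> / \<alpha>)"
      unfolding relative_height_def using a bdd by (intro cINF_lower)
    also have "\<dots> = 0" using assms(5) weil_height_one by simp
    finally have "relative_height \<Gamma> \<alpha> \<le> 0" .
    moreover have "relative_height \<Gamma> \<alpha> \<ge> 0"
      unfolding relative_height_def using ne weil_height_nonneg by (intro cINF_greatest)
    ultimately show "relative_height \<Gamma> \<alpha> = 0" by simp
  }
  assume height_0: "relative_height \<Gamma> \<alpha> = 0"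
  interpret level_family "{\<alpha>}" N K
    using assms(2-4) by unfold_locales auto
  have aL: "\<alpha> \<in> L" using A_level by simp
  define E where "E = kills {\<alpha>} K N \<alpha>"
  have E: "E \<in> Qbar" "E \<noteq> 0" unfolding E_def using kills_L[OF aL] kills_nz[OF aL assms(5)] L_Qbar by auto
  obtain C where C: "C \<ge> 0" "\<And>Q x. finite Q \<Longrightarrow> Q \<subseteq> pindex \<Longrightarrow> x \<in> L \<Longrightarrow> x \<noteq> 0 \<Longrightarrow>
      avg Q (kills {\<alpha>} K N x) \<le> C * avg Q x" using avg_kills_le[of N] by blast
  have "avg Q E \<le> 0" if Q: "finite Q" "Q \<subseteq> pindex" for Q
  proof (rule field_le_epsilon)
    fix e :: real assume e: "e > 0"
    \<comment> \<open>Chosen so that \<open>C * (2 * d)\<close> stays below \<open>e\<close>; the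
      summand 1 keeps the denominator positive when \<open>C\<close> is 0.\<close>
    define d where "d = e / (2 * C + 1)"
    have d: "d > 0" using e C(1) by (simp add: d_def)
    then have "(INF \<gamma>\<in>\<Gamma>. weil_height (\<alpha> / \<gamma>)) < d" using height_0 by (simp add: relative_height_def)
    then obtain \<gamma> where g: "\<gamma> \<in> \<Gamma>" "weil_height (\<alpha> / \<gamma>) < d"
      using cINF_less_iff[OF ne bdd] by blast
    have gQ: "\<gamma> \<in> Qbar" "\<gamma> \<noteq> 0" using g(1) by (auto simp: assms(6))
    obtain m :: int where m: "m \<noteq> 0" "\<gamma> powi m \<in> mult_group_product N K" using g(1) by (auto simp: assms(6))
    \<comment> \<open>A negative exponent is made positive by inverting, under which the product of
      the groups is closed.\<close>
    have "\<gamma> ^ nat \<bar>m\<bar> \<in> mult_group_product N K"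
    proof (cases "m > 0")
      case True
      then show ?thesis using m(2) by (simp add: power_int_def)
    next
      case False
      then have "inverse (\<gamma> powi m) = \<gamma> ^ nat \<bar>m\<bar>" using m(1) by (simp add: power_int_def power_inverse)
      then show ?thesis using mult_group_product_inverse[OF sub m(2)] by simp
    qed
    then have "avg Q E \<le> C * avg Q (\<alpha> / \<gamma>)"
      unfolding E_def using m(1)
      by (intro avg_kills_le_quotient[OF _ assms(5) gQ _ _ Q C(1) C(2)[OF Q], of "nat \<bar>m\<bar>"]) auto
    also have "\<dots> \<le> C * (2 * weil_height (\<alpha> / \<gamma>))"
      by (rule mult_left_mono[OF avg_le_weil_height[OF Q Qb.div[OF assms(4) gQ(1)]] C(1)])
        (use assms(5) gQ(2) in simp)
    also have "\<dots> \<le> C * (2 * d)" using g(2) C(1) by (intro mult_left_mono) auto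
    also have "\<dots> \<le> (2 * C + 1) * d" using d by (simp add: algebra_simps)
    also have "\<dots> = 0 + e" using C(1) by (simp add: d_def)
    finally show "avg Q E \<le> 0 + e" .
  qed
  then obtain k where k: "k > 0" "E ^ k = 1" using avg_zero_imp_root_of_unity[OF E] by blast
  obtain M c where M: "M > 0" "c \<in> mult_group_product N K" "\<alpha> ^ M = E * c"
    unfolding E_def using kills_power_eq[OF aL assms(5), of N] by auto
  have "\<alpha> ^ (M * k) = c ^ k" using k(2) by (simp add: power_mult M(3) power_mult_distrib)
  then have "\<alpha> ^ (M * k) \<in> mult_group_product N K"
    using mult_group_product_power[OF sub M(2)] by simp
  then have "\<alpha> powi int (M * k) \<in> mult_group_product N K" by (simp only: power_int_of_nat)
  then show "\<alpha> \<in> \<Gamma>" unfolding assms(6) using assms(4,5) M(1) k(1)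
    by (auto intro!: exI[of _ "int (M * k)"])
qed

end
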